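(* Let $p\ge 1$ and $q$ be coprime integers and let $k\ge 0$ be an integer. The eigenspace of the Laplacian on the lens space $L(p,q)$ with wave number $k$ (i.e. $\nabla^2\Psi=-k(k+2)\Psi$) has an orthonormal basis which, when lifted to $\mathbb{Z}_p$-invariant eigenmodes of $S^3$, consists of exactly the following functions, where $\ell$ and $m$ range over positive integers and a function is listed only when the $\Psi_{k,\cdot,\cdot}$ occurring in it exist (recall that $\Psi_{k\ell m}$ exists if and only if $|\ell|+|m|\le k$ and $\ell+m\equiv k\pmod 2$): 1. $\Psi_{k,0,0}$, always; 2. $\Psi_{k,+\ell,0}$ and $\Psi_{k,-\ell,0}$, whenever $\ell\equiv 0\pmod p$; 3. $\Psi_{k,0,+m}$ and $\Psi_{k,0,-m}$, whenever $qm\equiv 0\pmod p$; 4. $\sqrt{\tfrac12}\,(\Psi_{k,+\ell,+m}+\Psi_{k,-\ell,-m})$ and $\sqrt{\tfrac12}\,(\Psi_{k,-\ell,+m}-\Psi_{k,+\ell,-m})$, whenever $\ell\equiv qm\pmod p$; 5. $\sqrt{\tfrac12}\,(\Psi_{k,+\ell,+m}-\Psi_{k,-\ell,-m})$ and $\sqrt{\tfrac12}\,(\Psi_{k,-\ell,+m}+\Psi_{k,+\ell,-m})$, whenever $\ell\equiv -qm\pmod p$.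
   Context: $S^3=\{(x,y,z,w)\in\mathbb{R}^4 : x^2+y^2+z^2+w^2=1\}$ carries its standard round metric, with volume form $dV$ and Laplacian $\nabla^2$ (divergence of the gradient). Functions are smooth and real-valued. Toroidal coordinates $(\chi,\theta,\varphi)$ on $S^3$, with $0\le\chi\le\pi/2$, $0\le\theta\le 2\pi$, $0\le\varphi\le 2\pi$ (angles $\theta,\varphi$ taken mod $2\pi$), are defined by $$x=\cos\chi\cos\theta,\quad y=\cos\chi\sin\theta,\quad z=\sin\chi\cos\varphi,\quad w=\sin\chi\sin\varphi .$$ For an integer $k\ge 0$ (the wave number) and integers $\ell,m$ with $|\ell|+|m|\le k$ and $\ell+m\equiv k\pmod 2$ (exactly then we say $\Psi_{k\ell m}$ exists), put $d=\frac{k-(|\ell|+|m|)}{2}$ and $$X_{k\ell m}(\chi)=\cos^{|\ell|}\chi\,\sin^{|m|}\chi\;P_d^{(|m|,|\ell|)}(\cos 2\chi),$$ where $P_d^{(|m|,|\ell|)}$ is the Jacobi polynomial $$P_d^{(|m|,|\ell|)}(u)=\frac{1}{2^d}\sum_{i=0}^d\binom{|m|+d}{i}\binom{|\ell|+d}{d-i}(u+1)^i(u-1)^{d-i}.$$ Let $\Theta_\ell(\theta)=\cos(|\ell|\theta)$ if $\ell\ge 0$ and $\Theta_\ell(\theta)=\sin(|\ell|\theta)$ if $\ell<0$; let $\Phi_m(\varphi)=\cos(|m|\varphi)$ if $m\ge 0$ and $\Phi_m(\varphi)=\sin(|m|\varphi)$ if $m<0$. Set $\widetilde\Psi_{k\ell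 m}(\chi,\theta,\varphi)=X_{k\ell m}(\chi)\,\Theta_\ell(\theta)\,\Phi_m(\varphi)$, regarded as a function on $S^3$ (with the convention $0^0=1$), and $$\Psi_{k\ell m}=\frac{\widetilde\Psi_{k\ell m}}{\sqrt{2^{\hat\ell+\hat m}}\;\pi\;\sqrt{\frac{(|\ell|+d)!\,(|m|+d)!}{2(k+1)\,d!\,(|\ell|+|m|+d)!}}},$$ where $\hat\ell=1$ if $\ell=0$ and $\hat\ell=0$ otherwise, and $\hat m=1$ if $m=0$ and $\hat m=0$ otherwise. The lens space $L(p,q)$ is the quotient of $S^3$ by the cyclic group $\mathbb{Z}_p$ generated by the isometry $(\chi,\theta,\varphi)\mapsto(\chi,\theta+2\pi/p,\varphi+2\pi q/p)$, with the induced metric. Functions on $L(p,q)$ are identified with their lifts, the $\mathbb{Z}_p$-invariant functions on $S^3$; orthonormality is with respect to the inner product $\langle f,g\rangle=\int_{S^3}fg\,dV$ of the lifts. *)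

theory Defs
  imports "HOL-Analysis.Analysis" "HOL-Number_Theory.Cong"
begin

abbreviation S3 :: "(real^4) set" where
  "S3 \<equiv> sphere 0 1"

text \<open>
  A real function on \<open>S3\<close> is represented by a function on the ambient space of which only the
  values on \<open>S3\<close> matter. Where functions on \<open>S3\<close> have to be equal as HOL functions (modes, lifts),
  they are taken to vanish outside \<open>S3\<close>, so that pointwise linear combinations keep this form.
\<close>

subsection \<open>Smooth functions and the Laplacian on the round sphere\<close>

primrec Ck_on :: "nat \<Rightarrow> (real^4) set \<Rightarrow> (real^4 \<Rightarrow> real) \<Rightarrow> bool" where
  "Ck_on 0 U g \<longleftrightarrow> continuous_on U g"
| "Ck_on (Suc n) U g \<longleftrightarrow> (\<forall>x\<in>U. g differentiable at x) \<and>
     (\<forall>v. Ck_on n U (\<lambda>x. frechet_derivative g (at x) v))"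

definition smooth_on_S3 :: "(real^4 \<Rightarrow> real) \<Rightarrow> bool" where
  "smooth_on_S3 f \<longleftrightarrow> (\<forall>x\<in>S3. \<exists>U g. open U \<and> x \<in> U \<and> (\<forall>n. Ck_on n U g) \<and> (\<forall>y\<in>U \<inter> S3. g y = f y))"

text \<open>
  The tangent space at \<open>x \<in> S3\<close> is the orthogonal complement of \<open>x\<close>. The derivative
  \<open>frechet_derivative f (at x within S3)\<close> depends only on \<open>f\<close> restricted to \<open>S3\<close>; it is determined
  by \<open>f\<close> on tangent vectors, and arbitrary in the normal direction, so below it is applied to
  tangent vectors only.
\<close>

definition S3_grad :: "(real^4 \<Rightarrow> real) \<Rightarrow> real^4 \<Rightarrow> real^4" where
  "S3_grad f x = (THE g. g \<bullet> x = 0 \<and>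
     (\<forall>v. v \<bullet> x = 0 \<longrightarrow> g \<bullet> v = frechet_derivative f (at x within S3) v))"

definition tangent_proj :: "real^4 \<Rightarrow> real^4 \<Rightarrow> real^4" where
  "tangent_proj x v = v - (v \<bullet> x) *\<^sub>R x"

text \<open>
  The Levi-Civita connection of the round metric is the tangential part of the ambient derivative.
  The divergence is the trace of \<open>v \<mapsto> \<nabla>\<^sub>v V\<close> over the tangent space, computed here as the trace over
  the ambient space of this map composed with the tangential projection.
\<close>

definition S3_covariant_derivative :: "(real^4 \<Rightarrow> real^4) \<Rightarrow> real^4 \<Rightarrow> real^4 \<Rightarrow> real^4" where
  "S3_covariant_derivative V x v = tangent_proj x (frechet_derivative V (at x within S3) v)"

definition S3_div :: "(real^4 \<Rightarrow> real^4) \<Rightarrow> real^4 \<Rightarrow> real" where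
  "S3_div V x = (\<Sum>e\<in>Basis. e \<bullet> S3_covariant_derivative V x (tangent_proj x e))"

definition S3_laplacian :: "(real^4 \<Rightarrow> real) \<Rightarrow> real^4 \<Rightarrow> real" where
  "S3_laplacian f = S3_div (S3_grad f)"

subsection \<open>Toroidal coordinates and the volume form\<close>

definition toroidal :: "real \<Rightarrow> real \<Rightarrow> real \<Rightarrow> real^4" where
  "toroidal chi \<theta> \<phi> = vector [cos chi * cos \<theta>, cos chi * sin \<theta>, sin chi * cos \<phi>, sin chi * sin \<phi>]"

definition toroidal_frame :: "real \<Rightarrow> real \<Rightarrow> real \<Rightarrow> real^4^3" where
  "toroidal_frame chi \<theta> \<phi> = vector
     [vector_derivative (\<lambda>t. toroidal t \<theta> \<phi>) (at chi),
      vector_derivative (\<lambda>t. toroidal chi t \<phi>) (at \<theta>),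
      vector_derivative (\<lambda>t. toroidal chi \<theta> t) (at \<phi>)]"

text \<open>
  The matrix below is the metric tensor in toroidal coordinates, so this is the coefficient
  \<open>sqrt (det g)\<close> of the volume form; it equals \<open>cos chi * sin chi\<close> on the coordinate range.
  The coordinates are injective there up to a null set.
\<close>

definition toroidal_density :: "real \<Rightarrow> real \<Rightarrow> real \<Rightarrow> real" where
  "toroidal_density chi \<theta> \<phi> =
     sqrt (det (toroidal_frame chi \<theta> \<phi> ** transpose (toroidal_frame chi \<theta> \<phi>)))"

definition S3_integral :: "(real^4 \<Rightarrow> real) \<Rightarrow> real" where
  "S3_integral h = set_lebesgue_integral lborel ({0..pi/2} \<times> {0..2*pi} \<times> {0..2*pi})
     (\<lambda>(chi, \<theta>, \<phi>). h (toroidal chi \<theta> \<phi>) * toroidal_density chi \<theta> \<phi>)"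

lemma toroidal_density_eq: "toroidal_density chi \<theta> \<phi> = \<bar>cos chi * sin chi\<bar>"
proof -
  have vec: "((\<lambda>t. vector [a t, b t, c t, d t] :: real^4) has_vector_derivative vector [a', b', c', d'])
      (at t)"
    if "(a has_real_derivative a') (at t)" "(b has_real_derivative b') (at t)"
       "(c has_real_derivative c') (at t)" "(d has_real_derivative d') (at t)"
    for a b c d :: "real \<Rightarrow> real" and a' b' c' d' t
  proof -
    have eq: "(vector [p, q, r, s] :: real^4) =
        p *\<^sub>R axis 1 1 + q *\<^sub>R axis 2 1 + r *\<^sub>R axis 3 1 + s *\<^sub>R axis 4 1" for p q r s :: real
      by (simp add: vec_eq_iff forall_4 axis_def vector_def)
    show ?thesis
      unfolding eq using that
      by (auto intro!: derivative_eq_intros simp: has_real_derivative_iff_has_vector_derivative)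
  qed
  have frame: "toroidal_frame chi \<theta> \<phi> = vector
     [vector [- sin chi * cos \<theta>, - sin chi * sin \<theta>, cos chi * cos \<phi>, cos chi * sin \<phi>],
      vector [- cos chi * sin \<theta>, cos chi * cos \<theta>, 0, 0],
      vector [0, 0, - sin chi * sin \<phi>, sin chi * cos \<phi>]]"
    unfolding toroidal_frame_def toroidal_def
    by (intro arg_cong[where f = vector] arg_cong2[where f = Cons] refl vector_derivative_at vec)
       (auto intro!: derivative_eq_intros)
  have ent: "(M ** transpose M) $ i $ j = M $ i \<bullet> M $ j" for M :: "real^4^3" and i j
    by (simp add: matrix_matrix_mult_def transpose_def inner_vec_def)
  have i4: "(vector [a, b, c, d] :: real^4) \<bullet> vector [a', b', c', d'] = a*a' + b*b' + c*c' + d*d'"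
    for a b c d a' b' c' d' :: real
    by (simp add: inner_vec_def sum_4 vector_def)
  have g11: "- sin chi * cos \<theta> * (- sin chi * cos \<theta>) + - sin chi * sin \<theta> * (- sin chi * sin \<theta>)
      + cos chi * cos \<phi> * (cos chi * cos \<phi>) + cos chi * sin \<phi> * (cos chi * sin \<phi>) = 1" (is "?l = 1")
  proof -
    have "?l = (sin chi)\<^sup>2 * ((sin \<theta>)\<^sup>2 + (cos \<theta>)\<^sup>2) + (cos chi)\<^sup>2 * ((sin \<phi>)\<^sup>2 + (cos \<phi>)\<^sup>2)"
      by (simp only: power2_eq_square) (simp only: algebra_simps minus_mult_minus)
    then show ?thesis by simp
  qed
  have sq: "- r * sin x * (- r * sin x) + r * cos x * (r * cos x) = r\<^sup>2" for r x :: real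
  proof -
    have "- r * sin x * (- r * sin x) + r * cos x * (r * cos x) = r\<^sup>2 * ((sin x)\<^sup>2 + (cos x)\<^sup>2)"
      by (simp only: power2_eq_square) (simp only: algebra_simps minus_mult_minus)
    then show ?thesis by simp
  qed
  define G where "G = toroidal_frame chi \<theta> \<phi> ** transpose (toroidal_frame chi \<theta> \<phi>)"
  have diag: "G $ 1 $ 1 = 1" "G $ 2 $ 2 = (cos chi)\<^sup>2" "G $ 3 $ 3 = (sin chi)\<^sup>2"
    unfolding G_def frame ent vector_3 i4
    using g11 sq[of "cos chi" \<theta>] sq[of "sin chi" \<phi>] by simp_all
  have off: "G $ 1 $ 2 = 0" "G $ 2 $ 1 = 0" "G $ 1 $ 3 = 0" "G $ 3 $ 1 = 0" "G $ 2 $ 3 = 0" "G $ 3 $ 2 = 0"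
    unfolding G_def frame ent vector_3 i4 by simp_all
  have "det G = (cos chi * sin chi)\<^sup>2"
    unfolding det_3 diag off by (simp add: power_mult_distrib)
  then show ?thesis
    by (simp add: toroidal_density_def G_def)
qed

subsection \<open>The modes\<close>

definition mode_exists :: "nat \<Rightarrow> int \<Rightarrow> int \<Rightarrow> bool" where
  "mode_exists k l m \<longleftrightarrow> \<bar>l\<bar> + \<bar>m\<bar> \<le> int k \<and> [l + m = int k] (mod 2)"

lemma mode_exists_minus [simp]:
  "mode_exists k (- l) m \<longleftrightarrow> mode_exists k l m"
  "mode_exists k l (- m) \<longleftrightarrow> mode_exists k l m"
  by (auto simp: mode_exists_def cong_iff_dvd_diff)

definition jacobi :: "nat \<Rightarrow> nat \<Rightarrow> nat \<Rightarrow> real \<Rightarrow> real" where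
  "jacobi a b d u = 1 / 2 ^ d *
     (\<Sum>i=0..d. real ((a + d) choose i) * real ((b + d) choose (d - i)) * (u + 1) ^ i * (u - 1) ^ (d - i))"

definition mode_deg :: "nat \<Rightarrow> int \<Rightarrow> int \<Rightarrow> nat" where
  "mode_deg k l m = (k - (nat \<bar>l\<bar> + nat \<bar>m\<bar>)) div 2"

definition mode_X :: "nat \<Rightarrow> int \<Rightarrow> int \<Rightarrow> real \<Rightarrow> real" where
  "mode_X k l m chi = cos chi ^ nat \<bar>l\<bar> * sin chi ^ nat \<bar>m\<bar> *
     jacobi (nat \<bar>m\<bar>) (nat \<bar>l\<bar>) (mode_deg k l m) (cos (2 * chi))"

definition mode_angular :: "int \<Rightarrow> real \<Rightarrow> real" where
  "mode_angular l \<theta> = (if l \<ge> 0 then cos (\<bar>l\<bar> * \<theta>) else sin (\<bar>l\<bar> * \<theta>))"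

definition mode_tilde :: "nat \<Rightarrow> int \<Rightarrow> int \<Rightarrow> real \<Rightarrow> real \<Rightarrow> real \<Rightarrow> real" where
  "mode_tilde k l m chi \<theta> \<phi> = mode_X k l m chi * mode_angular l \<theta> * mode_angular m \<phi>"

definition mode_norm :: "nat \<Rightarrow> int \<Rightarrow> int \<Rightarrow> real" where
  "mode_norm k l m =
     (let d = mode_deg k l m; a = nat \<bar>l\<bar>; b = nat \<bar>m\<bar>;
          l_hat = (if l = 0 then 1 else 0 :: nat); m_hat = (if m = 0 then 1 else 0 :: nat)
      in sqrt (2 ^ (l_hat + m_hat)) * pi *
         sqrt (fact (a + d) * fact (b + d) / (2 * (real k + 1) * fact d * fact (a + b + d))))"

text \<open>
  The function on \<open>S3\<close> with a given coordinate expression. The expression has to give the same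
  value for all coordinates of a point; for the modes this holds also where \<open>\<theta>\<close> or \<open>\<phi>\<close> is
  undetermined, because there either the exponent is \<open>0\<close> or the power of \<open>cos chi\<close> or \<open>sin chi\<close> vanishes.
\<close>

definition from_toroidal :: "(real \<Rightarrow> real \<Rightarrow> real \<Rightarrow> real) \<Rightarrow> real^4 \<Rightarrow> real" where
  "from_toroidal h x = (if x \<in> S3
     then THE v. \<exists>chi\<in>{0..pi/2}. \<exists>\<theta>\<in>{0..2*pi}. \<exists>\<phi>\<in>{0..2*pi}. x = toroidal chi \<theta> \<phi> \<and> v = h chi \<theta> \<phi>
     else 0)"

definition Psi :: "nat \<Rightarrow> int \<Rightarrow> int \<Rightarrow> real^4 \<Rightarrow> real" where
  "Psi k l m = from_toroidal (\<lambda>chi \<theta> \<phi>. mode_tilde k l m chi \<theta> \<phi> / mode_norm k l m)"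

subsection \<open>Lens spaces\<close>

definition lens_rot :: "int \<Rightarrow> int \<Rightarrow> real^4 \<Rightarrow> real^4" where
  "lens_rot p q x =
     (let \<alpha> = 2 * pi / p; \<beta> = 2 * pi * q / p
      in vector [cos \<alpha> * x$1 - sin \<alpha> * x$2, sin \<alpha> * x$1 + cos \<alpha> * x$2,
                 cos \<beta> * x$3 - sin \<beta> * x$4, sin \<beta> * x$3 + cos \<beta> * x$4])"

lemma lens_rot_toroidal:
  "lens_rot p q (toroidal chi \<theta> \<phi>) = toroidal chi (\<theta> + 2 * pi / p) (\<phi> + 2 * pi * q / p)"
  unfolding lens_rot_def toroidal_def Let_def
  by (simp add: vec_eq_iff forall_4 vector_def) (simp add: cos_add sin_add right_diff_distrib distrib_left mult_ac)

text \<open>\<open>lens_rot p q\<close> has finite order for \<open>p \<ge> 1\<close>, so its natural powers form the group it generates.\<close>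

definition lens_orbit :: "int \<Rightarrow> int \<Rightarrow> real^4 \<Rightarrow> (real^4) set" where
  "lens_orbit p q x = {(lens_rot p q ^^ n) x | n. True}"

definition lens_space :: "int \<Rightarrow> int \<Rightarrow> (real^4) set set" where
  "lens_space p q = lens_orbit p q ` S3"

text \<open>
  A function on the lens space vanishes at arguments that are not points of it; hence its lift
  vanishes outside \<open>S3\<close>. The projection is a local isometry, so smoothness, Laplacian and
  inner product are those of the lifts.
\<close>

definition lens_functions :: "int \<Rightarrow> int \<Rightarrow> ((real^4) set \<Rightarrow> real) set" where
  "lens_functions p q = {F. \<forall>c. c \<notin> lens_space p q \<longrightarrow> F c = 0}"

definition lens_lift :: "int \<Rightarrow> int \<Rightarrow> ((real^4) set \<Rightarrow> real) \<Rightarrow> real^4 \<Rightarrow> real" where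
  "lens_lift p q F x = F (lens_orbit p q x)"

definition lens_eigenspace :: "int \<Rightarrow> int \<Rightarrow> nat \<Rightarrow> ((real^4) set \<Rightarrow> real) set" where
  "lens_eigenspace p q k = {F \<in> lens_functions p q. smooth_on_S3 (lens_lift p q F) \<and>
     (\<forall>x\<in>S3. S3_laplacian (lens_lift p q F) x = - (real k * (real k + 2)) * lens_lift p q F x)}"

definition lens_inner :: "int \<Rightarrow> int \<Rightarrow> ((real^4) set \<Rightarrow> real) \<Rightarrow> ((real^4) set \<Rightarrow> real) \<Rightarrow> real" where
  "lens_inner p q F G = S3_integral (\<lambda>x. lens_lift p q F x * lens_lift p q G x)"

definition fun_span :: "('a \<Rightarrow> real) set \<Rightarrow> ('a \<Rightarrow> real) set" where
  "fun_span B = {\<lambda>x. \<Sum>b\<in>A. c b * b x | A c. finite A \<and> A \<subseteq> B}"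

definition orthonormal_basis ::
  "(('a \<Rightarrow> real) \<Rightarrow> ('a \<Rightarrow> real) \<Rightarrow> real) \<Rightarrow> ('a \<Rightarrow> real) set \<Rightarrow> ('a \<Rightarrow> real) set \<Rightarrow> bool" where
  "orthonormal_basis ip E B \<longleftrightarrow>
     fun_span B = E \<and> (\<forall>b\<in>B. \<forall>b'\<in>B. ip b b' = (if b = b' then 1 else 0))"

end

theory Submission
  imports Defs
begin

text \<open>
  In toroidal coordinates the real combinations of modes in the theorem become a radial factor times
  \<open>cos (l * \<theta> + m * \<phi> + \<delta>)\<close> with \<open>\<delta> \<in> {0, - pi / 2}\<close>; such a function restricts from a polynomial on
  the ambient space, and averaging over the group of the lens space fixes it if \<open>p dvd l + q * m\<close> and
  kills it otherwise. So it suffices that these functions form an orthonormal basis of the eigenspace on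
  \<open>S3\<close>. The radial factor solves the separated equation because the Jacobi polynomial solves the
  hypergeometric one, and its norm comes from Beta integrals, since the Jacobi polynomial of degree \<open>d\<close>
  is orthogonal to lower powers of \<open>(cos chi)\<^sup>2\<close>. For completeness, the Laplacian is symmetric: multiplied by
  \<open>cos chi * sin chi\<close>, the integrand \<open>(\<Delta> f) h - f (\<Delta> h)\<close> is a sum of derivatives along \<open>chi\<close>, \<open>\<theta>\<close> and
  \<open>\<phi>\<close> whose boundary terms vanish or cancel. Hence an eigenfunction minus its projection to the modes
  of its own wave number is orthogonal to all modes, these span all polynomials, and Stone-Weierstrass
  shows that it vanishes.
\<close>

section \<open>Jacobi polynomials\<close>

text \<open>The product of an angular factor in theta and one in phi mixes the frequencies (l, m)
  and (l, - m), which the generator of the group treats differently: it shifts the phase of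
  \<open>cos (l * \<theta> + m * \<phi> + \<delta>)\<close> by 2 pi (l + q m) / p. The two-term
  combinations undo this mixing, and \<open>sqrt (1/2)\<close> restores the norm. The obstacle is
  that the coordinates degenerate on the two circles chi = 0 and chi = pi / 2, while the Laplacian
  is defined intrinsically, as divergence of gradient within the sphere. It is therefore computed
  from an arbitrary C2 extension to the ambient space, where nothing is singular; the coordinate
  formula is derived for interior chi only, and identities reach the circles by continuity. The
  volume, on the other hand, is given in coordinates, so symmetry of the Laplacian has to be proved
  there, in spite of the singular coefficients.\<close>

definition Jpoly :: "nat \<Rightarrow> nat \<Rightarrow> nat \<Rightarrow> real poly" where
  "Jpoly a b d = (\<Sum>i\<le>d. smult (real ((a + d) choose i) * real ((b + d) choose (d - i)))
     ([:0, 1:] ^ i * [:-1, 1:] ^ (d - i)))"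

lemma poly_Jpoly:
  "poly (Jpoly a b d) t =
     (\<Sum>i\<le>d. real ((a + d) choose i) * real ((b + d) choose (d - i)) * (t ^ i * (t - 1) ^ (d - i)))"
  by (simp add: Jpoly_def poly_sum algebra_simps)

text \<open>With u = 2t - 1 the factors u + 1 and u - 1 become 2t and 2(t - 1), so the powers of 2
  cancel the prefactor. For t = cos^2 chi, the squared length of the first two coordinates, the
  radial factor becomes polynomial on the ambient space.\<close>

lemma jacobi_eq_Jpoly: "jacobi a b d (2 * t - 1) = poly (Jpoly a b d) t"
proof -
  have "1 / 2 ^ d * (real ((a + d) choose i) * real ((b + d) choose (d - i)) * (2 * t - 1 + 1) ^ i * (2 * t - 1 - 1) ^ (d - i))
     = real ((a + d) choose i) * real ((b + d) choose (d - i)) * (t ^ i * (t - 1) ^ (d - i))" if "i \<le> d" for i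
  proof -
    define w where "w = t - 1"
    have e: "2 * t - 1 + 1 = 2 * t" "2 * t - 1 - 1 = 2 * w" by (simp_all add: w_def)
    have "(2::real) ^ d = 2 ^ i * 2 ^ (d - i)" using that by (simp flip: power_add)
    then show ?thesis unfolding e w_def[symmetric] by (simp add: power_mult_distrib)
  qed
  then show ?thesis
    unfolding jacobi_def poly_Jpoly sum_distrib_left atMost_atLeast0 by (intro sum.cong) auto
qed

lemma degree_Jpoly_le: "degree (Jpoly a b d) \<le> d"
  unfolding Jpoly_def
proof (rule degree_sum_le)
  fix i assume "i \<in> {..d}"
  have "degree (([:0, 1:] ^ i * [:-1, 1:] ^ (d - i)) :: real poly) = i + (d - i)"
    by (subst degree_mult_eq) (auto simp: degree_power_eq)
  then show "degree (smult (real ((a + d) choose i) * real ((b + d) choose (d - i)))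
     ([:0, 1:] ^ i * [:-1, 1:] ^ (d - i))) \<le> d"
    using \<open>i \<in> {..d}\<close> by (metis atMost_iff degree_smult_le le_add_diff_inverse)
qed simp

text \<open>Every product t^i (t - 1)^(d - i) is monic of degree \<open>d\<close>, so the leading
  coefficient is a Vandermonde sum. It is nonzero, so the degree is exactly \<open>d\<close>, on
  which both the norm and the completeness argument rely.\<close>

lemma coeff_Jpoly: "coeff (Jpoly a b d) d = real ((a + b + 2 * d) choose d)"
proof -
  have "coeff (([:0, 1:] ^ i * [:-1, 1:] ^ (d - i)) :: real poly) d = 1" if "i \<le> d" for i
  proof -
    have "degree (([:0, 1:] ^ i * [:-1, 1:] ^ (d - i)) :: real poly) = d"
      using that by (subst degree_mult_eq) (auto simp: degree_power_eq)
    moreover have "lead_coeff (([:0, 1:] ^ i * [:-1, 1:] ^ (d - i)) :: real poly) = 1"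
      by (simp add: lead_coeff_mult lead_coeff_power)
    ultimately show ?thesis by simp
  qed
  then have "coeff (Jpoly a b d) d = (\<Sum>i\<le>d. real ((a + d) choose i) * real ((b + d) choose (d - i)))"
    unfolding Jpoly_def coeff_sum by (intro sum.cong) auto
  also have "\<dots> = real (\<Sum>i\<le>d. ((a + d) choose i) * ((b + d) choose (d - i)))" by simp
  also have "\<dots> = real ((a + d + (b + d)) choose d)" by (subst vandermonde) simp
  also have "a + d + (b + d) = a + b + 2 * d" by simp
  finally show ?thesis .
qed

lemma degree_Jpoly: "degree (Jpoly a b d) = d"
proof (rule antisym[OF degree_Jpoly_le le_degree])
  have "((a + b + 2 * d) choose d) \<noteq> 0" by (simp add: binomial_eq_0_iff)
  then show "coeff (Jpoly a b d) d \<noteq> 0" unfolding coeff_Jpoly by linarith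
qed

text \<open>Absorption in each binomial factor gives the ratio of consecutive coefficients of
  \<open>Jpoly\<close>. This recurrence lets the sums in the differential equation be
  reindexed.\<close>

lemma Jpoly_coeff_step:
  assumes "i < d"
  shows "real ((a + d) choose Suc i) * real ((b + d) choose (d - Suc i)) * real (Suc i) * real (Suc i + b)
    = real ((a + d) choose i) * real ((b + d) choose (d - i)) * real (d - i) * real (d - i + a)"
proof -
  obtain m where m: "d = Suc (i + m)" using assms less_imp_Suc_add by blast
  have "Suc i * ((a + d) choose Suc i) = (a + d - i) * ((a + d) choose i)"
    by (simp only: binomial_absorption binomial_absorb_comp)
  then have 1: "real ((a + d) choose Suc i) * real (Suc i) = real ((a + d) choose i) * real (d - i + a)"
    using m by (metis add.commute assms diff_add_assoc2 less_imp_le mult.commute of_nat_mult)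
  have "Suc m * ((b + d) choose Suc m) = (b + d - m) * ((b + d) choose m)"
    by (simp only: binomial_absorption binomial_absorb_comp)
  moreover have "b + d - m = Suc i + b" "d - i = Suc m" "d - Suc i = m" using m by auto
  ultimately have 2: "real ((b + d) choose (d - Suc i)) * real (Suc i + b) = real ((b + d) choose (d - i)) * real (d - i)"
    by (metis mult.commute of_nat_mult)
  have "(real ((a + d) choose Suc i) * real (Suc i)) * (real ((b + d) choose (d - Suc i)) * real (Suc i + b))
    = (real ((a + d) choose i) * real (d - i + a)) * (real ((b + d) choose (d - i)) * real (d - i))"
    by (simp only: 1 2)
  then show ?thesis by (simp only: mult_ac)
qed

text \<open>The hypergeometric operator, with sign reversed, sends the product with exponents (i, j)
  to its two neighbours and itself. The truncated exponents i - 1 and j - 1 are harmless, since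
  their coefficients contain the factor i or j.\<close>

lemma hypergeometric_term:
  fixes t a b :: real
  defines "T \<equiv> \<lambda>i j. [:0, 1:] ^ i * [:-1, 1:] ^ j :: real poly"
  shows "t * (t - 1) * poly (pderiv (pderiv (T i j))) t + ((a + 1) * t + (b + 1) * (t - 1)) * poly (pderiv (T i j)) t
    = real i * (real i + b) * (t ^ (i - 1) * (t - 1) ^ (j + 1)) + real j * (real j + a) * (t ^ (i + 1) * (t - 1) ^ (j - 1))
      + (2 * real i * real j + (a + 1) * real i + (b + 1) * real j) * (t ^ i * (t - 1) ^ j)"
proof -
  have d: "pderiv [:0, 1::real:] = 1" "pderiv [:-1, 1::real:] = 1" by (simp_all add: pderiv_pCons)
  have d1: "pderiv (T i j) = smult (real i) (T (i - 1) j) + smult (real j) (T i (j - 1))" for i j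
    unfolding T_def by (simp add: pderiv_mult pderiv_power d mult_ac)
  have p: "poly (T i j) t = t ^ i * (t - 1) ^ j" for i j
    by (simp add: T_def algebra_simps)
  have e: "poly (pderiv (T i j)) t = real i * (t ^ (i - 1) * (t - 1) ^ j) + real j * (t ^ i * (t - 1) ^ (j - 1))" for i j
    by (simp add: d1 p)
  have e2: "poly (pderiv (pderiv (T i j))) t = real i * poly (pderiv (T (i - 1) j)) t + real j * poly (pderiv (T i (j - 1))) t"
    unfolding d1[of i j] by (simp add: pderiv_add pderiv_smult)
  define u where "u = t - 1"
  \<comment> \<open>Second derivatives involve i - 2 and j - 2 in truncated subtraction, so the
    exponents 0, 1 and larger ones are separated.\<close>
  have ex: "n = 0 \<or> n = 1 \<or> (\<exists>k. n = Suc (Suc k))" for n :: nat by presburger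
  show ?thesis
    unfolding e2 e u_def[symmetric]
    using ex[of i] ex[of j] by (elim disjE exE) (simp_all add: algebra_simps)
qed

text \<open>By the coefficient recurrence both neighbour terms can be shifted back onto t^i (t -
  1)^(d - i); the factors then add up to d (d + a + b + 1), independently of i.\<close>

lemma Jpoly_ode:
  "t * (1 - t) * poly (pderiv (pderiv (Jpoly a b d))) t
    + (real b + 1 - (real a + real b + 2) * t) * poly (pderiv (Jpoly a b d)) t
    + real d * (real d + real a + real b + 1) * poly (Jpoly a b d) t = 0"
proof -
  define c where "c i = real ((a + d) choose i) * real ((b + d) choose (d - i))" for i
  define T where "T i = t ^ i * (t - 1) ^ (d - i)" for i
  \<comment> \<open>The term \<open>i = 0\<close> on the left and the term \<open>i = d\<close> on
    the right vanish, so the recurrence matches \<open>Suc i\<close> with \<open>i\<close>.\<close>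
  have s1: "(\<Sum>i\<le>d. c i * (real i * (real i + real b) * (t ^ (i - 1) * (t - 1) ^ (d - i + 1))))
      = (\<Sum>i\<le>d. c i * (real (d - i) * (real (d - i) + real a)) * T i)"
  proof (cases d)
    case (Suc e)
    have "c (Suc i) * (real (Suc i) * (real (Suc i) + real b) * (t ^ (Suc i - 1) * (t - 1) ^ (d - Suc i + 1)))
      = c i * (real (d - i) * (real (d - i) + real a)) * T i" if "i \<le> e" for i
    proof -
      have e: "d - Suc i + 1 = d - i" "i < d" using that Suc by auto
      have "c (Suc i) * (real (Suc i) * (real (Suc i) + real b)) = c i * (real (d - i) * (real (d - i) + real a))"
        using Jpoly_coeff_step[OF e(2), of a b] unfolding c_def by (simp only: mult_ac of_nat_add)
      then show ?thesis unfolding e T_def by (simp only: diff_Suc_1 mult.assoc[symmetric])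
    qed
    then show ?thesis
      unfolding Suc sum.atMost_Suc_shift[of _ e] sum.atMost_Suc[of "\<lambda>i. c i * (real (Suc e - i) * (real (Suc e - i) + real a)) * T i"]
      by (simp add: Suc)
  qed simp
  have s2: "(\<Sum>i\<le>d. c i * (real (d - i) * (real (d - i) + real a) * (t ^ (i + 1) * (t - 1) ^ (d - i - 1))))
      = (\<Sum>i\<le>d. c i * (real i * (real i + real b)) * T i)"
  proof (cases d)
    case (Suc e)
    have "c i * (real (d - i) * (real (d - i) + real a) * (t ^ (i + 1) * (t - 1) ^ (d - i - 1)))
      = c (Suc i) * (real (Suc i) * (real (Suc i) + real b)) * T (Suc i)" if "i \<le> e" for i
    proof -
      have e: "d - i - 1 = d - Suc i" "i < d" using that Suc by auto
      have "c i * (real (d - i) * (real (d - i) + real a)) = c (Suc i) * (real (Suc i) * (real (Suc i) + real b))"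
        using Jpoly_coeff_step[OF e(2), of a b] unfolding c_def by (simp only: mult_ac of_nat_add)
      then show ?thesis unfolding e T_def by (simp only: Suc_eq_plus1[symmetric] mult.assoc[symmetric])
    qed
    then show ?thesis
      unfolding Suc sum.atMost_Suc_shift[of "\<lambda>i. c i * (real i * (real i + real b)) * T i" e] sum.atMost_Suc[of _ e]
      by (simp add: Suc)
  qed simp
  have J: "poly (Jpoly a b d) t = (\<Sum>i\<le>d. c i * T i)"
    unfolding poly_Jpoly c_def T_def ..
  have J1: "poly (pderiv (Jpoly a b d)) t = (\<Sum>i\<le>d. c i * poly (pderiv ([:0, 1:] ^ i * [:-1, 1:] ^ (d - i))) t)"
    unfolding Jpoly_def c_def by (simp add: higher_pderiv_sum[where n = "Suc 0", simplified] poly_sum pderiv_smult)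
  have J2: "poly (pderiv (pderiv (Jpoly a b d))) t = (\<Sum>i\<le>d. c i * poly (pderiv (pderiv ([:0, 1:] ^ i * [:-1, 1:] ^ (d - i)))) t)"
    unfolding Jpoly_def c_def by (simp add: higher_pderiv_sum[where n = "Suc 0", simplified] poly_sum pderiv_smult)
  have "t * (t - 1) * poly (pderiv (pderiv (Jpoly a b d))) t
      + ((real a + 1) * t + (real b + 1) * (t - 1)) * poly (pderiv (Jpoly a b d)) t
    = (\<Sum>i\<le>d. c i * (t * (t - 1) * poly (pderiv (pderiv ([:0, 1:] ^ i * [:-1, 1:] ^ (d - i)))) t
      + ((real a + 1) * t + (real b + 1) * (t - 1)) * poly (pderiv ([:0, 1:] ^ i * [:-1, 1:] ^ (d - i))) t))"
    unfolding J1 J2 by (simp only: sum_distrib_left sum.distrib[symmetric]) (simp only: distrib_left mult_ac)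
  also have "\<dots> = (\<Sum>i\<le>d. c i * (real i * (real i + real b) * (t ^ (i - 1) * (t - 1) ^ (d - i + 1))))
     + (\<Sum>i\<le>d. c i * (real (d - i) * (real (d - i) + real a) * (t ^ (i + 1) * (t - 1) ^ (d - i - 1))))
     + (\<Sum>i\<le>d. c i * (2 * real i * real (d - i) + (real a + 1) * real i + (real b + 1) * real (d - i)) * T i)"
    unfolding hypergeometric_term 
    unfolding T_def by (simp only: sum.distrib[symmetric]) (intro sum.cong refl, simp only: distrib_left distrib_right mult.assoc)
  also have "\<dots> = (\<Sum>i\<le>d. c i * T i * (real (d - i) * (real (d - i) + real a) + real i * (real i + real b)
      + (2 * real i * real (d - i) + (real a + 1) * real i + (real b + 1) * real (d - i))))"
    unfolding s1 s2 by (simp add: sum.distrib[symmetric] algebra_simps)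
  also have "\<dots> = (\<Sum>i\<le>d. c i * T i * (real d * (real d + real a + real b + 1)))"
    by (intro sum.cong refl arg_cong2[where f = "(*)"]) (simp add: of_nat_diff algebra_simps)
  also have "\<dots> = real d * (real d + real a + real b + 1) * poly (Jpoly a b d) t"
    unfolding J sum_distrib_left by (intro sum.cong refl) (simp only: mult_ac)
  finally show ?thesis by (simp add: algebra_simps)
qed

section \<open>Finite differences, Beta integrals and the radial norm\<close>

text \<open>The d-th difference of n \<mapsto> n choose r. By Pascal's rule each difference lowers
  \<open>r\<close> by one, so nothing is left for r < d; this is the source of the orthogonality of
  the Jacobi polynomials to lower powers.\<close>

lemma alternating_binomial_sum:
  "(\<Sum>i\<le>d. (-1) ^ i * real (d choose i) * real ((N + d - i) choose r)) =
     (if d \<le> r then real (N choose (r - d)) else 0)"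
proof (induction d arbitrary: N)
  case (Suc d)
  have "(\<Sum>i\<le>Suc d. (-1) ^ i * real (Suc d choose i) * real ((N + Suc d - i) choose r))
     = real ((N + Suc d) choose r) + (\<Sum>i\<le>d. (-1) ^ Suc i * real (Suc d choose Suc i) * real ((N + d - i) choose r))"
    by (subst sum.atMost_Suc_shift) simp
  also have "\<dots> = real ((N + Suc d) choose r) + (\<Sum>i\<le>d. (-1) ^ Suc i * real (d choose Suc i) * real ((N + d - i) choose r))
      - (\<Sum>i\<le>d. (-1) ^ i * real (d choose i) * real ((N + d - i) choose r))"
    by (simp add: sum.distrib[symmetric] sum_subtractf[symmetric] sum_negf algebra_simps)
  also have "real ((N + Suc d) choose r) + (\<Sum>i\<le>d. (-1) ^ Suc i * real (d choose Suc i) * real ((N + d - i) choose r))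
     = (\<Sum>i\<le>Suc d. (-1) ^ i * real (d choose i) * real ((Suc N + d - i) choose r))"
    by (subst sum.atMost_Suc_shift) simp
  also have "\<dots> = (\<Sum>i\<le>d. (-1) ^ i * real (d choose i) * real ((Suc N + d - i) choose r))"
    by simp
  finally show ?case
    unfolding Suc.IH by (cases "Suc d \<le> r") (auto simp: Suc_diff_le not_less_eq_eq Suc_diff_Suc le_Suc_eq binomial_Suc_Suc dest!: le_Suc_ex)
qed simp

text \<open>Half of the Beta function at (p + 1, q + 1). Writing B(p, q) for the integral, the
  derivative of cos^(2p+2) sin^(2q+2) integrates to 0, so (q + 1) B(p + 1, q) = (p + 1) B(p, q + 1);
  with B(p, q) = B(p + 1, q) + B(p, q + 1) this determines B(p, q + 1) from B(p, q).\<close>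

lemma has_integral_cos_sin_power:
  "((\<lambda>x. cos x ^ (2 * p + 1) * sin x ^ (2 * q + 1)) has_integral
     fact p * fact q / (2 * fact (p + q + 1))) {0..pi / 2}"
proof (induction q arbitrary: p)
  case 0
  have "((\<lambda>x. cos x ^ (2 * p + 1) * sin x) has_integral
      (- (cos (pi / 2) ^ (2 * p + 2)) / (2 * real p + 2) - - (cos 0 ^ (2 * p + 2)) / (2 * real p + 2))) {0..pi / 2}"
  proof (intro fundamental_theorem_of_calculus)
    fix x assume "x \<in> {0..pi/2}"
    have "((\<lambda>x. - (cos x ^ n) / K) has_real_derivative - (real n * (cos x ^ (n - Suc 0) * - sin x)) / K)
        (at x within {0..pi / 2})" if "K \<noteq> 0" for n :: nat and K :: real
      using that by (auto intro!: derivative_eq_intros)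
    from this[where n = "2 * p + 2" and K = "2 * real p + 2"]
    have "((\<lambda>x. - (cos x ^ (2 * p + 2)) / (2 * real p + 2)) has_real_derivative
        - (real (2 * p + 2) * (cos x ^ (2 * p + 2 - Suc 0) * - sin x)) / (2 * real p + 2)) (at x within {0..pi / 2})"
      by linarith
    moreover have "- (real (2 * p + 2) * (cos x ^ (2 * p + 2 - Suc 0) * - sin x)) / (2 * real p + 2) = cos x ^ (2 * p + 1) * sin x"
    proof -
      have "- (n * (z * - s)) / n = z * s" if "n \<noteq> 0" for n z s :: real using that by simp
      moreover have "real (2 * p + 2) = 2 * real p + 2" "2 * p + 2 - Suc 0 = 2 * p + 1" by simp_all
      moreover have "2 * real p + 2 \<noteq> 0" by linarith
      ultimately show ?thesis by presburger
    qed
    ultimately show "((\<lambda>x. - (cos x ^ (2 * p + 2)) / (2 * real p + 2)) has_vector_derivative cos x ^ (2 * p + 1) * sin x) (at x within {0..pi / 2})"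
      by (simp add: has_real_derivative_iff_has_vector_derivative)
  qed auto
  moreover have "- (cos (pi / 2) ^ (2 * p + 2)) / (2 * real p + 2) - - (cos 0 ^ (2 * p + 2)) / (2 * real p + 2) = fact p * fact 0 / (2 * fact (p + 0 + 1))"
  proof -
    have 1: "fact (p + 0 + 1) = (real p + 1) * fact p" by (simp add: algebra_simps)
    have 2: "2 * real p + 2 = 2 * (real p + 1)" by simp
    have "real p + 1 \<noteq> 0" by linarith
    then show ?thesis unfolding 1 2 by simp
  qed
  ultimately show ?case by (simp add: add.commute)
next
  case (Suc q)
  let ?B = "\<lambda>p q. (\<lambda>x::real. cos x ^ (2 * p + 1) * sin x ^ (2 * q + 1))"
  have "((\<lambda>x. (2 * real q + 2) * ?B (Suc p) q x - (2 * real p + 2) * ?B p (Suc q) x) has_integral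
      (cos (pi / 2) ^ (2 * p + 2) * sin (pi/2) ^ (2 * q + 2) - cos 0 ^ (2 * p + 2) * sin 0 ^ (2 * q + 2))) {0..pi / 2}"
  proof (intro fundamental_theorem_of_calculus)
    fix x assume "x \<in> {0..pi/2}"
    have "((\<lambda>x. cos x ^ Suc m * sin x ^ Suc n) has_real_derivative
        (real n + 1) * (cos x ^ (m + 2) * sin x ^ n) - (real m + 1) * (cos x ^ m * sin x ^ (n + 2))) (at x within {0..pi / 2})" for m n
      by (rule derivative_eq_intros refl)+ (simp add: algebra_simps)
    note der = this[of "2 * p + 1" "2 * q + 1"]
    have "((\<lambda>x. cos x ^ (2 * p + 2) * sin x ^ (2 * q + 2)) has_real_derivative
        (2 * real q + 2) * ?B (Suc p) q x - (2 * real p + 2) * ?B p (Suc q) x) (at x within {0..pi / 2})"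
    proof -
      have e: "Suc (2 * p + 1) = 2 * p + 2" "2 * p + 1 + 2 = 2 * Suc p + 1" "real (2 * p + 1) + 1 = 2 * real p + 2" for p by simp_all
      show ?thesis using der unfolding e .
    qed
    then show "((\<lambda>x. cos x ^ (2 * p + 2) * sin x ^ (2 * q + 2)) has_vector_derivative
        (2 * real q + 2) * ?B (Suc p) q x - (2 * real p + 2) * ?B p (Suc q) x) (at x within {0..pi / 2})"
      by (simp add: has_real_derivative_iff_has_vector_derivative)
  qed auto
  then have 1: "((\<lambda>x. (2 * real q + 2) * ?B (Suc p) q x - (2 * real p + 2) * ?B p (Suc q) x) has_integral 0) {0..pi / 2}"
    by simp
  have 2: "((\<lambda>x. (2 * real q + 2) * ?B p q x) has_integral (2 * real q + 2) * (fact p * fact q / (2 * fact (p + q + 1)))) {0..pi / 2}"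
    by (intro has_integral_mult_right Suc.IH)
  have "?B p q x = ?B (Suc p) q x + ?B p (Suc q) x" for x
  proof -
    have "c ^ (m + 2) * s ^ n + c ^ m * s ^ (n + 2) = c ^ m * s ^ n * (c\<^sup>2 + s\<^sup>2)" for c s :: real and m n
      by (simp add: power_add distrib_left power2_eq_square)
    moreover have "2 * Suc p + 1 = (2 * p + 1) + 2" "2 * Suc q + 1 = (2 * q + 1) + 2" by simp_all
    ultimately show ?thesis by (metis mult.right_neutral sin_cos_squared_add2)
  qed
  then have e: "(2 * real q + 2) * ?B p q x - ((2 * real q + 2) * ?B (Suc p) q x - (2 * real p + 2) * ?B p (Suc q) x)
     = (2 * (real p + real q + 2)) * ?B p (Suc q) x" for x
    by (simp only: ) (simp only: algebra_simps)
  have "((\<lambda>x. (2 * (real p + real q + 2)) * ?B p (Suc q) x) has_integral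
      (2 * real q + 2) * (fact p * fact q / (2 * fact (p + q + 1))) - 0) {0..pi / 2}"
    using has_integral_diff[OF 2 1] unfolding e .
  then have "((\<lambda>x. (1 / (2 * (real p + real q + 2))) * ((2 * (real p + real q + 2)) * ?B p (Suc q) x)) has_integral
      (1 / (2 * (real p + real q + 2))) * ((2 * real q + 2) * (fact p * fact q / (2 * fact (p + q + 1))) - 0)) {0..pi / 2}"
    by (rule has_integral_mult_right)
  moreover have "(1 / (2 * (real p + real q + 2))) * ((2 * (real p + real q + 2)) * z) = z" for z
  proof -
    have "real p + real q + 2 \<noteq> 0" by linarith
    then show ?thesis by simp
  qed
  moreover have "(1 / (2 * (real p + real q + 2))) * ((2 * real q + 2) * (fact p * fact q / (2 * fact (p + q + 1))) - 0)
      = fact p * fact (Suc q) / (2 * fact (p + Suc q + 1))"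
  proof -
    have "real p + real q + 2 \<noteq> 0" by linarith
    moreover have "fact (p + Suc q + 1) = (real p + real q + 2) * fact (p + q + 1)"
      by (simp add: algebra_simps)
    ultimately show ?thesis by (simp add: divide_simps) (simp add: algebra_simps)
  qed
  ultimately show ?case by simp
qed

text \<open>Termwise Beta integrals: the sum of the exponents of cosine and sine does not depend on
  the term, so the denominators agree, and the remaining factorials form the alternating binomial
  sum with r = j. For j \<le> d only j = d survives.\<close>

lemma has_integral_Jpoly_power:
  assumes "j \<le> d"
  shows "((\<lambda>x. cos x ^ (2 * b + 1) * sin x ^ (2 * a + 1) * poly (Jpoly a b d) ((cos x)\<^sup>2) * ((cos x)\<^sup>2) ^ j) has_integral
    (if j = d then fact (a + d) * fact (b + d) / (2 * fact (a + b + 2 * d + 1)) else 0)) {0..pi / 2}"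
proof -
  define c where "c i = real ((a + d) choose i) * real ((b + d) choose (d - i))" for i
  \<comment> \<open>All factorials free of the summation index: the numerators of the two binomials
    in \<open>c\<close>, the common Beta denominator, and \<open>fact j / fact d\<close>, which
    completes the two binomials of the alternating sum.\<close>
  define K where "K = fact (a + d) * fact (b + d) * fact j / (2 * fact d * fact (a + b + d + j + 1) :: real)"
  have eq: "cos x ^ (2 * b + 1) * sin x ^ (2 * a + 1) * poly (Jpoly a b d) ((cos x)\<^sup>2) * ((cos x)\<^sup>2) ^ j
     = (\<Sum>i\<le>d. c i * (-1) ^ (d - i) * (cos x ^ (2 * (b + i + j) + 1) * sin x ^ (2 * (a + (d - i)) + 1)))" for x :: real
  proof -
    have "(cos x)\<^sup>2 - 1 = - ((sin x)\<^sup>2)" using sin_squared_eq[of x] by simp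
    then have "poly (Jpoly a b d) ((cos x)\<^sup>2) = (\<Sum>i\<le>d. c i * (-1) ^ (d - i) * (((cos x)\<^sup>2) ^ i * ((sin x)\<^sup>2) ^ (d - i)))"
      unfolding poly_Jpoly c_def by (simp add: power_minus[of "(sin x)\<^sup>2"] mult_ac)
    then have "cos x ^ (2 * b + 1) * sin x ^ (2 * a + 1) * poly (Jpoly a b d) ((cos x)\<^sup>2) * ((cos x)\<^sup>2) ^ j
      = (\<Sum>i\<le>d. cos x ^ (2 * b + 1) * sin x ^ (2 * a + 1) * (c i * (-1) ^ (d - i) * (((cos x)\<^sup>2) ^ i * ((sin x)\<^sup>2) ^ (d - i))) * ((cos x)\<^sup>2) ^ j)"
      by (simp only: sum_distrib_left sum_distrib_right)
    also have "\<dots> = (\<Sum>i\<le>d. c i * (-1) ^ (d - i) * (cos x ^ (2 * (b + i + j) + 1) * sin x ^ (2 * (a + (d - i)) + 1)))"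
      by (intro sum.cong refl) (simp only: power_add power_mult[symmetric] distrib_left distrib_right mult_ac)
    finally show ?thesis .
  qed
  have "((\<lambda>x. cos x ^ (2 * b + 1) * sin x ^ (2 * a + 1) * poly (Jpoly a b d) ((cos x)\<^sup>2) * ((cos x)\<^sup>2) ^ j) has_integral
     (\<Sum>i\<le>d. c i * (-1) ^ (d - i) * (fact (b + i + j) * fact (a + (d - i)) / (2 * fact (b + i + j + (a + (d - i)) + 1))))) {0..pi / 2}"
    unfolding eq by (intro has_integral_sum has_integral_mult_right has_integral_cos_sin_power) auto
  also have "(\<Sum>i\<le>d. c i * (-1) ^ (d - i) * (fact (b + i + j) * fact (a + (d - i)) / (2 * fact (b + i + j + (a + (d - i)) + 1))))
     = (\<Sum>i\<le>d. K * ((-1) ^ (d - i) * real (d choose (d - i)) * real ((b + j + d - (d - i)) choose j)))"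
  proof (intro sum.cong refl)
    fix i assume "i \<in> {..d}"
    then obtain e where e: "d = i + e" using le_Suc_ex by auto
    have 1: "real ((a + d) choose i) = fact (a + d) / (fact i * fact (a + e))"
      by (subst binomial_fact) (auto simp: e add_ac)
    have 2: "real ((b + d) choose (d - i)) = fact (b + d) / (fact e * fact (b + i))"
      by (subst binomial_fact) (auto simp: e add_ac)
    have 3: "real (d choose (d - i)) = fact d / (fact e * fact i)"
      by (subst binomial_fact) (auto simp: e)
    have 4: "real ((b + j + d - (d - i)) choose j) = fact (b + i + j) / (fact j * fact (b + i))"
      by (subst binomial_fact) (auto simp: e add_ac)
    have 5: "b + i + j + (a + (d - i)) + 1 = a + b + d + j + 1" using e by simp
    have 6: "d - i = e" using e by simp
    show "c i * (-1) ^ (d - i) * (fact (b + i + j) * fact (a + (d - i)) / (2 * fact (b + i + j + (a + (d - i)) + 1)))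
      = K * ((-1) ^ (d - i) * real (d choose (d - i)) * real ((b + j + d - (d - i)) choose j))"
      unfolding c_def 1 2 3 4 K_def 5 unfolding 6 by (simp del: fact_Suc of_nat_add add: divide_simps)
  qed
  also have "\<dots> = K * (\<Sum>i\<le>d. (-1) ^ (d - i) * real (d choose (d - i)) * real ((b + j + d - (d - i)) choose j))"
    by (simp add: sum_distrib_left)
  also have "(\<Sum>i\<le>d. (-1) ^ (d - i) * real (d choose (d - i)) * real ((b + j + d - (d - i)) choose j))
     = (\<Sum>i\<le>d. (-1) ^ i * real (d choose i) * real ((b + j + d - i) choose j))"
    by (rule sum.reindex_bij_witness[of _ "\<lambda>i. d - i" "\<lambda>i. d - i"]) auto
  also have "\<dots> = (if d \<le> j then real ((b + j) choose (j - d)) else 0)"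
    by (rule alternating_binomial_sum)
  also have "K * \<dots> = (if j = d then fact (a + d) * fact (b + d) / (2 * fact (a + b + 2 * d + 1)) else 0)"
  proof (cases "j = d")
    case True
    then have e: "a + b + d + j + 1 = a + b + 2 * d + 1" by simp
    show ?thesis unfolding K_def e using True by (simp del: fact_Suc)
  next
    case False
    then have "\<not> d \<le> j" using assms by simp
    then show ?thesis using False by simp
  qed
  finally show ?thesis .
qed

text \<open>One of the two factors is expanded in powers of cos^2; by orthogonality only the top
  power contributes, with the leading coefficient \<open>(a + b + 2 * d) choose d\<close>.\<close>

lemma has_integral_Jpoly_square:
  "((\<lambda>x. cos x ^ (2 * b + 1) * sin x ^ (2 * a + 1) * (poly (Jpoly a b d) ((cos x)\<^sup>2))\<^sup>2) has_integral
    fact (a + d) * fact (b + d) / (2 * (real (a + b + 2 * d) + 1) * fact d * fact (a + b + d))) {0..pi / 2}"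
proof -
  let ?g = "\<lambda>x. cos x ^ (2 * b + 1) * sin x ^ (2 * a + 1) * poly (Jpoly a b d) ((cos x)\<^sup>2)"
  have eq: "cos x ^ (2 * b + 1) * sin x ^ (2 * a + 1) * (poly (Jpoly a b d) ((cos x)\<^sup>2))\<^sup>2
     = (\<Sum>j\<le>d. coeff (Jpoly a b d) j * (?g x * ((cos x)\<^sup>2) ^ j))" for x :: real
    unfolding power2_eq_square[of "poly _ _"] mult.assoc[symmetric]
    by (subst (2) poly_altdef) (simp add: degree_Jpoly sum_distrib_left mult_ac)
  have "((\<lambda>x. \<Sum>j\<le>d. coeff (Jpoly a b d) j * (?g x * ((cos x)\<^sup>2) ^ j)) has_integral
    (\<Sum>j\<le>d. coeff (Jpoly a b d) j * (if j = d then fact (a + d) * fact (b + d) / (2 * fact (a + b + 2 * d + 1)) else 0))) {0..pi / 2}"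
    by (intro has_integral_sum has_integral_mult_right has_integral_Jpoly_power) auto
  also have "(\<Sum>j\<le>d. coeff (Jpoly a b d) j * (if j = d then fact (a + d) * fact (b + d) / (2 * fact (a + b + 2 * d + 1)) else 0))
    = real ((a + b + 2 * d) choose d) * (fact (a + d) * fact (b + d) / (2 * fact (a + b + 2 * d + 1)))"
    by (subst sum.remove[of _ d]) (auto simp: coeff_Jpoly)
  also have "\<dots> = fact (a + d) * fact (b + d) / (2 * (real (a + b + 2 * d) + 1) * fact d * fact (a + b + d))"
  proof -
    have b: "real ((a + b + 2 * d) choose d) = fact (a + b + 2 * d) / (fact d * fact (a + b + d))"
      by (subst binomial_fact) (auto simp: mult_2 add_ac)
    have f: "fact (a + b + 2 * d + 1) = (real (a + b + 2 * d) + 1) * (fact (a + b + 2 * d) :: real)"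
      by (simp add: algebra_simps)
    show ?thesis unfolding b f by (simp del: of_nat_add fact_Suc add: divide_simps)
  qed
  finally show ?thesis unfolding eq .
qed

section \<open>The Laplacian through local extensions\<close>

text \<open>The sphere has empty interior, so a derivative within it is not unique as a linear map.
  Along the great circle cos t y + sin t u it becomes a derivative in one real variable, which is
  unique; scaling then passes from unit tangent vectors to all of them.\<close>

lemma tangent_derivative_unique:
  fixes h :: "real^4 \<Rightarrow> 'b::real_normed_vector"
  assumes "(h has_derivative A) (at y within S3)" "(h has_derivative B) (at y within S3)"
    and y: "y \<in> S3" and v: "v \<bullet> y = 0"
  shows "A v = B v"
proof -
  have unit: "A u = B u" if u: "u \<bullet> y = 0" "norm u = 1" for u
  proof -
    define c where "c t = cos t *\<^sub>R y + sin t *\<^sub>R u" for t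
    have c0: "c 0 = y" by (simp add: c_def)
    have dc: "(c has_derivative (\<lambda>t. t *\<^sub>R u)) (at 0 within UNIV)"
      unfolding c_def by (auto intro!: derivative_eq_intros)
    have "norm (c t) = 1" for t
    proof -
      have "c t \<bullet> c t = (cos t)\<^sup>2 * (y \<bullet> y) + (sin t)\<^sup>2 * (u \<bullet> u)"
        using u by (simp add: c_def inner_add_left inner_add_right inner_commute power2_eq_square)
      also have "\<dots> = 1"
        using u y by (simp add: dot_square_norm)
      finally show ?thesis by (simp add: norm_eq_1)
    qed
    then have ran: "c ` UNIV \<subseteq> S3" by auto
    have "((\<lambda>t. h (c t)) has_derivative (\<lambda>t. L (t *\<^sub>R u))) (at 0)"
      if "(h has_derivative L) (at y within S3)" for L
      using has_derivative_in_compose[OF dc, of h L] has_derivative_subset[OF that ran] c0 by simp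
    then have "(\<lambda>t. A (t *\<^sub>R u)) = (\<lambda>t. B (t *\<^sub>R u))"
      using assms(1,2) has_derivative_unique by blast
    then show ?thesis by (metis scaleR_one)
  qed
  have lin: "linear A" "linear B"
    using assms(1,2) has_derivative_linear by blast+
  show ?thesis
  proof (cases "v = 0")
    case False
    then have "A (v /\<^sub>R norm v) = B (v /\<^sub>R norm v)" using v by (intro unit) auto
    then show ?thesis using False lin by (simp add: linear_cmul)
  qed (simp add: linear_0 lin)
qed

text \<open>\<open>D\<close> is the ambient gradient and \<open>K y\<close> the Hessian of the local
  extension \<open>g\<close>. Carrying them explicitly reduces the intrinsic gradient and divergence
  to linear algebra, and continuity of \<open>K\<close> is what makes the Laplacian
  continuous.\<close>

definition C2_extension ::
  "(real^4 \<Rightarrow> real) \<Rightarrow> (real^4) set \<Rightarrow> (real^4 \<Rightarrow> real) \<Rightarrow> (real^4 \<Rightarrow> real^4) \<Rightarrow> (real^4 \<Rightarrow> real^4 \<Rightarrow> real^4) \<Rightarrow> bool"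
  where "C2_extension f U g D K \<longleftrightarrow> open U \<and>
     (\<forall>y\<in>U. (g has_derivative (\<lambda>v. D y \<bullet> v)) (at y) \<and> (D has_derivative K y) (at y)) \<and>
     (\<forall>v. continuous_on U (\<lambda>y. K y v)) \<and> (\<forall>y\<in>U \<inter> S3. g y = f y)"

lemma smooth_on_S3_C2_extension:
  assumes "smooth_on_S3 f" "x \<in> S3"
  obtains U g D K where "C2_extension f U g D K" "x \<in> U"
proof -
  obtain U g where U: "open U" "x \<in> U" and Ck: "\<And>n. Ck_on n U g" and eq: "\<forall>y\<in>U \<inter> S3. g y = f y"
    using assms unfolding smooth_on_S3_def by blast
  define d where "d v y = frechet_derivative g (at y) v" for v y
  define D where "D y = (\<Sum>e\<in>Basis. d e y *\<^sub>R e)" for y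
  define K where "K y v = (\<Sum>e\<in>Basis. frechet_derivative (d e) (at y) v *\<^sub>R e)" for y v
  have C2: "Ck_on (Suc (Suc 0)) U g" by (rule Ck)
  have g: "(g has_derivative (\<lambda>v. D y \<bullet> v)) (at y)" if "y \<in> U" for y
  proof -
    have g': "(g has_derivative frechet_derivative g (at y)) (at y)"
      using C2 that by (simp flip: frechet_derivative_works)
    have "D y \<bullet> v = frechet_derivative g (at y) v" for v
    proof -
      have "frechet_derivative g (at y) v = frechet_derivative g (at y) (\<Sum>e\<in>Basis. (v \<bullet> e) *\<^sub>R e)"
        by (simp add: euclidean_representation)
      also have "\<dots> = (\<Sum>e\<in>Basis. (v \<bullet> e) * d e y)"
        using has_derivative_linear[OF g'] by (simp add: linear_sum linear_cmul d_def)
      also have "\<dots> = D y \<bullet> v"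
        by (simp add: D_def inner_sum_left inner_commute[of v] mult.commute)
      finally show ?thesis ..
    qed
    then show ?thesis using g' by simp
  qed
  have d: "(d e has_derivative frechet_derivative (d e) (at y)) (at y)" if "y \<in> U" for e y
    using C2 that by (auto simp: d_def[abs_def] simp flip: frechet_derivative_works)
  have D: "(D has_derivative K y) (at y)" if "y \<in> U" for y
    unfolding D_def[abs_def] K_def[abs_def]
    by (intro has_derivative_sum has_derivative_scaleR_left d that)
  have "continuous_on U (\<lambda>y. frechet_derivative (d e) (at y) v)" for e v
    using C2 by (simp add: d_def[abs_def])
  then have "continuous_on U (\<lambda>y. K y v)" for v
    unfolding K_def by (intro continuous_intros)
  then have "C2_extension f U g D K"
    unfolding C2_extension_def using U eq g D by blast
  then show ?thesis using that U by blast
qed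

lemma has_derivative_within_S3_cong:
  assumes "(g has_derivative L) (at y)" "open U" "y \<in> U \<inter> S3" "\<And>z. z \<in> U \<inter> S3 \<Longrightarrow> g z = f z"
  shows "(f has_derivative L) (at y within S3)"
proof -
  have g: "(g has_derivative L) (at y within S3)" using assms(1) by (rule has_derivative_at_withinI)
  obtain e where e: "e > 0" "ball y e \<subseteq> U" using assms(2,3) openE by blast
  show ?thesis
  proof (rule has_derivative_transform_within[OF g e(1)])
    show "y \<in> S3" using assms(3) by blast
    fix z assume z: "z \<in> S3" "dist z y < e"
    then have "z \<in> U" using e(2) by (auto simp: dist_commute)
    then show "g z = f z" using z assms(4) by blast
  qed
qed

text \<open>The tangential part of the ambient gradient has the defining property because
  derivatives within the sphere agree on tangent vectors. Uniqueness: the difference of two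
  candidates is tangent, hence orthogonal to itself.\<close>

lemma S3_grad_eq:
  assumes C2: "C2_extension f U g D K" and y: "y \<in> U \<inter> S3"
  shows "S3_grad f y = D y - (D y \<bullet> y) *\<^sub>R y"
proof -
  have yy: "y \<bullet> y = 1" using y by (simp add: norm_eq_1)
  have fd: "(f has_derivative (\<lambda>v. D y \<bullet> v)) (at y within S3)"
    using C2 y unfolding C2_extension_def by (intro has_derivative_within_S3_cong[of g _ _ U]) auto
  then have fd': "(f has_derivative frechet_derivative f (at y within S3)) (at y within S3)"
    using frechet_derivative_works differentiable_def by blast
  have eq: "frechet_derivative f (at y within S3) v = D y \<bullet> v" if "v \<bullet> y = 0" for v
    using tangent_derivative_unique[OF fd' fd] y that by auto
  show ?thesis
    unfolding S3_grad_def
  proof (rule the_equality)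
    show "(D y - (D y \<bullet> y) *\<^sub>R y) \<bullet> y = 0 \<and> (\<forall>v. v \<bullet> y = 0 \<longrightarrow> (D y - (D y \<bullet> y) *\<^sub>R y) \<bullet> v = frechet_derivative f (at y within S3) v)"
    proof (intro conjI allI impI)
      show "(D y - (D y \<bullet> y) *\<^sub>R y) \<bullet> y = 0" using yy by (simp add: inner_diff_left)
      fix v assume v: "v \<bullet> y = 0"
      then show "(D y - (D y \<bullet> y) *\<^sub>R y) \<bullet> v = frechet_derivative f (at y within S3) v"
        using inner_commute[of y v] by (simp add: eq inner_diff_left)
    qed
  next
    fix w assume w: "w \<bullet> y = 0 \<and> (\<forall>v. v \<bullet> y = 0 \<longrightarrow> w \<bullet> v = frechet_derivative f (at y within S3) v)"
    define z where "z = w - (D y - (D y \<bullet> y) *\<^sub>R y)"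
    have zy: "z \<bullet> y = 0" using w yy by (simp add: z_def inner_diff_left)
    then have "w \<bullet> z = D y \<bullet> z" using w eq by simp
    then have "z \<bullet> z = 0"
      using inner_commute[of y z] zy by (subst z_def) (simp add: inner_diff_left)
    then show "w = D y - (D y \<bullet> y) *\<^sub>R y" by (simp add: z_def)
  qed
qed

text \<open>The flat Laplacian of the extension, minus its second derivative along the radius, minus
  3 times its radial derivative. The last term comes from the curvature of the unit sphere, 3 being
  the trace of the tangential projection.\<close>

lemma S3_laplacian_eq:
  assumes C2: "C2_extension f U g D K" and x: "x \<in> U \<inter> S3"
  shows "S3_laplacian f x = (\<Sum>e\<in>Basis. K x e \<bullet> e) - K x x \<bullet> x - 3 * (D x \<bullet> x)"
proof -
  have xx: "x \<bullet> x = 1" using x by (simp add: norm_eq_1)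
  have D: "(D has_derivative K x) (at x)" and U: "open U" using C2 x by (auto simp: C2_extension_def)
  have lin: "linear (K x)" using D has_derivative_linear by blast
  let ?V = "\<lambda>y. D y - (D y \<bullet> y) *\<^sub>R y"
  \<comment> \<open>Product rule for the tangential part of the gradient. The multiple of
    \<open>x\<close> is normal and disappears when paired with a tangent vector.\<close>
  let ?L = "\<lambda>v. K x v - ((D x \<bullet> x) *\<^sub>R v + (D x \<bullet> v + K x v \<bullet> x) *\<^sub>R x)"
  have "(?V has_derivative ?L) (at x)"
    by (intro derivative_intros D)
  then have V: "(S3_grad f has_derivative ?L) (at x within S3)"
    using S3_grad_eq[OF C2] U x by (intro has_derivative_within_S3_cong[of ?V _ _ U]) auto
  then have V': "(S3_grad f has_derivative frechet_derivative (S3_grad f) (at x within S3)) (at x within S3)"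
    using frechet_derivative_works differentiable_def by blast
  have eq: "frechet_derivative (S3_grad f) (at x within S3) v = ?L v" if "v \<bullet> x = 0" for v
    using tangent_derivative_unique[OF V' V] x that by auto
  define P where "P = tangent_proj x"
  have P: "P v = v - (v \<bullet> x) *\<^sub>R x" for v by (simp add: P_def tangent_proj_def)
  have Px: "P v \<bullet> x = 0" for v using xx by (simp add: P inner_diff_left)
  have Psym: "u \<bullet> P v = P u \<bullet> v" for u v
    by (simp add: P inner_diff_left inner_diff_right inner_commute)
  have tm: "e \<bullet> S3_covariant_derivative (S3_grad f) x (tangent_proj x e)
     = K x e \<bullet> e - (e \<bullet> x) * (K x x \<bullet> e) - (e \<bullet> x) * (K x e \<bullet> x) + (e \<bullet> x)\<^sup>2 * (K x x \<bullet> x) - (D x \<bullet> x) * (1 - (e \<bullet> x)\<^sup>2)"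
    if "e \<in> Basis" for e
  proof -
    have "e \<bullet> S3_covariant_derivative (S3_grad f) x (tangent_proj x e) = P e \<bullet> ?L (P e)"
      unfolding S3_covariant_derivative_def P_def[symmetric] Psym eq[OF Px] ..
    also have "\<dots> = P e \<bullet> K x (P e) - (D x \<bullet> x) * (P e \<bullet> P e)"
      using Px[of e] by (simp add: inner_diff_right inner_add_right)
    also have "P e \<bullet> P e = 1 - (e \<bullet> x)\<^sup>2"
      using that xx by (simp add: P inner_diff_left inner_diff_right inner_commute power2_eq_square inner_Basis)
    also have "P e \<bullet> K x (P e) = K x e \<bullet> e - (e \<bullet> x) * (K x x \<bullet> e) - (e \<bullet> x) * (K x e \<bullet> x) + (e \<bullet> x)\<^sup>2 * (K x x \<bullet> x)"
      unfolding P using lin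
      by (simp add: linear_diff linear_cmul inner_diff_left inner_diff_right inner_commute power2_eq_square algebra_simps)
    finally show ?thesis .
  qed
  have s1: "(\<Sum>e\<in>Basis. (e \<bullet> x) * (v \<bullet> e)) = v \<bullet> x" for v :: "real^4"
    by (simp add: euclidean_inner[of v x] inner_commute mult.commute)
  have s2: "(\<Sum>e\<in>Basis. (e \<bullet> x) * (K x e \<bullet> x)) = K x x \<bullet> x"
  proof -
    have "K x x = K x (\<Sum>e\<in>Basis. (x \<bullet> e) *\<^sub>R e)" by (simp add: euclidean_representation)
    also have "\<dots> = (\<Sum>e\<in>Basis. (x \<bullet> e) *\<^sub>R K x e)" using lin by (simp add: linear_sum linear_cmul)
    finally have "K x x \<bullet> x = (\<Sum>e\<in>Basis. (x \<bullet> e) * (K x e \<bullet> x))" by (simp add: inner_sum_left)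
    then show ?thesis by (simp add: inner_commute[of x])
  qed
  have s3: "(\<Sum>e\<in>Basis. (e \<bullet> x)\<^sup>2) = 1"
    using s1[of x] xx by (simp add: inner_commute power2_eq_square)
  have "S3_laplacian f x = (\<Sum>e\<in>Basis. K x e \<bullet> e - (e \<bullet> x) * (K x x \<bullet> e) - (e \<bullet> x) * (K x e \<bullet> x) + (e \<bullet> x)\<^sup>2 * (K x x \<bullet> x) - (D x \<bullet> x) * (1 - (e \<bullet> x)\<^sup>2))"
    unfolding S3_laplacian_def S3_div_def by (intro sum.cong refl tm)
  also have "\<dots> = (\<Sum>e\<in>Basis. K x e \<bullet> e) - K x x \<bullet> x - K x x \<bullet> x + (\<Sum>e\<in>Basis. (e \<bullet> x)\<^sup>2) * (K x x \<bullet> x) - (D x \<bullet> x) * (\<Sum>e\<in>Basis. 1 - (e \<bullet> x)\<^sup>2)"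
    unfolding sum.distrib sum_subtractf sum_distrib_right[symmetric] sum_distrib_left[symmetric] s1 s2 ..
  also have "(\<Sum>e\<in>Basis. 1 - (e \<bullet> x)\<^sup>2) = 3"
    unfolding sum_subtractf s3 by simp
  finally show ?thesis unfolding s3 by simp
qed

lemma smooth_on_S3_continuous: "smooth_on_S3 f \<Longrightarrow> continuous_on S3 f"
proof -
  assume f: "smooth_on_S3 f"
  have "continuous (at x within S3) f" if x: "x \<in> S3" for x
  proof -
    obtain U g D K where C2: "C2_extension f U g D K" and U: "x \<in> U"
      using smooth_on_S3_C2_extension[OF f x] .
    then have "(f has_derivative (\<lambda>v. D x \<bullet> v)) (at x within S3)"
      using x unfolding C2_extension_def by (intro has_derivative_within_S3_cong[of g _ _ U]) auto
    then show ?thesis by (rule has_derivative_continuous)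
  qed
  then show ?thesis by (simp add: continuous_on_eq_continuous_within)
qed

text \<open>Linearity of \<open>K (a p)\<close> reduces a moving direction \<open>b p\<close> to the
  finitely many basis directions, for which continuity is part of
  \<open>C2_extension\<close>.\<close>

lemma continuous_on_C2_Hessian:
  assumes "C2_extension f U g D K" "continuous_on W a" "continuous_on W b" "a ` W \<subseteq> U"
  shows "continuous_on W (\<lambda>p. K (a p) (b p))"
proof -
  have K: "continuous_on W (\<lambda>p. K (a p) v)" for v
    using assms(1) unfolding C2_extension_def
    by (intro continuous_on_compose2[OF _ assms(2,4), of "\<lambda>y. K y v"]) blast
  have "K (a p) (b p) = (\<Sum>e\<in>Basis. (b p \<bullet> e) *\<^sub>R K (a p) e)" if "p \<in> W" for p
  proof -
    have "linear (K (a p))"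
      using assms that unfolding C2_extension_def by (metis has_derivative_linear image_subset_iff)
    then have "K (a p) (\<Sum>e\<in>Basis. (b p \<bullet> e) *\<^sub>R e) = (\<Sum>e\<in>Basis. (b p \<bullet> e) *\<^sub>R K (a p) e)"
      by (simp add: linear_sum linear_cmul)
    then show ?thesis by (simp add: euclidean_representation)
  qed
  moreover have "continuous_on W (\<lambda>p. \<Sum>e\<in>Basis. (b p \<bullet> e) *\<^sub>R K (a p) e)"
    by (intro continuous_intros K assms)
  ultimately show ?thesis by (simp cong: continuous_on_cong)
qed

lemma continuous_on_C2_gradient:
  assumes "C2_extension f U g D K"
  shows "continuous_on U D"
  using assms unfolding C2_extension_def
  by (metis (no_types, lifting) continuous_at_imp_continuous_on has_derivative_continuous)

text \<open>This carries the eigenvalue equation from interior chi to the two circles where the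
  coordinate formula breaks down.\<close>

lemma continuous_on_S3_laplacian:
  assumes f: "smooth_on_S3 f"
  shows "continuous_on S3 (S3_laplacian f)"
proof -
  show ?thesis
    unfolding continuous_on_eq_continuous_within
  proof (intro ballI)
    fix x :: "real^4" assume x: "x \<in> S3"
    obtain U g D K where C2: "C2_extension f U g D K" and U: "x \<in> U"
      using smooth_on_S3_C2_extension[OF f x] .
    have "continuous_on (S3 \<inter> U) D"
      using continuous_on_C2_gradient[OF C2] by (rule continuous_on_subset) auto
    then have "continuous_on (S3 \<inter> U) (\<lambda>x. (\<Sum>e\<in>Basis. K x e \<bullet> e) - K x x \<bullet> x - 3 * (D x \<bullet> x))"
      by (intro continuous_intros continuous_on_C2_Hessian[OF C2]) auto
    then have "continuous_on (S3 \<inter> U) (S3_laplacian f)"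
      by (rule continuous_on_eq) (use S3_laplacian_eq[OF C2] in auto)
    then have "continuous (at x within S3 \<inter> U) (S3_laplacian f)"
      using x U by (auto simp: continuous_on_eq_continuous_within)
    moreover have "at x within S3 \<inter> U = at x within S3"
      by (rule at_within_nhd[of x U]) (use U C2 in \<open>auto simp: C2_extension_def\<close>)
    ultimately show "continuous (at x within S3) (S3_laplacian f)" by simp
  qed
qed

section \<open>Toroidal coordinates\<close>

text \<open>At fixed angles the four vectors are orthonormal, and the families are closed under
  differentiation up to sign, so toroidal points and their coordinate derivatives can be handled
  without components.\<close>

definition circle12 :: "real \<Rightarrow> real^4" where "circle12 t = cos t *\<^sub>R axis 1 1 + sin t *\<^sub>R axis 2 1"
definition circle12' :: "real \<Rightarrow> real^4" where "circle12' t = (- sin t) *\<^sub>R axis 1 1 + cos t *\<^sub>R axis 2 1"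
definition circle34 :: "real \<Rightarrow> real^4" where "circle34 t = cos t *\<^sub>R axis 3 1 + sin t *\<^sub>R axis 4 1"
definition circle34' :: "real \<Rightarrow> real^4" where "circle34' t = (- sin t) *\<^sub>R axis 3 1 + cos t *\<^sub>R axis 4 1"

lemmas circle_defs = circle12_def circle12'_def circle34_def circle34'_def

lemma vec4_eqI: "x $ 1 = y $ 1 \<Longrightarrow> x $ 2 = y $ 2 \<Longrightarrow> x $ 3 = y $ 3 \<Longrightarrow> x $ 4 = y $ 4 \<Longrightarrow> x = (y :: 'a^4)"
  by (simp add: vec_eq_iff forall_4)

lemma toroidal_eq: "toroidal chi \<theta> \<phi> = cos chi *\<^sub>R circle12 \<theta> + sin chi *\<^sub>R circle34 \<phi>"
  by (rule vec4_eqI) (simp_all add: toroidal_def circle_defs axis_def vector_def)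

lemma circle_inner:
  "circle12 t \<bullet> circle12 t = 1" "circle12' t \<bullet> circle12' t = 1" "circle12 t \<bullet> circle12' t = 0" "circle12' t \<bullet> circle12 t = 0"
  "circle34 t \<bullet> circle34 t = 1" "circle34' t \<bullet> circle34' t = 1" "circle34 t \<bullet> circle34' t = 0" "circle34' t \<bullet> circle34 t = 0"
  "circle12 t \<bullet> circle34 u = 0" "circle12 t \<bullet> circle34' u = 0" "circle12' t \<bullet> circle34 u = 0" "circle12' t \<bullet> circle34' u = 0"
  "circle34 u \<bullet> circle12 t = 0" "circle34' u \<bullet> circle12 t = 0" "circle34 u \<bullet> circle12' t = 0" "circle34' u \<bullet> circle12' t = 0"
  by (simp_all add: circle_defs inner_vec_def sum_4 axis_def power2_eq_square[symmetric])

lemma circle_vector_derivative [derivative_intros]: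
  "(circle12 has_vector_derivative circle12' t) (at t within S)"
  "(circle12' has_vector_derivative - circle12 t) (at t within S)"
  "(circle34 has_vector_derivative circle34' t) (at t within S)"
  "(circle34' has_vector_derivative - circle34 t) (at t within S)"
  unfolding circle12_def[abs_def] circle12'_def[abs_def] circle34_def[abs_def] circle34'_def[abs_def]
  by (auto intro!: derivative_eq_intros simp: has_real_derivative_iff_has_vector_derivative[symmetric])

lemma continuous_on_circle [continuous_intros]:
  fixes S :: "'a::t2_space set"
  assumes "continuous_on S h"
  shows "continuous_on S (\<lambda>x. circle12 (h x))" "continuous_on S (\<lambda>x. circle12' (h x))"
    "continuous_on S (\<lambda>x. circle34 (h x))" "continuous_on S (\<lambda>x. circle34' (h x))"
  using assms unfolding circle_defs by (auto intro!: continuous_intros)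

lemma toroidal_in_S3: "toroidal chi \<theta> \<phi> \<in> S3"
proof -
  have "toroidal chi \<theta> \<phi> \<bullet> toroidal chi \<theta> \<phi> = (cos chi)\<^sup>2 + (sin chi)\<^sup>2"
    by (simp add: toroidal_eq inner_add_left inner_add_right circle_inner power2_eq_square)
  then show ?thesis by (simp add: norm_eq_1)
qed

lemma norm_toroidal [simp]: "norm (toroidal chi \<theta> \<phi>) = 1"
  using toroidal_in_S3[of chi \<theta> \<phi>] by simp

text \<open>Invariance of the trace over a plane under rotation of its basis: the mixed terms cancel
  between the two summands.\<close>

lemma trace_rotation:
  fixes L :: "real^4 \<Rightarrow> real^4"
  assumes "linear L"
  shows "L (cos t *\<^sub>R u + sin t *\<^sub>R v) \<bullet> (cos t *\<^sub>R u + sin t *\<^sub>R v)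
       + L ((- sin t) *\<^sub>R u + cos t *\<^sub>R v) \<bullet> ((- sin t) *\<^sub>R u + cos t *\<^sub>R v) = L u \<bullet> u + L v \<bullet> v"
proof -
  define c where "c = cos t"
  define s where "s = sin t"
  have "L (c *\<^sub>R u + s *\<^sub>R v) \<bullet> (c *\<^sub>R u + s *\<^sub>R v) + L ((- s) *\<^sub>R u + c *\<^sub>R v) \<bullet> ((- s) *\<^sub>R u + c *\<^sub>R v)
     = (L u \<bullet> u) * (c\<^sup>2 + s\<^sup>2) + (L v \<bullet> v) * (c\<^sup>2 + s\<^sup>2)"
    using assms unfolding power2_eq_square
    by (simp add: linear_add linear_diff linear_cmul inner_add_left inner_add_right inner_diff_left inner_diff_right algebra_simps)
  then show ?thesis by (simp add: c_def s_def)
qed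

lemma sum_Basis4:
  fixes h :: "real^4 \<Rightarrow> real"
  shows "(\<Sum>e\<in>Basis. h e) = h (axis 1 1) + h (axis 2 1) + h (axis 3 1) + h (axis 4 1)"
proof -
  have "(Basis :: (real^4) set) = range (\<lambda>i. axis i 1)" by (auto simp: Basis_vec_def)
  moreover have "inj (\<lambda>i::4. axis i (1::real))" by (simp add: inj_on_def axis_eq_axis)
  ultimately have "(\<Sum>e\<in>Basis. h e) = (\<Sum>i\<in>UNIV. h (axis i 1))"
    by (metis (no_types, lifting) sum.reindex_cong)
  then show ?thesis by (simp add: sum_4)
qed

text \<open>Three plane rotations lead from the standard basis to this frame: by theta in the first
  coordinate plane, by phi in the second, then by chi in the plane of
  \<open>circle12 \<theta>\<close> and \<open>circle34 \<phi>\<close>.\<close>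

lemma trace_toroidal_frame:
  fixes L :: "real^4 \<Rightarrow> real^4" and chi \<theta> \<phi> :: real
  assumes L: "linear L"
  defines "x \<equiv> toroidal chi \<theta> \<phi>" and "x' \<equiv> (- sin chi) *\<^sub>R circle12 \<theta> + cos chi *\<^sub>R circle34 \<phi>"
  shows "(\<Sum>e\<in>Basis. L e \<bullet> e) = L x \<bullet> x + L x' \<bullet> x' + L (circle12' \<theta>) \<bullet> circle12' \<theta> + L (circle34' \<phi>) \<bullet> circle34' \<phi>"
  using trace_rotation[OF L, of chi "circle12 \<theta>" "circle34 \<phi>"]
    trace_rotation[OF L, of \<theta> "axis 1 1" "axis 2 1"] trace_rotation[OF L, of \<phi> "axis 3 1" "axis 4 1"]
  unfolding x_def x'_def toroidal_eq sum_Basis4 circle_defs[symmetric] by linarith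

text \<open>Differentiating |c|^2 = 1 shows that c' is tangent, so pairing with c' does not see the
  difference between \<open>S3_grad f\<close> and the ambient gradient \<open>D\<close>. The first
  derivative is stated intrinsically, to be one global function; the second is computed in any
  extension around the point.\<close>

lemma smooth_on_curve:
  assumes f: "smooth_on_S3 f" and c: "\<And>t. c t \<in> S3"
    and c': "\<And>t. (c has_vector_derivative c' t) (at t)" and c'': "\<And>t. (c' has_vector_derivative c'' t) (at t)"
  shows smooth_on_curve_deriv: "((\<lambda>t. f (c t)) has_real_derivative S3_grad f (c t) \<bullet> c' t) (at t)"
    and smooth_on_curve_deriv2: "C2_extension f U g D K \<Longrightarrow> c t \<in> U \<Longrightarrow>
      ((\<lambda>t. S3_grad f (c t) \<bullet> c' t) has_real_derivative K (c t) (c' t) \<bullet> c' t + D (c t) \<bullet> c'' t) (at t)"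
proof -
  have tangent: "c t \<bullet> c' t = 0" for t
  proof -
    have "((\<lambda>t. c t \<bullet> c t) has_vector_derivative (c t \<bullet> c' t + c' t \<bullet> c t)) (at t)"
      using has_derivative_inner[OF c'[of t, unfolded has_vector_derivative_def] c'[of t, unfolded has_vector_derivative_def]]
      unfolding has_vector_derivative_def by (simp add: algebra_simps)
    moreover have "(\<lambda>t. c t \<bullet> c t) = (\<lambda>t. 1)" using c by (auto simp: norm_eq_1)
    ultimately have "((\<lambda>t. 1::real) has_vector_derivative (c t \<bullet> c' t + c' t \<bullet> c t)) (at t)" by simp
    then have "c t \<bullet> c' t + c' t \<bullet> c t = 0"
      using vector_derivative_unique_at has_vector_derivative_const by blast
    then show ?thesis by (simp add: inner_commute[of "c' t"])
  qed
  have grad: "S3_grad f (c t) \<bullet> c' t = D (c t) \<bullet> c' t" if "C2_extension f U g D K" "c t \<in> U" for U g D K t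
    using S3_grad_eq[OF that(1), of "c t"] that(2) c[of t] tangent[of t] by (simp add: inner_diff_left)
  have nbhd: "\<forall>\<^sub>F s in nhds t. c s \<in> U" if "open U" "c t \<in> U" for U t
  proof -
    have "isCont c t" using c' has_vector_derivative_continuous by blast
    then have "(c \<longlongrightarrow> c t) (nhds t)"
      by (simp add: isCont_def tendsto_at_iff_tendsto_nhds)
    then show ?thesis using that by (rule topological_tendstoD)
  qed
  show "((\<lambda>t. f (c t)) has_real_derivative S3_grad f (c t) \<bullet> c' t) (at t)"
  proof -
    obtain U g D K where C2: "C2_extension f U g D K" and U: "c t \<in> U"
      using smooth_on_S3_C2_extension[OF f c] .
    have "(g has_derivative (\<lambda>v. D (c t) \<bullet> v)) (at (c t))" and op: "open U"
      using C2 U by (auto simp: C2_extension_def)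
    then have "((\<lambda>t. g (c t)) has_derivative (\<lambda>h. D (c t) \<bullet> (h *\<^sub>R c' t))) (at t)"
      using c'[of t] has_derivative_compose unfolding has_vector_derivative_def by blast
    then have "((\<lambda>t. g (c t)) has_real_derivative D (c t) \<bullet> c' t) (at t)"
      by (simp add: has_field_derivative_def mult_commute_abs)
    moreover have "\<forall>\<^sub>F s in nhds t. f (c s) = g (c s)"
      using nbhd[OF op U] by eventually_elim (use C2 c in \<open>auto simp: C2_extension_def\<close>)
    ultimately show ?thesis
      unfolding grad[OF C2 U] by (subst DERIV_cong_ev) auto
  qed
  show "((\<lambda>t. S3_grad f (c t) \<bullet> c' t) has_real_derivative K (c t) (c' t) \<bullet> c' t + D (c t) \<bullet> c'' t) (at t)"
    if C2: "C2_extension f U g D K" and U: "c t \<in> U"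
  proof -
    have "(D has_derivative K (c t)) (at (c t))" and op: "open U"
      using C2 U by (auto simp: C2_extension_def)
    then have 1: "((\<lambda>t. D (c t)) has_derivative (\<lambda>h. K (c t) (h *\<^sub>R c' t))) (at t)"
      using c'[of t] has_derivative_compose unfolding has_vector_derivative_def by blast
    have lin: "linear (K (c t))" using \<open>(D has_derivative K (c t)) (at (c t))\<close> has_derivative_linear by blast
    have "((\<lambda>t. D (c t) \<bullet> c' t) has_derivative (\<lambda>h. D (c t) \<bullet> (h *\<^sub>R c'' t) + K (c t) (h *\<^sub>R c' t) \<bullet> c' t)) (at t)"
      using has_derivative_inner[OF 1 c''[of t, unfolded has_vector_derivative_def]] .
    then have "((\<lambda>t. D (c t) \<bullet> c' t) has_real_derivative K (c t) (c' t) \<bullet> c' t + D (c t) \<bullet> c'' t) (at t)"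
      using lin by (simp add: has_field_derivative_def linear_cmul distrib_left[symmetric] mult_commute_abs add.commute[of "D _ \<bullet> _"])
    moreover have "\<forall>\<^sub>F s in nhds t. S3_grad f (c s) \<bullet> c' s = D (c s) \<bullet> c' s"
      using nbhd[OF op U] by eventually_elim (rule grad[OF C2])
    ultimately show ?thesis
      by (subst DERIV_cong_ev) auto
  qed
qed

section \<open>Partial derivatives and the Laplacian in coordinates\<close>

lemma continuous_on_toroidal [continuous_intros]:
  fixes S :: "'a::t2_space set"
  assumes "continuous_on S a" "continuous_on S b" "continuous_on S c"
  shows "continuous_on S (\<lambda>x. toroidal (a x) (b x) (c x))"
  unfolding toroidal_eq by (intro continuous_intros assms)

lemma continuous_on_S3_grad:
  assumes f: "smooth_on_S3 f"
  shows "continuous_on S3 (S3_grad f)"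
  unfolding continuous_on_eq_continuous_within
proof (intro ballI)
  fix x :: "real^4" assume x: "x \<in> S3"
  obtain U g D K where C2: "C2_extension f U g D K" and U: "x \<in> U"
    using smooth_on_S3_C2_extension[OF f x] .
  have "continuous_on (S3 \<inter> U) D"
    using continuous_on_C2_gradient[OF C2] by (rule continuous_on_subset) auto
  then have "continuous_on (S3 \<inter> U) (\<lambda>y. D y - (D y \<bullet> y) *\<^sub>R y)"
    by (intro continuous_intros)
  then have "continuous_on (S3 \<inter> U) (S3_grad f)"
    by (rule continuous_on_eq) (use S3_grad_eq[OF C2] in auto)
  then have "continuous (at x within S3 \<inter> U) (S3_grad f)"
    using x U by (auto simp: continuous_on_eq_continuous_within)
  moreover have "at x within S3 \<inter> U = at x within S3"
    by (rule at_within_nhd[of x U]) (use U C2 in \<open>auto simp: C2_extension_def\<close>)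
  ultimately show "continuous (at x within S3) (S3_grad f)" by simp
qed

text \<open>Continuity is local, and near each point a single extension describes \<open>h\<close>
  on a whole neighbourhood, since the assumed formula holds for every extension.\<close>

lemma continuous_on_second_derivative:
  fixes h :: "real \<times> real \<times> real \<Rightarrow> real" and X :: "real \<times> real \<times> real \<Rightarrow> real^4"
  assumes f: "smooth_on_S3 f" and X: "continuous_on UNIV X" "\<And>p. X p \<in> S3"
    and V: "continuous_on UNIV V" and A: "continuous_on UNIV A"
    and h: "\<And>p U g D K. C2_extension f U g D K \<Longrightarrow> X p \<in> U \<Longrightarrow> h p = K (X p) (V p) \<bullet> V p + D (X p) \<bullet> A p"
  shows "continuous_on UNIV h"
proof -
  have "isCont h p" for p
  proof -
    obtain U g D K where C2: "C2_extension f U g D K" and U: "X p \<in> U"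
      using smooth_on_S3_C2_extension[OF f X(2)] .
    have op: "open (X -` U)"
      using C2 X(1) by (simp add: C2_extension_def open_vimage)
    have "continuous_on (X -` U) (\<lambda>p. K (X p) (V p) \<bullet> V p + D (X p) \<bullet> A p)"
      by (intro continuous_intros continuous_on_C2_Hessian[OF C2] continuous_on_compose2[OF continuous_on_C2_gradient[OF C2]]
         continuous_on_subset[OF X(1)] continuous_on_subset[OF V] continuous_on_subset[OF A]) auto
    then have "continuous_on (X -` U) h"
      by (rule continuous_on_eq) (use h[OF C2] in auto)
    then show ?thesis using op U by (simp add: continuous_on_eq_continuous_at)
  qed
  then show ?thesis by (simp add: continuous_on_eq_continuous_at)
qed

definition toroidal_dchi :: "real \<Rightarrow> real \<Rightarrow> real \<Rightarrow> real^4" where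
  "toroidal_dchi chi \<theta> \<phi> = (- sin chi) *\<^sub>R circle12 \<theta> + cos chi *\<^sub>R circle34 \<phi>"

lemma toroidal_curve_derivs:
  "((\<lambda>t. toroidal t \<theta> \<phi>) has_vector_derivative toroidal_dchi t \<theta> \<phi>) (at t)"
  "((\<lambda>t. toroidal_dchi t \<theta> \<phi>) has_vector_derivative - toroidal t \<theta> \<phi>) (at t)"
  "((\<lambda>t. toroidal chi t \<phi>) has_vector_derivative cos chi *\<^sub>R circle12' t) (at t)"
  "((\<lambda>t. cos chi *\<^sub>R circle12' t) has_vector_derivative (- cos chi) *\<^sub>R circle12 t) (at t)"
  "((\<lambda>t. toroidal chi \<theta> t) has_vector_derivative sin chi *\<^sub>R circle34' t) (at t)"
  "((\<lambda>t. sin chi *\<^sub>R circle34' t) has_vector_derivative (- sin chi) *\<^sub>R circle34 t) (at t)"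
proof -
  show "((\<lambda>t. toroidal t \<theta> \<phi>) has_vector_derivative toroidal_dchi t \<theta> \<phi>) (at t)"
    unfolding toroidal_eq toroidal_dchi_def
    by (rule has_vector_derivative_eq_rhs, (rule has_vector_derivative_add has_vector_derivative_scaleR DERIV_cos DERIV_sin has_vector_derivative_const)+) simp
  show "((\<lambda>t. toroidal_dchi t \<theta> \<phi>) has_vector_derivative - toroidal t \<theta> \<phi>) (at t)"
    unfolding toroidal_eq toroidal_dchi_def
    by (rule has_vector_derivative_eq_rhs, (rule has_vector_derivative_add has_vector_derivative_scaleR DERIV_cos DERIV_minus DERIV_sin has_vector_derivative_const)+) simp
  show "((\<lambda>t. toroidal chi t \<phi>) has_vector_derivative cos chi *\<^sub>R circle12' t) (at t)"
    "((\<lambda>t. cos chi *\<^sub>R circle12' t) has_vector_derivative (- cos chi) *\<^sub>R circle12 t) (at t)"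
    "((\<lambda>t. toroidal chi \<theta> t) has_vector_derivative sin chi *\<^sub>R circle34' t) (at t)"
    "((\<lambda>t. sin chi *\<^sub>R circle34' t) has_vector_derivative (- sin chi) *\<^sub>R circle34 t) (at t)"
    unfolding toroidal_eq
    by (rule has_vector_derivative_eq_rhs, (rule has_vector_derivative_add has_vector_derivative_scaleR DERIV_const circle_vector_derivative has_vector_derivative_const)+, simp)+
qed

text \<open>The coefficient of \<open>F1\<close> is the logarithmic derivative of the volume density
  cos x sin x. The formula for the Laplacian is restricted to points where both factors are nonzero,
  whereas the partial derivatives exist everywhere.\<close>

definition has_toroidal_partials ::
  "(real^4 \<Rightarrow> real) \<Rightarrow> (real \<Rightarrow> real \<Rightarrow> real \<Rightarrow> real) \<Rightarrow> (real \<Rightarrow> real \<Rightarrow> real \<Rightarrow> real) \<Rightarrow> (real \<Rightarrow> real \<Rightarrow> real \<Rightarrow> real) \<Rightarrow>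
   (real \<Rightarrow> real \<Rightarrow> real \<Rightarrow> real) \<Rightarrow> (real \<Rightarrow> real \<Rightarrow> real \<Rightarrow> real) \<Rightarrow> (real \<Rightarrow> real \<Rightarrow> real \<Rightarrow> real) \<Rightarrow> bool"
  where "has_toroidal_partials f F1 F11 F2 F22 F3 F33 \<longleftrightarrow>
    (\<forall>x y z. ((\<lambda>t. f (toroidal t y z)) has_real_derivative F1 x y z) (at x) \<and>
       ((\<lambda>t. F1 t y z) has_real_derivative F11 x y z) (at x) \<and>
       ((\<lambda>t. f (toroidal x t z)) has_real_derivative F2 x y z) (at y) \<and>
       ((\<lambda>t. F2 x t z) has_real_derivative F22 x y z) (at y) \<and>
       ((\<lambda>t. f (toroidal x y t)) has_real_derivative F3 x y z) (at z) \<and>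
       ((\<lambda>t. F3 x y t) has_real_derivative F33 x y z) (at z) \<and>
       (cos x \<noteq> 0 \<longrightarrow> sin x \<noteq> 0 \<longrightarrow> S3_laplacian f (toroidal x y z) =
          F11 x y z + ((cos x)\<^sup>2 - (sin x)\<^sup>2) / (cos x * sin x) * F1 x y z + F22 x y z / (cos x)\<^sup>2 + F33 x y z / (sin x)\<^sup>2)) \<and>
    continuous_on UNIV (\<lambda>(x, y, z). F1 x y z) \<and>
    continuous_on UNIV (\<lambda>(x, y, z). F11 x y z) \<and>
    continuous_on UNIV (\<lambda>(x, y, z). F22 x y z) \<and>
    continuous_on UNIV (\<lambda>(x, y, z). F33 x y z)"

lemma toroidal_partial_derivatives:
  assumes f: "smooth_on_S3 f"
  shows "\<exists>F1 F11 F2 F22 F3 F33. has_toroidal_partials f F1 F11 F2 F22 F3 F33"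
proof -
  note d1 = smooth_on_curve_deriv[OF f toroidal_in_S3 toroidal_curve_derivs(1) toroidal_curve_derivs(2)]
  note d2 = smooth_on_curve_deriv[OF f toroidal_in_S3 toroidal_curve_derivs(3) toroidal_curve_derivs(4)]
  note d3 = smooth_on_curve_deriv[OF f toroidal_in_S3 toroidal_curve_derivs(5) toroidal_curve_derivs(6)]
  note e1 = smooth_on_curve_deriv2[OF f toroidal_in_S3 toroidal_curve_derivs(1) toroidal_curve_derivs(2)]
  note e2 = smooth_on_curve_deriv2[OF f toroidal_in_S3 toroidal_curve_derivs(3) toroidal_curve_derivs(4)]
  note e3 = smooth_on_curve_deriv2[OF f toroidal_in_S3 toroidal_curve_derivs(5) toroidal_curve_derivs(6)]
  define F1 where "F1 x y z = S3_grad f (toroidal x y z) \<bullet> toroidal_dchi x y z" for x y z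
  define F2 where "F2 x y z = S3_grad f (toroidal x y z) \<bullet> (cos x *\<^sub>R circle12' y)" for x y z
  define F3 where "F3 x y z = S3_grad f (toroidal x y z) \<bullet> (sin x *\<^sub>R circle34' z)" for x y z
  \<comment> \<open>\<open>deriv\<close> gives a value independent of the local extension;
    \<open>h1\<close>, \<open>h2\<close> and \<open>h3\<close> evaluate it in whichever extension is
    at hand.\<close>
  define F11 where "F11 x y z = deriv (\<lambda>t. F1 t y z) x" for x y z
  define F22 where "F22 x y z = deriv (\<lambda>t. F2 x t z) y" for x y z
  define F33 where "F33 x y z = deriv (\<lambda>t. F3 x y t) z" for x y z
  let ?T = toroidal
  have h1: "F11 x y z = K (?T x y z) (toroidal_dchi x y z) \<bullet> toroidal_dchi x y z + D (?T x y z) \<bullet> - ?T x y z"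
    and g1: "((\<lambda>t. F1 t y z) has_real_derivative F11 x y z) (at x)"
    if "C2_extension f U g D K" "?T x y z \<in> U" for U g D K x y z
    using DERIV_imp_deriv[OF e1[OF that]] e1[OF that] by (simp_all add: F11_def F1_def)
  have h2: "F22 x y z = K (?T x y z) (cos x *\<^sub>R circle12' y) \<bullet> (cos x *\<^sub>R circle12' y) + D (?T x y z) \<bullet> ((- cos x) *\<^sub>R circle12 y)"
    and g2: "((\<lambda>t. F2 x t z) has_real_derivative F22 x y z) (at y)"
    if "C2_extension f U g D K" "?T x y z \<in> U" for U g D K x y z
    using DERIV_imp_deriv[OF e2[OF that]] e2[OF that] by (simp_all add: F22_def F2_def)
  have h3: "F33 x y z = K (?T x y z) (sin x *\<^sub>R circle34' z) \<bullet> (sin x *\<^sub>R circle34' z) + D (?T x y z) \<bullet> ((- sin x) *\<^sub>R circle34 z)"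
    and g3: "((\<lambda>t. F3 x y t) has_real_derivative F33 x y z) (at z)"
    if "C2_extension f U g D K" "?T x y z \<in> U" for U g D K x y z
    using DERIV_imp_deriv[OF e3[OF that]] e3[OF that] by (simp_all add: F33_def F3_def)
  have lap: "S3_laplacian f (?T x y z) =
        F11 x y z + ((cos x)\<^sup>2 - (sin x)\<^sup>2) / (cos x * sin x) * F1 x y z + F22 x y z / (cos x)\<^sup>2 + F33 x y z / (sin x)\<^sup>2"
    if nz: "cos x \<noteq> 0" "sin x \<noteq> 0" for x y z
  proof -
    obtain U g D K where C2: "C2_extension f U g D K" and U: "?T x y z \<in> U"
      using smooth_on_S3_C2_extension[OF f toroidal_in_S3] .
    have lin: "linear (K (?T x y z))" using C2 U has_derivative_linear unfolding C2_extension_def by blast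
    define p where "p = D (?T x y z) \<bullet> circle12 y"
    define q where "q = D (?T x y z) \<bullet> circle34 z"
    define A where "A = K (?T x y z) (circle12' y) \<bullet> circle12' y"
    define B where "B = K (?T x y z) (circle34' z) \<bullet> circle34' z"
    define C where "C = K (?T x y z) (toroidal_dchi x y z) \<bullet> toroidal_dchi x y z"
    have DT: "D (?T x y z) \<bullet> ?T x y z = cos x * p + sin x * q"
      unfolding p_def q_def by (subst (2) toroidal_eq) (simp add: inner_add_right)
    have "toroidal_dchi x y z \<bullet> ?T x y z = 0"
      by (simp add: toroidal_dchi_def toroidal_eq inner_add_left inner_add_right inner_diff_left circle_inner)
    then have "F1 x y z = D (?T x y z) \<bullet> toroidal_dchi x y z"
      unfolding F1_def S3_grad_eq[OF C2 IntI[OF U toroidal_in_S3]]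
      by (simp add: inner_diff_left inner_commute[of "?T x y z" "toroidal_dchi x y z"])
    then have F1: "F1 x y z = cos x * q - sin x * p"
      by (simp add: p_def q_def toroidal_dchi_def inner_add_right inner_diff_right)
    have F11: "F11 x y z = C - (cos x * p + sin x * q)"
      unfolding h1[OF C2 U] by (simp add: DT C_def)
    have F22: "F22 x y z = (cos x)\<^sup>2 * A - cos x * p"
      unfolding h2[OF C2 U] using lin by (simp add: A_def p_def linear_cmul power2_eq_square)
    have F33: "F33 x y z = (sin x)\<^sup>2 * B - sin x * q"
      unfolding h3[OF C2 U] using lin by (simp add: B_def q_def linear_cmul power2_eq_square)
    \<comment> \<open>In the toroidal frame the radial entry of the Hessian trace cancels the radial
      second derivative in \<open>S3_laplacian_eq\<close>.\<close>
    have "S3_laplacian f (?T x y z) = C + A + B - 3 * (cos x * p + sin x * q)"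
      unfolding S3_laplacian_eq[OF C2 IntI[OF U toroidal_in_S3]] trace_toroidal_frame[OF lin, of x y z, folded toroidal_dchi_def] DT
      by (simp add: A_def B_def C_def)
    \<comment> \<open>Only first-order terms are left to compare. \<open>F11\<close> accounts for
      one of the three copies of cos x p + sin x q; the accelerations of the two angular circles and
      the \<open>F1\<close> term supply the other two.\<close>
    moreover have "((cos x)\<^sup>2 - (sin x)\<^sup>2) / (cos x * sin x) * (cos x * q - sin x * p) - cos x * p / (cos x)\<^sup>2 - sin x * q / (sin x)\<^sup>2
      = - 2 * (cos x * p + sin x * q)"
    proof -
      define c where "c = cos x"
      define s where "s = sin x"
      have cs: "c\<^sup>2 + s\<^sup>2 = 1" by (simp add: c_def s_def)
      have nz': "c \<noteq> 0" "s \<noteq> 0" using nz by (simp_all add: c_def s_def)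
      have "(c\<^sup>2 - s\<^sup>2) / (c * s) * (c * q - s * p) - c * p / c\<^sup>2 - s * q / s\<^sup>2
         = ((c\<^sup>2 - s\<^sup>2) * (c * q - s * p) - s * p - c * q) / (c * s)"
        using nz' by (simp add: field_simps power2_eq_square)
      also have "(c\<^sup>2 - s\<^sup>2) * (c * q - s * p) - s * p - c * q = (c\<^sup>2 - s\<^sup>2) * (c * q - s * p) - (s * p + c * q) * (c\<^sup>2 + s\<^sup>2)"
        unfolding cs by simp
      also have "\<dots> = - 2 * (c * p + s * q) * (c * s)"
        by (simp add: power2_eq_square algebra_simps)
      also have "\<dots> / (c * s) = - 2 * (c * p + s * q)" using nz' by simp
      finally show ?thesis unfolding c_def s_def .
    qed
    moreover have "F22 x y z / (cos x)\<^sup>2 = A - cos x * p / (cos x)\<^sup>2" "F33 x y z / (sin x)\<^sup>2 = B - sin x * q / (sin x)\<^sup>2"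
      using nz unfolding F22 F33 by (simp_all add: diff_divide_distrib)
    \<comment> \<open>With the quotients as atoms the claim becomes polynomial.\<close>
    moreover define W where "W = ((cos x)\<^sup>2 - (sin x)\<^sup>2) / (cos x * sin x) * (cos x * q - sin x * p)"
    moreover define P Q R S where "P = cos x * p / (cos x)\<^sup>2" and "Q = sin x * q / (sin x)\<^sup>2"
      and "R = F22 x y z / (cos x)\<^sup>2" and "S = F33 x y z / (sin x)\<^sup>2"
    ultimately show ?thesis
      unfolding F11 F1 W_def[symmetric] P_def[symmetric] Q_def[symmetric] R_def[symmetric] S_def[symmetric]
      by algebra
  qed
  have X: "continuous_on UNIV (\<lambda>(x, y, z). ?T x y z)" "\<And>p. (\<lambda>(x, y, z). ?T x y z) p \<in> S3"
    unfolding case_prod_unfold by (auto intro!: continuous_intros)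
  have c11: "continuous_on UNIV (\<lambda>(x, y, z). F11 x y z)"
    by (rule continuous_on_second_derivative[OF f X, where V = "\<lambda>(x, y, z). toroidal_dchi x y z" and A = "\<lambda>(x, y, z). - ?T x y z"])
       (auto simp: case_prod_unfold toroidal_dchi_def h1 intro!: continuous_intros)
  have c22: "continuous_on UNIV (\<lambda>(x, y, z). F22 x y z)"
    by (rule continuous_on_second_derivative[OF f X, where V = "\<lambda>(x, y, z). cos x *\<^sub>R circle12' y" and A = "\<lambda>(x, y, z). (- cos x) *\<^sub>R circle12 y"])
       (auto simp: case_prod_unfold h2 intro!: continuous_intros)
  have c33: "continuous_on UNIV (\<lambda>(x, y, z). F33 x y z)"
    by (rule continuous_on_second_derivative[OF f X, where V = "\<lambda>(x, y, z). sin x *\<^sub>R circle34' z" and A = "\<lambda>(x, y, z). (- sin x) *\<^sub>R circle34 z"])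
       (auto simp: case_prod_unfold h3 intro!: continuous_intros)
  have "continuous_on UNIV (\<lambda>p. S3_grad f (?T (fst p) (fst (snd p)) (snd (snd p))))"
    by (rule continuous_on_compose2[OF continuous_on_S3_grad[OF f]])
       (use X in \<open>auto simp: case_prod_unfold\<close>)
  then have c1: "continuous_on UNIV (\<lambda>(x, y, z). F1 x y z)"
    unfolding F1_def case_prod_unfold toroidal_dchi_def
    by (rule continuous_on_inner) (intro continuous_intros)
  have t1: "((\<lambda>t. F1 t y z) has_real_derivative F11 x y z) (at x)"
    and t2: "((\<lambda>t. F2 x t z) has_real_derivative F22 x y z) (at y)"
    and t3: "((\<lambda>t. F3 x y t) has_real_derivative F33 x y z) (at z)" for x y z
  proof -
    obtain U g D K where "C2_extension f U g D K" "?T x y z \<in> U"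
      using smooth_on_S3_C2_extension[OF f toroidal_in_S3] .
    then show "((\<lambda>t. F1 t y z) has_real_derivative F11 x y z) (at x)"
      "((\<lambda>t. F2 x t z) has_real_derivative F22 x y z) (at y)" "((\<lambda>t. F3 x y t) has_real_derivative F33 x y z) (at z)"
      by (rule g1, rule g2, rule g3)
  qed
  have s1: "((\<lambda>t. f (?T t y z)) has_real_derivative F1 x y z) (at x)"
    and s2: "((\<lambda>t. f (?T x t z)) has_real_derivative F2 x y z) (at y)"
    and s3: "((\<lambda>t. f (?T x y t)) has_real_derivative F3 x y z) (at z)" for x y z
    unfolding F1_def F2_def F3_def by (rule d1 d2 d3)+
  have "has_toroidal_partials f F1 F11 F2 F22 F3 F33"
    unfolding has_toroidal_partials_def
    apply (intro conjI allI impI)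
    apply (rule s1)
    apply (rule t1)
    apply (rule s2)
    apply (rule t2)
    apply (rule s3)
    apply (rule t3)
    apply (rule lap; assumption)
    apply (rule c1 c11 c22 c33)+
    done
  then show ?thesis by blast
qed

section \<open>Modes as polynomials\<close>

text \<open>Conjugation instead of inversion for negative exponents: the value stays a polynomial in
  the coordinates, and its modulus is |z| to the power |l|, as the radial factor requires.\<close>

definition zpow :: "int \<Rightarrow> complex \<Rightarrow> complex" where
  "zpow l z = (if l \<ge> 0 then z ^ nat l else cnj z ^ nat (- l))"

lemma zpow_polar: "zpow l (complex_of_real r * cis t) = complex_of_real (r ^ nat \<bar>l\<bar>) * cis (of_int l * t)"
proof (cases "l \<ge> 0")
  case True
  then show ?thesis by (simp add: zpow_def power_mult_distrib Complex.DeMoivre)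
next
  case False
  then have "real (nat (- l)) = - of_int l" by simp
  then show ?thesis using False
    by (simp add: zpow_def power_mult_distrib Complex.DeMoivre cis_cnj)
qed

text \<open>The separated function written on the ambient space: \<open>\<delta>\<close> selects a
  mixture of real and imaginary part, and the argument of \<open>Q\<close> is cos^2 chi on the
  sphere. In this form the circles where an angle is undetermined are not special.\<close>

definition torus_mode :: "int \<Rightarrow> int \<Rightarrow> real \<Rightarrow> real poly \<Rightarrow> real^4 \<Rightarrow> real" where
  "torus_mode l m \<delta> Q x =
     Re (cis \<delta> * zpow l (Complex (x$1) (x$2)) * zpow m (Complex (x$3) (x$4))) * poly Q ((x$1)\<^sup>2 + (x$2)\<^sup>2)"

lemma toroidal_components:
  "toroidal x y z $ 1 = cos x * cos y" "toroidal x y z $ 2 = cos x * sin y"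
  "toroidal x y z $ 3 = sin x * cos z" "toroidal x y z $ 4 = sin x * sin z"
  by (simp_all add: toroidal_def vector_def)

lemma toroidal_complex:
  "Complex (toroidal x y z $ 1) (toroidal x y z $ 2) = complex_of_real (cos x) * cis y"
  "Complex (toroidal x y z $ 3) (toroidal x y z $ 4) = complex_of_real (sin x) * cis z"
  by (simp_all add: toroidal_components complex_eq_iff)

lemma toroidal_square: "(toroidal x y z $ 1)\<^sup>2 + (toroidal x y z $ 2)\<^sup>2 = (cos x)\<^sup>2"
  by (simp add: toroidal_components power_mult_distrib flip: distrib_left)

lemma torus_mode_toroidal:
  "torus_mode l m \<delta> Q (toroidal x y z) =
     cos x ^ nat \<bar>l\<bar> * sin x ^ nat \<bar>m\<bar> * poly Q ((cos x)\<^sup>2) * cos (of_int l * y + of_int m * z + \<delta>)"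
proof -
  have *: "cis \<delta> * (complex_of_real a * cis u) * (complex_of_real b * cis v) = complex_of_real (a * b) * cis (u + v + \<delta>)" for a b u v
    by (simp add: cis_mult[symmetric] mult_ac)
  then have "Re (cis \<delta> * (complex_of_real a * cis u) * (complex_of_real b * cis v)) = a * b * cos (u + v + \<delta>)" for a b u v
    unfolding * by simp
  note * = this[of "cos x ^ nat \<bar>l\<bar>" "of_int l * y" "sin x ^ nat \<bar>m\<bar>" "of_int m * z"]
  show ?thesis
    unfolding torus_mode_def toroidal_square toroidal_complex zpow_polar * by (simp only: mult_ac)
qed

lemma real_polynomial_function_complex_power:
  assumes "real_polynomial_function a" "real_polynomial_function b"
  shows "real_polynomial_function (\<lambda>x. Re (Complex (a x) (b x) ^ n)) \<and> real_polynomial_function (\<lambda>x. Im (Complex (a x) (b x) ^ n))"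
proof (induction n)
  case (Suc n)
  then show ?case using assms by (auto intro!: real_polynomial_function.intros(3,4) real_polynomial_function_diff)
qed auto

lemma real_polynomial_function_component: "real_polynomial_function (\<lambda>x :: real^'n. x $ i)"
  by (rule real_polynomial_function.intros(1)) (rule bounded_linear_vec_nth)

lemma real_polynomial_function_poly:
  assumes "real_polynomial_function a"
  shows "real_polynomial_function (\<lambda>x. poly Q (a x))"
  by (induction Q) (auto intro!: real_polynomial_function.intros(2,3,4) assms)

lemma real_polynomial_function_zpow:
  "real_polynomial_function (\<lambda>x :: real^'n. Re (zpow l (Complex (x $ i) (x $ j))))"
  "real_polynomial_function (\<lambda>x :: real^'n. Im (zpow l (Complex (x $ i) (x $ j))))"
proof -
  have "cnj (Complex a b) = Complex a (- b)" for a b by (simp add: complex_eq_iff)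
  then show "real_polynomial_function (\<lambda>x :: real^'n. Re (zpow l (Complex (x $ i) (x $ j))))"
    "real_polynomial_function (\<lambda>x :: real^'n. Im (zpow l (Complex (x $ i) (x $ j))))"
    unfolding zpow_def
    using real_polynomial_function_complex_power[of "\<lambda>x::real^'n. x $ i" "\<lambda>x. x $ j" "nat l"]
      real_polynomial_function_complex_power[of "\<lambda>x::real^'n. x $ i" "\<lambda>x. - x $ j" "nat (- l)"]
    by (cases "l \<ge> 0"; simp add: real_polynomial_function_component real_polynomial_function_minus)+
qed

lemma real_polynomial_function_torus_mode: "real_polynomial_function (torus_mode l m \<delta> Q)"
proof -
  have "torus_mode l m \<delta> Q = (\<lambda>x.
    ((cos \<delta> * Re (zpow l (Complex (x$1) (x$2))) - sin \<delta> * Im (zpow l (Complex (x$1) (x$2)))) * Re (zpow m (Complex (x$3) (x$4)))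
    - (cos \<delta> * Im (zpow l (Complex (x$1) (x$2))) + sin \<delta> * Re (zpow l (Complex (x$1) (x$2)))) * Im (zpow m (Complex (x$3) (x$4))))
    * poly Q ((x$1)\<^sup>2 + (x$2)\<^sup>2))"
    by (simp add: torus_mode_def fun_eq_iff)
  then show ?thesis
    by (auto intro!: real_polynomial_function.intros(2,3,4) real_polynomial_function_diff real_polynomial_function_zpow
        real_polynomial_function_poly real_polynomial_function_power real_polynomial_function_component)
qed

section \<open>Smoothness of polynomials; locality and linearity of the Laplacian\<close>

lemma real_polynomial_function_has_derivative:
  fixes p :: "'a::real_normed_vector \<Rightarrow> real"
  assumes "real_polynomial_function p"
  shows "\<exists>p'. (\<forall>x. (p has_derivative p' x) (at x)) \<and> (\<forall>v. real_polynomial_function (\<lambda>x. p' x v))"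
  using assms
proof (induction p)
  case (linear f)
  then show ?case by (intro exI[of _ "\<lambda>x. f"]) (auto intro: bounded_linear_imp_has_derivative)
next
  case (const c)
  then show ?case by (intro exI[of _ "\<lambda>x v. 0"]) auto
next
  case (add f g)
  then obtain f' g' where "\<forall>x. (f has_derivative f' x) (at x)" "\<forall>v. real_polynomial_function (\<lambda>x. f' x v)"
    "\<forall>x. (g has_derivative g' x) (at x)" "\<forall>v. real_polynomial_function (\<lambda>x. g' x v)" by blast
  then show ?case by (intro exI[of _ "\<lambda>x v. f' x v + g' x v"]) (auto intro!: has_derivative_add)
next
  case (mult f g)
  then obtain f' g' where "\<forall>x. (f has_derivative f' x) (at x)" "\<forall>v. real_polynomial_function (\<lambda>x. f' x v)"
    "\<forall>x. (g has_derivative g' x) (at x)" "\<forall>v. real_polynomial_function (\<lambda>x. g' x v)" by blast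
  then show ?case using mult.hyps
    by (intro exI[of _ "\<lambda>x v. f x * g' x v + f' x v * g x"]) (auto intro!: has_derivative_mult real_polynomial_function.intros(3,4))
qed

lemma Ck_on_real_polynomial_function: "real_polynomial_function p \<Longrightarrow> Ck_on n U p"
proof (induction n arbitrary: p)
  case 0
  then show ?case
    by (auto intro!: continuous_at_imp_continuous_on continuous_real_polymonial_function)
next
  case (Suc n)
  then obtain p' where p': "\<forall>x. (p has_derivative p' x) (at x)" "\<forall>v. real_polynomial_function (\<lambda>x. p' x v)"
    using real_polynomial_function_has_derivative by blast
  then have "frechet_derivative p (at x) = p' x" for x
    using frechet_derivative_at by metis
  then show ?case using p' Suc.IH by (auto simp: differentiable_def)
qed

lemma smooth_on_S3_cong: "(\<And>x. x \<in> S3 \<Longrightarrow> f x = g x) \<Longrightarrow> smooth_on_S3 f \<longleftrightarrow> smooth_on_S3 g"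
  unfolding smooth_on_S3_def by (metis IntD2)

lemma smooth_on_S3_polynomial: "real_polynomial_function p \<Longrightarrow> smooth_on_S3 p"
  unfolding smooth_on_S3_def using Ck_on_real_polynomial_function by blast

text \<open>A local extension of one function is also one of the other, and the extension determines
  the Laplacian.\<close>

lemma S3_laplacian_cong:
  assumes "smooth_on_S3 f" "\<And>x. x \<in> S3 \<Longrightarrow> f x = g x" "x \<in> S3"
  shows "S3_laplacian f x = S3_laplacian g x"
proof -
  obtain U h D K where C2: "C2_extension f U h D K" and U: "x \<in> U"
    using smooth_on_S3_C2_extension[OF assms(1,3)] .
  then have "C2_extension g U h D K" using assms(2) unfolding C2_extension_def by auto
  from S3_laplacian_eq[OF C2] S3_laplacian_eq[OF this] show ?thesis using U assms(3) by simp
qed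

lemma S3_laplacian_add_scale:
  assumes f: "smooth_on_S3 f" and g: "smooth_on_S3 g" and x: "x \<in> S3"
  shows "S3_laplacian (\<lambda>x. c * f x + g x) x = c * S3_laplacian f x + S3_laplacian g x"
proof -
  obtain U f' D K where C2: "C2_extension f U f' D K" and U: "x \<in> U"
    using smooth_on_S3_C2_extension[OF f x] .
  obtain V g' E L where C2': "C2_extension g V g' E L" and V: "x \<in> V"
    using smooth_on_S3_C2_extension[OF g x] .
  have "C2_extension (\<lambda>x. c * f x + g x) (U \<inter> V) (\<lambda>x. c * f' x + g' x) (\<lambda>x. c *\<^sub>R D x + E x) (\<lambda>x v. c *\<^sub>R K x v + L x v)"
    unfolding C2_extension_def
  proof (intro conjI ballI allI)
    show "open (U \<inter> V)" using C2 C2' by (simp add: C2_extension_def open_Int)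
    fix y assume y: "y \<in> U \<inter> V"
    have "(f' has_derivative (\<lambda>v. D y \<bullet> v)) (at y)" "(g' has_derivative (\<lambda>v. E y \<bullet> v)) (at y)"
      using y C2 C2' by (auto simp: C2_extension_def)
    from has_derivative_add[OF has_derivative_mult_right[OF this(1), of c] this(2)]
    show "((\<lambda>x. c * f' x + g' x) has_derivative (\<lambda>v. (c *\<^sub>R D y + E y) \<bullet> v)) (at y)"
      by (simp add: inner_add_left)
    show "((\<lambda>x. c *\<^sub>R D x + E x) has_derivative (\<lambda>v. c *\<^sub>R K y v + L y v)) (at y)"
      using y C2 C2' by (auto simp: C2_extension_def intro!: has_derivative_add has_derivative_scaleR_right)
  next
    show "continuous_on (U \<inter> V) (\<lambda>y. c *\<^sub>R K y v + L y v)" for v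
      using C2 C2' unfolding C2_extension_def by (intro continuous_intros) (auto intro: continuous_on_subset)
    show "c * f' y + g' y = c * f y + g y" if "y \<in> U \<inter> V \<inter> S3" for y
      using that C2 C2' by (auto simp: C2_extension_def)
  qed
  from S3_laplacian_eq[OF this, of x] S3_laplacian_eq[OF C2, of x] S3_laplacian_eq[OF C2', of x]
  show ?thesis using U V x
    by (simp add: inner_add_left sum.distrib distrib_left right_diff_distrib flip: sum_distrib_left)
qed

lemma S3_laplacian_sum:
  assumes "finite I" "\<And>i. i \<in> I \<Longrightarrow> real_polynomial_function (h i)" "x \<in> S3"
  shows "S3_laplacian (\<lambda>x. \<Sum>i\<in>I. c i * h i x) x = (\<Sum>i\<in>I. c i * S3_laplacian (h i) x)"
  using assms(1,2)
proof (induction I rule: finite_induct)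
  case empty
  have "smooth_on_S3 (\<lambda>x. 0)" by (intro smooth_on_S3_polynomial real_polynomial_function.intros(2))
  \<comment> \<open>With factor -1 and both functions zero, the right-hand side cancels to
    0.\<close>
  from S3_laplacian_add_scale[OF this this assms(3), of "-1"] show ?case by simp
next
  case (insert i I)
  have "smooth_on_S3 (h i)" "smooth_on_S3 (\<lambda>x. \<Sum>i\<in>I. c i * h i x)"
    using insert by (auto intro!: smooth_on_S3_polynomial real_polynomial_function_sum real_polynomial_function.intros(2,4))
  then show ?case using insert S3_laplacian_add_scale[OF _ _ assms(3), of "h i" "\<lambda>x. \<Sum>i\<in>I. c i * h i x" "c i"] by simp
qed

section \<open>Surjectivity of the coordinates and separation of variables\<close>

lemma toroidal_surj:
  assumes "x \<in> S3"
  obtains chi \<theta> \<phi> where "chi \<in> {0..pi/2}" "\<theta> \<in> {0..2*pi}" "\<phi> \<in> {0..2*pi}" "x = toroidal chi \<theta> \<phi>"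
proof -
  have polar: "\<exists>t\<in>{0..2*pi}. a = sqrt (a\<^sup>2 + b\<^sup>2) * cos t \<and> b = sqrt (a\<^sup>2 + b\<^sup>2) * sin t" for a b :: real
  proof (cases "a\<^sup>2 + b\<^sup>2 = 0")
    case True
    then have "a = 0" "b = 0" by (simp_all add: sum_power2_eq_zero_iff)
    then show ?thesis by (intro bexI[of _ 0]) auto
  next
    case False
    define r where "r = sqrt (a\<^sup>2 + b\<^sup>2)"
    have r: "r\<^sup>2 = a\<^sup>2 + b\<^sup>2" "r \<noteq> 0" using False by (simp_all add: r_def)
    then have "(a / r)\<^sup>2 + (b / r)\<^sup>2 = 1" using False by (simp add: power_divide flip: add_divide_distrib)
    then obtain t where "0 \<le> t" "t < 2 * pi" "a / r = cos t" "b / r = sin t"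
      using sincos_total_2pi by metis
    then show ?thesis unfolding r_def[symmetric] using r by (intro bexI[of _ t]) (auto simp: field_simps)
  qed
  obtain \<theta> where \<theta>: "\<theta> \<in> {0..2*pi}" "x$1 = sqrt ((x$1)\<^sup>2 + (x$2)\<^sup>2) * cos \<theta>" "x$2 = sqrt ((x$1)\<^sup>2 + (x$2)\<^sup>2) * sin \<theta>"
    using polar by blast
  obtain \<phi> where \<phi>: "\<phi> \<in> {0..2*pi}" "x$3 = sqrt ((x$3)\<^sup>2 + (x$4)\<^sup>2) * cos \<phi>" "x$4 = sqrt ((x$3)\<^sup>2 + (x$4)\<^sup>2) * sin \<phi>"
    using polar by blast
  have "x \<bullet> x = 1" using assms by (simp add: norm_eq_1)
  then have "(x$1)\<^sup>2 + (x$2)\<^sup>2 + ((x$3)\<^sup>2 + (x$4)\<^sup>2) = 1"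
    by (simp add: inner_vec_def sum_4 power2_eq_square)
  then have "(sqrt ((x$1)\<^sup>2 + (x$2)\<^sup>2))\<^sup>2 + (sqrt ((x$3)\<^sup>2 + (x$4)\<^sup>2))\<^sup>2 = 1" by simp
  then obtain chi where chi: "0 \<le> chi" "chi \<le> pi / 2" "sqrt ((x$1)\<^sup>2 + (x$2)\<^sup>2) = cos chi" "sqrt ((x$3)\<^sup>2 + (x$4)\<^sup>2) = sin chi"
    using sincos_total_pi_half by (metis real_sqrt_ge_0_iff sum_power2_ge_zero)
  have "x = toroidal chi \<theta> \<phi>"
    using \<theta>(2,3)[unfolded chi(3)] \<phi>(2,3)[unfolded chi(4)]
    by (intro vec4_eqI) (simp_all only: toroidal_components)
  then show ?thesis using that[of chi \<theta> \<phi>] \<theta>(1) \<phi>(1) chi by simp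
qed

text \<open>With R = y Q, where y = cos^b sin^a, every derivative keeps the factor y, and the
  singular terms enter through its logarithmic derivative \<open>q\<close>. The coefficient of Q
  itself turns out constant, and the terms with derivatives of Q are, in t = cos^2 x, 4 times those
  of the hypergeometric equation. \<open>R1\<close> is a function because it is differentiated
  again; \<open>R2\<close> is a value at one point.\<close>

lemma radial_derivatives:
  fixes a b d :: nat
  defines "Q \<equiv> Jpoly a b d"
  defines "R \<equiv> \<lambda>x::real. cos x ^ b * sin x ^ a * poly Q ((cos x)\<^sup>2)"
  assumes nz: "cos x \<noteq> 0" "sin x \<noteq> 0"
  obtains R1 :: "real \<Rightarrow> real" and R2 :: real
  where "\<And>x. cos x \<noteq> 0 \<Longrightarrow> sin x \<noteq> 0 \<Longrightarrow> (R has_real_derivative R1 x) (at x)" "(R1 has_real_derivative R2) (at x)"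
    "R2 + ((cos x)\<^sup>2 - (sin x)\<^sup>2) / (cos x * sin x) * R1 x - (real b)\<^sup>2 * R x / (cos x)\<^sup>2 - (real a)\<^sup>2 * R x / (sin x)\<^sup>2
      = - (real (a + b + 2 * d) * (real (a + b + 2 * d) + 2)) * R x"
proof -
  define y where "y x = cos x ^ b * sin x ^ a" for x :: real
  define q where "q x = real a * cos x / sin x - real b * sin x / cos x" for x :: real
  define Q0 where "Q0 x = poly Q ((cos x)\<^sup>2)" for x :: real
  define Q1 where "Q1 x = poly (pderiv Q) ((cos x)\<^sup>2)" for x :: real
  define Q2 where "Q2 x = poly (pderiv (pderiv Q)) ((cos x)\<^sup>2)" for x :: real
  define G where "G x = q x * Q0 x - 2 * (cos x * sin x) * Q1 x" for x
  define G' where "G' x = (- real a / (sin x)\<^sup>2 - real b / (cos x)\<^sup>2) * Q0 x - 2 * (cos x * sin x) * q x * Q1 x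
     - 2 * ((cos x)\<^sup>2 - (sin x)\<^sup>2) * Q1 x + 4 * (cos x)\<^sup>2 * (sin x)\<^sup>2 * Q2 x" for x
  \<comment> \<open>Division by \<open>c\<close> replaces the truncated exponent; for
    \<open>n = 0\<close> both sides are 0.\<close>
  have pw: "real n * c ^ (n - Suc 0) = real n * c ^ n / c" if "c \<noteq> 0" for c :: real and n
    using that by (cases n) auto
  have dy: "(y has_real_derivative y x * q x) (at x)" if nz: "cos x \<noteq> 0" "sin x \<noteq> 0" for x
  proof -
    have "(y has_real_derivative (real b * cos x ^ (b - Suc 0)) * - sin x * sin x ^ a + (real a * sin x ^ (a - Suc 0)) * cos x * cos x ^ b) (at x)"
      unfolding y_def[abs_def] by (auto intro!: derivative_eq_intros)
    moreover have "(real b * cos x ^ (b - Suc 0)) * - sin x * sin x ^ a + (real a * sin x ^ (a - Suc 0)) * cos x * cos x ^ b = y x * q x"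
      unfolding pw[OF nz(1)] pw[OF nz(2)] y_def q_def by (simp add: algebra_simps)
    ultimately show ?thesis by simp
  qed
  have dpoly: "((\<lambda>x. poly P ((cos x)\<^sup>2)) has_real_derivative - 2 * (cos x * sin x) * poly (pderiv P) ((cos x)\<^sup>2)) (at x)" for P and x :: real
    by (rule DERIV_cong, rule DERIV_chain'[OF _ poly_DERIV]) (auto intro!: derivative_eq_intros)
  have dR: "(R has_real_derivative y x * G x) (at x)" if "cos x \<noteq> 0" "sin x \<noteq> 0" for x
  proof -
    have "R = (\<lambda>x. y x * Q0 x)" by (simp add: R_def y_def Q0_def)
    moreover have "((\<lambda>x. y x * Q0 x) has_real_derivative y x * q x * Q0 x + (- 2 * (cos x * sin x) * Q1 x) * y x) (at x)"
      unfolding Q0_def Q1_def by (intro DERIV_mult dy dpoly that)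
    ultimately show ?thesis by (simp add: G_def algebra_simps)
  qed
  have dq: "(q has_real_derivative (- real a / (sin x)\<^sup>2 - real b / (cos x)\<^sup>2)) (at x)"
  proof -
    have "(q has_real_derivative ((real a * - sin x) * sin x - (real a * cos x) * cos x) / (sin x * sin x)
       - ((real b * cos x) * cos x - (real b * sin x) * - sin x) / (cos x * cos x)) (at x)"
      unfolding q_def[abs_def] using nz by (auto intro!: derivative_eq_intros simp: mult_ac)
    moreover have "(A * - s) * s - (A * c) * c = - A * (s\<^sup>2 + c\<^sup>2)" "(A * c) * c - (A * s) * - s = A * (s\<^sup>2 + c\<^sup>2)" for A c s :: real
      unfolding power2_eq_square by (simp_all add: algebra_simps)
    ultimately show ?thesis by (simp only: sin_cos_squared_add power2_eq_square[symmetric] mult_1_right)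
  qed
  have dG: "(G has_real_derivative G' x) (at x)"
  proof -
    have dcs: "((\<lambda>x. 2 * (cos x * sin x)) has_real_derivative 2 * ((cos x)\<^sup>2 - (sin x)\<^sup>2)) (at x)"
      by (auto intro!: derivative_eq_intros simp: power2_eq_square)
    have "(G has_real_derivative (- real a / (sin x)\<^sup>2 - real b / (cos x)\<^sup>2) * Q0 x + (- 2 * (cos x * sin x) * Q1 x) * q x
       - (2 * ((cos x)\<^sup>2 - (sin x)\<^sup>2) * Q1 x + (- 2 * (cos x * sin x) * Q2 x) * (2 * (cos x * sin x)))) (at x)"
      unfolding G_def[abs_def] Q0_def Q1_def Q2_def by (intro DERIV_diff DERIV_mult dq dcs dpoly)
    then show ?thesis by (rule DERIV_cong) (simp add: G'_def power2_eq_square algebra_simps)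
  qed
  have dR1: "((\<lambda>x. y x * G x) has_real_derivative y x * (q x * G x + G' x)) (at x)"
    by (rule DERIV_cong[OF DERIV_mult[OF dy[OF nz] dG]]) (simp add: algebra_simps)
  define c where "c = cos x"
  define s where "s = sin x"
  have cs: "s\<^sup>2 = 1 - c\<^sup>2" and nz': "c \<noteq> 0" "s \<noteq> 0"
    using nz by (simp_all add: c_def s_def sin_squared_eq)
  have cs1: "c\<^sup>2 + s\<^sup>2 = 1" using cs by simp
  have q: "q x = real a * c / s - real b * s / c" by (simp add: q_def c_def s_def)
  \<comment> \<open>The Riccati equation for \<open>q\<close>: it says that y alone solves the
    radial equation with d = 0 and wave number a + b.\<close>
  have qq: "q x * q x + ((c\<^sup>2 - s\<^sup>2) / (c * s)) * q x + (- real a / s\<^sup>2 - real b / c\<^sup>2) - (real b)\<^sup>2 / c\<^sup>2 - (real a)\<^sup>2 / s\<^sup>2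
     = - (real a + real b)\<^sup>2 - 2 * (real a + real b)"
  proof -
    have r: "1 / c\<^sup>2 = 1 + s\<^sup>2 / c\<^sup>2" "1 / s\<^sup>2 = 1 + c\<^sup>2 / s\<^sup>2"
      using nz' cs1 by (simp_all add: divide_simps add.commute)
    have "q x * q x = (real a)\<^sup>2 * (c\<^sup>2 / s\<^sup>2) + (real b)\<^sup>2 * (s\<^sup>2 / c\<^sup>2) - 2 * real a * real b"
      unfolding q using nz' by (simp add: field_simps power2_eq_square)
    moreover have "((c\<^sup>2 - s\<^sup>2) / (c * s)) * q x = real a * (c\<^sup>2 / s\<^sup>2) - real b - real a + real b * (s\<^sup>2 / c\<^sup>2)"
      unfolding q using nz' by (simp add: field_simps power2_eq_square)
    moreover have "- real a / s\<^sup>2 - real b / c\<^sup>2 = - real a * (1 / s\<^sup>2) - real b * (1 / c\<^sup>2)" by simp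
    moreover have "(real b)\<^sup>2 / c\<^sup>2 = (real b)\<^sup>2 * (1 / c\<^sup>2)" "(real a)\<^sup>2 / s\<^sup>2 = (real a)\<^sup>2 * (1 / s\<^sup>2)" by simp_all
    ultimately show ?thesis unfolding r by (simp add: power2_eq_square algebra_simps)
  qed
  have csq: "c * s * q x = real a * c\<^sup>2 - real b * s\<^sup>2"
    unfolding q using nz' by (simp add: field_simps power2_eq_square)
  have ode: "c\<^sup>2 * (1 - c\<^sup>2) * Q2 x + (real b + 1 - (real a + real b + 2) * c\<^sup>2) * Q1 x
      + real d * (real d + real a + real b + 1) * Q0 x = 0"
    using Jpoly_ode[of "c\<^sup>2" a b d] by (simp add: Q0_def Q1_def Q2_def Q_def c_def)
  have cancel: "((c\<^sup>2 - s\<^sup>2) / (c * s)) * (2 * (c * s) * Q1 x) = 2 * (c\<^sup>2 - s\<^sup>2) * Q1 x"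
    using nz' by simp
  have "q x * G x + G' x + ((c\<^sup>2 - s\<^sup>2) / (c * s)) * G x - (real b)\<^sup>2 * Q0 x / c\<^sup>2 - (real a)\<^sup>2 * Q0 x / s\<^sup>2
     = (q x * q x + ((c\<^sup>2 - s\<^sup>2) / (c * s)) * q x + (- real a / s\<^sup>2 - real b / c\<^sup>2) - (real b)\<^sup>2 / c\<^sup>2 - (real a)\<^sup>2 / s\<^sup>2) * Q0 x
      - 4 * (c * s * q x) * Q1 x - 2 * (c\<^sup>2 - s\<^sup>2) * Q1 x - ((c\<^sup>2 - s\<^sup>2) / (c * s)) * (2 * (c * s) * Q1 x) + 4 * c\<^sup>2 * s\<^sup>2 * Q2 x"
    unfolding G_def G'_def c_def[symmetric] s_def[symmetric] by (simp add: left_diff_distrib right_diff_distrib distrib_left distrib_right)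
  also have "\<dots> = (- (real a + real b)\<^sup>2 - 2 * (real a + real b)) * Q0 x
      + 4 * ((real b + 1 - (real a + real b + 2) * c\<^sup>2) * Q1 x + c\<^sup>2 * (1 - c\<^sup>2) * Q2 x)"
    unfolding qq csq cancel unfolding cs by (simp add: algebra_simps)
  also have "\<dots> = (- (real a + real b)\<^sup>2 - 2 * (real a + real b)) * Q0 x - 4 * (real d * (real d + real a + real b + 1) * Q0 x)"
    using ode by algebra
  \<comment> \<open>For k = a + b + 2 d, the sum of (a + b) (a + b + 2) and 4 d (d + a + b + 1) is k
    (k + 2).\<close>
  also have "\<dots> = - (real (a + b + 2 * d) * (real (a + b + 2 * d) + 2)) * Q0 x"
    by (simp add: power2_eq_square algebra_simps)
  finally have key: "q x * G x + G' x + ((c\<^sup>2 - s\<^sup>2) / (c * s)) * G x - (real b)\<^sup>2 * Q0 x / c\<^sup>2 - (real a)\<^sup>2 * Q0 x / s\<^sup>2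
     = - (real (a + b + 2 * d) * (real (a + b + 2 * d) + 2)) * Q0 x" .
  have Rx: "R x = y x * Q0 x" by (simp add: R_def y_def Q0_def)
  have "y x * (q x * G x + G' x) + (c\<^sup>2 - s\<^sup>2) / (c * s) * (y x * G x) - (real b)\<^sup>2 * R x / c\<^sup>2 - (real a)\<^sup>2 * R x / s\<^sup>2
      = y x * (q x * G x + G' x + ((c\<^sup>2 - s\<^sup>2) / (c * s)) * G x - (real b)\<^sup>2 * Q0 x / c\<^sup>2 - (real a)\<^sup>2 * Q0 x / s\<^sup>2)"
    unfolding Rx by (simp only: distrib_left right_diff_distrib times_divide_eq_right mult_ac)
  also have "\<dots> = - (real (a + b + 2 * d) * (real (a + b + 2 * d) + 2)) * R x"
    unfolding key Rx by (simp only: mult_ac)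
  finally show thesis
    using that[of "\<lambda>x. y x * G x" "y x * (q x * G x + G' x)"] dR dR1 unfolding c_def s_def by blast
qed

lemma torus_mode_eigenfunction:
  fixes l m :: int and \<delta> :: real and d :: nat
  defines "a \<equiv> nat \<bar>m\<bar>" and "b \<equiv> nat \<bar>l\<bar>"
  defines "E \<equiv> torus_mode l m \<delta> (Jpoly a b d)"
  assumes X: "X \<in> S3"
  shows "S3_laplacian E X = - (real (a + b + 2 * d) * (real (a + b + 2 * d) + 2)) * E X"
proof -
  let ?k = "real (a + b + 2 * d) * (real (a + b + 2 * d) + 2)"
  have smooth: "smooth_on_S3 E"
    unfolding E_def by (intro smooth_on_S3_polynomial real_polynomial_function_torus_mode)
  define R where "R x = cos x ^ b * sin x ^ a * poly (Jpoly a b d) ((cos x)\<^sup>2)" for x :: real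
  let ?C = "\<lambda>y z. cos (of_int l * y + of_int m * z + \<delta>)"
  let ?S = "\<lambda>y z. sin (of_int l * y + of_int m * z + \<delta>)"
  have E: "E (toroidal x y z) = R x * ?C y z" for x y z
    unfolding E_def torus_mode_toroidal by (simp add: R_def a_def b_def)
  obtain F1 F11 F2 F22 F3 F33 where P: "has_toroidal_partials E F1 F11 F2 F22 F3 F33"
    using toroidal_partial_derivatives[OF smooth] by blast
  have F1: "((\<lambda>t. E (toroidal t y z)) has_real_derivative F1 x y z) (at x)"
    and F11: "((\<lambda>t. F1 t y z) has_real_derivative F11 x y z) (at x)"
    and F2: "((\<lambda>t. E (toroidal x t z)) has_real_derivative F2 x y z) (at y)"
    and F22: "((\<lambda>t. F2 x t z) has_real_derivative F22 x y z) (at y)"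
    and F3: "((\<lambda>t. E (toroidal x y t)) has_real_derivative F3 x y z) (at z)"
    and F33: "((\<lambda>t. F3 x y t) has_real_derivative F33 x y z) (at z)"
    and lap: "cos x \<noteq> 0 \<Longrightarrow> sin x \<noteq> 0 \<Longrightarrow> S3_laplacian E (toroidal x y z) =
        F11 x y z + ((cos x)\<^sup>2 - (sin x)\<^sup>2) / (cos x * sin x) * F1 x y z + F22 x y z / (cos x)\<^sup>2 + F33 x y z / (sin x)\<^sup>2" for x y z
    using P unfolding has_toroidal_partials_def by blast+
  have f2: "F2 x y z = - of_int l * R x * ?S y z" for x y z
    by (rule DERIV_unique[OF F2]) (auto simp: E intro!: derivative_eq_intros)
  have "F22 x y z = - (of_int l * of_int l) * R x * ?C y z" for x y z
    by (rule DERIV_unique[OF F22]) (auto simp: f2 intro!: derivative_eq_intros)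
  then have f22: "F22 x y z = - ((real b)\<^sup>2 * R x * ?C y z)" for x y z
    by (simp add: b_def power2_eq_square flip: abs_mult)
  have f3: "F3 x y z = - of_int m * R x * ?S y z" for x y z
    by (rule DERIV_unique[OF F3]) (auto simp: E intro!: derivative_eq_intros)
  have "F33 x y z = - (of_int m * of_int m) * R x * ?C y z" for x y z
    by (rule DERIV_unique[OF F33]) (auto simp: f3 intro!: derivative_eq_intros)
  then have f33: "F33 x y z = - ((real a)\<^sup>2 * R x * ?C y z)" for x y z
    by (simp add: a_def power2_eq_square flip: abs_mult)
  have interior: "S3_laplacian E (toroidal x y z) = - ?k * E (toroidal x y z)"
    if nz: "cos x \<noteq> 0" "sin x \<noteq> 0" for x y z
  proof -
    from radial_derivatives[OF nz, of b a d]
    obtain R1 R2 where R1: "\<And>x. cos x \<noteq> 0 \<Longrightarrow> sin x \<noteq> 0 \<Longrightarrow> (R has_real_derivative R1 x) (at x)"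
      and R2: "(R1 has_real_derivative R2) (at x)"
      and ode: "R2 + ((cos x)\<^sup>2 - (sin x)\<^sup>2) / (cos x * sin x) * R1 x - (real b)\<^sup>2 * R x / (cos x)\<^sup>2 - (real a)\<^sup>2 * R x / (sin x)\<^sup>2
      = - ?k * R x"
      unfolding R_def[symmetric] by blast
    have f1: "F1 t y z = R1 t * ?C y z" if "cos t \<noteq> 0" "sin t \<noteq> 0" for t
      using DERIV_cmult_right[OF R1[OF that], of "?C y z"] F1[of y z t] unfolding E by (rule DERIV_unique[rotated])
    \<comment> \<open>The formula for \<open>F1\<close> is known only off the zeros of cosine and
      sine. These points form an open set, so it may still be differentiated at
      \<open>x\<close>.\<close>
    define N where "N = {t::real. cos t \<noteq> 0 \<and> sin t \<noteq> 0}"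
    have "open N" unfolding N_def by (intro open_Collect_conj open_Collect_neq continuous_intros)
    then have "\<forall>\<^sub>F t in nhds x. t \<in> N" using nz by (intro eventually_nhds_in_open) (auto simp: N_def)
    then have "\<forall>\<^sub>F t in nhds x. F1 t y z = R1 t * ?C y z"
      by eventually_elim (auto simp: N_def f1)
    then have "((\<lambda>t. R1 t * ?C y z) has_real_derivative F11 x y z) (at x)"
      using F11[of y z x] by (simp add: DERIV_cong_ev[OF refl _ refl])
    then have f11: "F11 x y z = R2 * ?C y z"
      using DERIV_unique DERIV_cmult_right[OF R2] by blast
    have "S3_laplacian E (toroidal x y z) = (R2 + ((cos x)\<^sup>2 - (sin x)\<^sup>2) / (cos x * sin x) * R1 x - (real b)\<^sup>2 * R x / (cos x)\<^sup>2 - (real a)\<^sup>2 * R x / (sin x)\<^sup>2) * ?C y z"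
      unfolding lap[OF nz] f11 f1[OF nz] f22 f33 by (simp add: left_diff_distrib distrib_right)
    also have "\<dots> = - ?k * E (toroidal x y z)" unfolding ode E by simp
    finally show ?thesis .
  qed
  obtain x y z where x: "x \<in> {0..pi/2}" and XT: "X = toroidal x y z"
    using toroidal_surj[OF X] by metis
  \<comment> \<open>For fixed angles both sides are continuous in chi, so the equation extends from
    the open interval to its ends.\<close>
  have "continuous_on UNIV (\<lambda>t. S3_laplacian E (toroidal t y z) + ?k * E (toroidal t y z))"
    by (intro continuous_intros continuous_on_compose2[OF continuous_on_S3_laplacian[OF smooth]]
        continuous_on_compose2[OF smooth_on_S3_continuous[OF smooth]]) auto
  then have "continuous_on (closure {0<..<pi/2}) (\<lambda>t. S3_laplacian E (toroidal t y z) + ?k * E (toroidal t y z))"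
    by (rule continuous_on_subset) auto
  moreover have "S3_laplacian E (toroidal t y z) + ?k * E (toroidal t y z) = 0" if "t \<in> {0<..<pi/2}" for t
  proof -
    have "cos t > 0" "sin t > 0" using that by (auto intro!: cos_gt_zero_pi sin_gt_zero)
    then show ?thesis using interior[of t y z] by simp
  qed
  moreover have "x \<in> closure {0<..<pi/2}" using x by simp
  ultimately have "S3_laplacian E (toroidal x y z) + ?k * E (toroidal x y z) = 0"
    by (rule continuous_constant_on_closure)
  then show ?thesis unfolding XT by simp
qed

section \<open>Integration and symmetry of the Laplacian\<close>

definition toroidal_box :: "(real \<times> real \<times> real) set" where
  "toroidal_box = cbox (0, 0, 0) (pi / 2, 2 * pi, 2 * pi)"

definition toroidal_integrand :: "(real^4 \<Rightarrow> real) \<Rightarrow> real \<times> real \<times> real \<Rightarrow> real" where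
  "toroidal_integrand h = (\<lambda>(x, y, z). h (toroidal x y z) * (cos x * sin x))"

lemma continuous_on_toroidal_integrand:
  assumes "continuous_on S3 h"
  shows "continuous_on S (toroidal_integrand h)"
  unfolding toroidal_integrand_def case_prod_unfold
  by (intro continuous_intros continuous_on_compose2[OF assms]) auto

lemma toroidal_integrand_integrable:
  "continuous_on S3 h \<Longrightarrow> toroidal_integrand h integrable_on toroidal_box"
  unfolding toroidal_box_def by (intro integrable_continuous continuous_on_toroidal_integrand)

text \<open>On the coordinate range cosine and sine are nonnegative, so the density loses its
  absolute value; continuity makes the Lebesgue and the gauge integral agree.\<close>

lemma S3_integral_eq:
  assumes h: "continuous_on S3 h"
  shows "S3_integral h = integral toroidal_box (toroidal_integrand h)"
proof -
  have box: "{0..pi/2} \<times> {0..2*pi} \<times> {0..2*pi} = toroidal_box"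
    by (simp add: toroidal_box_def cbox_Pair_eq)
  have "S3_integral h = set_lebesgue_integral lborel toroidal_box (toroidal_integrand h)"
    unfolding S3_integral_def box
  proof (intro set_lebesgue_integral_cong ballI allI impI)
    show "toroidal_box \<in> sets lborel" by (simp add: toroidal_box_def)
    fix p :: "real \<times> real \<times> real" assume p: "p \<in> toroidal_box"
    obtain x y z where xyz: "p = (x, y, z)" by (metis prod.collapse)
    have "0 \<le> x" "x \<le> pi / 2" using p by (auto simp: xyz toroidal_box_def cbox_Pair_eq)
    then have "0 \<le> cos x" "0 \<le> sin x" by (auto intro!: cos_ge_zero sin_ge_zero)
    then show "(case p of (x, y, z) \<Rightarrow> h (toroidal x y z) * toroidal_density x y z) = toroidal_integrand h p"
      by (simp add: xyz toroidal_integrand_def toroidal_density_eq)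
  qed
  also have "\<dots> = integral toroidal_box (toroidal_integrand h)"
  proof (rule set_borel_integral_eq_integral(2))
    show "set_integrable lborel toroidal_box (toroidal_integrand h)"
      unfolding set_integrable_def toroidal_box_def
      by (intro borel_integrable_compact continuous_on_toroidal_integrand h compact_cbox)
  qed
  finally show ?thesis .
qed

lemma S3_integral_cong:
  assumes "\<And>x. x \<in> S3 \<Longrightarrow> f x = g x"
  shows "S3_integral f = S3_integral g"
  unfolding S3_integral_def using assms by simp

lemma S3_integral_add:
  assumes "continuous_on S3 f" "continuous_on S3 g"
  shows "S3_integral (\<lambda>x. f x + g x) = S3_integral f + S3_integral g"
proof -
  have "toroidal_integrand (\<lambda>x. f x + g x) = (\<lambda>p. toroidal_integrand f p + toroidal_integrand g p)"
    by (auto simp: toroidal_integrand_def distrib_right)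
  then show ?thesis
    using assms by (simp add: S3_integral_eq continuous_on_add integral_add toroidal_integrand_integrable)
qed

lemma S3_integral_cmult:
  assumes "continuous_on S3 f"
  shows "S3_integral (\<lambda>x. c * f x) = c * S3_integral f"
proof -
  have "toroidal_integrand (\<lambda>x. c * f x) = (\<lambda>p. c * toroidal_integrand f p)"
    by (auto simp: toroidal_integrand_def)
  then show ?thesis
    using assms by (simp add: S3_integral_eq continuous_on_mult_left)
qed

lemma S3_integral_sum:
  assumes "finite I" "\<And>i. i \<in> I \<Longrightarrow> continuous_on S3 (h i)"
  shows "S3_integral (\<lambda>x. \<Sum>i\<in>I. c i * h i x) = (\<Sum>i\<in>I. c i * S3_integral (h i))"
  using assms
proof (induction I rule: finite_induct)
  case empty
  show ?case using S3_integral_cmult[of "\<lambda>x. 0" 0] by simp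
next
  case (insert i I)
  then show ?case
    using S3_integral_add[of "\<lambda>x. c i * h i x" "\<lambda>x. \<Sum>i\<in>I. c i * h i x"]
    by (simp add: S3_integral_cmult continuous_on_sum continuous_on_mult_left)
qed

lemma S3_integral_bound:
  assumes "continuous_on S3 h" "\<And>x. x \<in> S3 \<Longrightarrow> \<bar>h x\<bar> \<le> M"
  shows "\<bar>S3_integral h\<bar> \<le> M * measure lborel toroidal_box"
proof -
  have M: "0 \<le> M" using assms(2)[OF toroidal_in_S3[of 0 0 0]] by linarith
  have "norm (integral toroidal_box (toroidal_integrand h)) \<le> M * measure lborel toroidal_box"
    unfolding toroidal_box_def
  proof (rule integrable_bound[OF M])
    show "toroidal_integrand h integrable_on cbox (0, 0, 0) (pi / 2, 2 * pi, 2 * pi)"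
      using toroidal_integrand_integrable[OF assms(1)] by (simp add: toroidal_box_def)
    fix p :: "real \<times> real \<times> real"
    obtain x y z where xyz: "p = (x, y, z)" by (metis prod.collapse)
    have "\<bar>h (toroidal x y z)\<bar> * \<bar>cos x * sin x\<bar> \<le> M * 1"
    proof (intro mult_mono)
      show "\<bar>cos x * sin x\<bar> \<le> 1"
        using mult_mono[of "\<bar>cos x\<bar>" 1 "\<bar>sin x\<bar>" 1] by (simp add: abs_mult)
    qed (use assms(2)[OF toroidal_in_S3] M in auto)
    then show "norm (toroidal_integrand h p) \<le> M"
      by (simp add: xyz toroidal_integrand_def abs_mult)
  qed
  then show ?thesis by (simp add: S3_integral_eq[OF assms(1)])
qed

text \<open>The density vanishes at chi = 0 and chi = pi / 2, so the zero integral forces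
  \<open>h\<close> to vanish only for interior chi; continuity along chi adds the ends.\<close>

lemma S3_integral_square_eq_0:
  assumes h: "continuous_on S3 h" and 0: "S3_integral (\<lambda>x. h x * h x) = 0" and X: "X \<in> S3"
  shows "h X = 0"
proof -
  let ?F = "toroidal_integrand (\<lambda>x. h x * h x)"
  have hh: "continuous_on S3 (\<lambda>x. h x * h x)" by (intro continuous_intros h)
  have "(?F has_integral 0) (cbox (0, 0, 0) (pi / 2, 2 * pi, 2 * pi))"
    using toroidal_integrand_integrable[OF hh] 0 unfolding S3_integral_eq[OF hh] toroidal_box_def
    by (metis integrable_integral)
  moreover have "0 \<le> ?F p" if p: "p \<in> box (0, 0, 0) (pi / 2, 2 * pi, 2 * pi)" for p
  proof -
    obtain x y z where xyz: "p = (x, y, z)" by (metis prod.collapse)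
    have "0 \<le> x" "x \<le> pi / 2" using subsetD[OF box_subset_cbox p] by (auto simp: xyz cbox_Pair_eq)
    then have "0 \<le> cos x" "0 \<le> sin x" by (auto intro!: cos_ge_zero sin_ge_zero)
    then show ?thesis by (simp add: xyz toroidal_integrand_def)
  qed
  moreover have "box (0, 0, 0) (pi / 2, 2 * pi, 2 * pi) \<noteq> ({} :: (real \<times> real \<times> real) set)"
    unfolding box_ne_empty by (auto simp: Basis_prod_def)
  ultimately have F0: "?F p = 0" if "p \<in> cbox (0, 0, 0) (pi / 2, 2 * pi, 2 * pi)" for p
    using that by (intro has_integral_0_cbox_imp_0[where f = ?F]) (auto intro: continuous_on_toroidal_integrand[OF hh])
  obtain x y z where x: "x \<in> {0..pi/2}" "y \<in> {0..2*pi}" "z \<in> {0..2*pi}" and XT: "X = toroidal x y z"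
    using toroidal_surj[OF X] .
  have "continuous_on UNIV (\<lambda>t. h (toroidal t y z))"
    by (intro continuous_intros continuous_on_compose2[OF h]) auto
  then have "continuous_on (closure {0<..<pi/2}) (\<lambda>t. h (toroidal t y z))"
    by (rule continuous_on_subset) auto
  moreover have "h (toroidal t y z) = 0" if t: "t \<in> {0<..<pi/2}" for t
  proof -
    have "cos t > 0" "sin t > 0" using t by (auto intro!: cos_gt_zero_pi sin_gt_zero)
    moreover have "?F (t, y, z) = 0" using t x by (intro F0) (auto simp: cbox_Pair_eq)
    ultimately show ?thesis by (simp add: toroidal_integrand_def)
  qed
  moreover have "x \<in> closure {0<..<pi/2}" using x by simp
  ultimately have "h (toroidal x y z) = 0"
    by (rule continuous_constant_on_closure)
  then show ?thesis by (simp add: XT)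
qed

section \<open>Iterated integrals and Green's identity\<close>

abbreviation angle_box :: "(real \<times> real) set" where
  "angle_box \<equiv> cbox (0, 0) (2 * pi, 2 * pi)"

lemma integral_angle_dz:
  assumes G: "continuous_on angle_box (\<lambda>(y, z). G y z)"
    and P: "\<And>y z. (P y has_real_derivative G y z) (at z)" and per: "\<And>y. P y (2 * pi) = P y 0"
  shows "integral angle_box (\<lambda>(y, z). G y z) = 0"
proof -
  have "integral (cbox 0 (2 * pi)) (G y) = 0" for y
  proof -
    have "(G y has_integral P y (2 * pi) - P y 0) {0..2 * pi}"
      by (rule fundamental_theorem_of_calculus)
         (use P in \<open>auto simp: has_real_derivative_iff_has_vector_derivative[symmetric] intro: has_field_derivative_at_within\<close>)
    then show ?thesis by (simp add: per integral_unique)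
  qed
  then show ?thesis using integral_prod_continuous[OF G] by simp
qed

lemma integral_angle_dy:
  assumes G: "continuous_on angle_box (\<lambda>(y, z). G y z)"
    and P: "\<And>y z. ((\<lambda>y. P y z) has_real_derivative G y z) (at y)" and per: "\<And>z. P (2 * pi) z = P 0 z"
  shows "integral angle_box (\<lambda>(y, z). G y z) = 0"
proof -
  have "integral (cbox 0 (2 * pi)) (\<lambda>y. G y z) = 0" for z
  proof -
    have "((\<lambda>y. G y z) has_integral P (2 * pi) z - P 0 z) {0..2 * pi}"
      by (rule fundamental_theorem_of_calculus)
         (use P in \<open>auto simp: has_real_derivative_iff_has_vector_derivative[symmetric] intro: has_field_derivative_at_within\<close>)
    then show ?thesis by (simp add: per integral_unique)
  qed
  then show ?thesis using integral_prod_continuous[OF G] integral_swap_continuous[OF G] by simp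
qed

lemma S3_integral_iterated:
  assumes h: "continuous_on S3 h"
  shows "S3_integral h = integral (cbox 0 (pi / 2)) (\<lambda>x. integral angle_box (\<lambda>(y, z). h (toroidal x y z) * (cos x * sin x)))"
  unfolding S3_integral_eq[OF h] toroidal_box_def
  by (subst integral_prod_continuous[OF continuous_on_toroidal_integrand[OF h]])
     (simp add: toroidal_integrand_def case_prod_unfold)

lemma toroidal_periodic:
  "toroidal x (y + 2 * pi) z = toroidal x y z" "toroidal x y (z + 2 * pi) = toroidal x y z"
  by (simp_all add: toroidal_def)

lemma periodic_derivative:
  fixes f :: "real \<Rightarrow> real"
  assumes "\<And>t. f (t + p) = f t" "(f has_real_derivative a) (at t)" "(f has_real_derivative b) (at (t + p))"
  shows "b = a"
proof -
  have "((\<lambda>x. f (x + p)) has_real_derivative b) (at t)"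
    using assms(3) by (simp add: DERIV_shift)
  then show ?thesis using assms(1,2) DERIV_unique by auto
qed

text \<open>\<open>A\<close> is the chi-derivative of the weighted Wronskian \<open>W\<close>, while
  \<open>B\<close> and \<open>C\<close> are angular derivatives with the singular coefficients tan
  and cot of chi. These coefficients do not depend on the angles, so integrating over the angles
  first removes \<open>B\<close> and \<open>C\<close> for each interior chi; the continuous
  \<open>A\<close> remains, for which the order of integration can be exchanged.\<close>

theorem S3_laplacian_symmetric:
  assumes f: "smooth_on_S3 f" and h: "smooth_on_S3 h"
  shows "S3_integral (\<lambda>x. S3_laplacian f x * h x) = S3_integral (\<lambda>x. f x * S3_laplacian h x)"
proof -
  note cf = smooth_on_S3_continuous[OF f] and ch = smooth_on_S3_continuous[OF h]
  note lf = continuous_on_S3_laplacian[OF f] and lh = continuous_on_S3_laplacian[OF h]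
  obtain F1 F11 F2 F22 F3 F33 where PF: "has_toroidal_partials f F1 F11 F2 F22 F3 F33"
    using toroidal_partial_derivatives[OF f] by blast
  obtain H1 H11 H2 H22 H3 H33 where PH: "has_toroidal_partials h H1 H11 H2 H22 H3 H33"
    using toroidal_partial_derivatives[OF h] by blast
  let ?T = toroidal
  define F where "F x y z = f (?T x y z)" for x y z
  define H where "H x y z = h (?T x y z)" for x y z
  have F1: "((\<lambda>t. F t y z) has_real_derivative F1 x y z) (at x)"
    and F11: "((\<lambda>t. F1 t y z) has_real_derivative F11 x y z) (at x)"
    and F2: "((\<lambda>t. F x t z) has_real_derivative F2 x y z) (at y)"
    and F22: "((\<lambda>t. F2 x t z) has_real_derivative F22 x y z) (at y)"
    and F3: "((\<lambda>t. F x y t) has_real_derivative F3 x y z) (at z)"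
    and F33: "((\<lambda>t. F3 x y t) has_real_derivative F33 x y z) (at z)"
    and lapf: "cos x \<noteq> 0 \<Longrightarrow> sin x \<noteq> 0 \<Longrightarrow> S3_laplacian f (toroidal x y z) =
        F11 x y z + ((cos x)\<^sup>2 - (sin x)\<^sup>2) / (cos x * sin x) * F1 x y z + F22 x y z / (cos x)\<^sup>2 + F33 x y z / (sin x)\<^sup>2" for x y z
    using PF unfolding has_toroidal_partials_def F_def by blast+
  have H1: "((\<lambda>t. H t y z) has_real_derivative H1 x y z) (at x)"
    and H11: "((\<lambda>t. H1 t y z) has_real_derivative H11 x y z) (at x)"
    and H2: "((\<lambda>t. H x t z) has_real_derivative H2 x y z) (at y)"
    and H22: "((\<lambda>t. H2 x t z) has_real_derivative H22 x y z) (at y)"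
    and H3: "((\<lambda>t. H x y t) has_real_derivative H3 x y z) (at z)"
    and H33: "((\<lambda>t. H3 x y t) has_real_derivative H33 x y z) (at z)"
    and laph: "cos x \<noteq> 0 \<Longrightarrow> sin x \<noteq> 0 \<Longrightarrow> S3_laplacian h (toroidal x y z) =
        H11 x y z + ((cos x)\<^sup>2 - (sin x)\<^sup>2) / (cos x * sin x) * H1 x y z + H22 x y z / (cos x)\<^sup>2 + H33 x y z / (sin x)\<^sup>2" for x y z
    using PH unfolding has_toroidal_partials_def H_def by blast+
  have cont: "continuous_on S (\<lambda>p. G (a p) (b p) (c p))"
    if "continuous_on UNIV (\<lambda>(x, y, z). G x y z)" "continuous_on S a" "continuous_on S b" "continuous_on S c"
    for G :: "real \<Rightarrow> real \<Rightarrow> real \<Rightarrow> real" and a b c and S :: "'x::t2_space set"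
    using continuous_on_compose2[OF that(1), of S "\<lambda>p. (a p, b p, c p)"] that(2-4) by (simp add: continuous_on_Pair)
  have cF: "continuous_on UNIV (\<lambda>(x, y, z). F x y z)" "continuous_on UNIV (\<lambda>(x, y, z). H x y z)"
    unfolding F_def H_def case_prod_unfold
    by (intro continuous_intros continuous_on_compose2[OF cf] continuous_on_compose2[OF ch]; auto)+
  have cP: "continuous_on UNIV (\<lambda>(x, y, z). F1 x y z)" "continuous_on UNIV (\<lambda>(x, y, z). F11 x y z)"
    "continuous_on UNIV (\<lambda>(x, y, z). F22 x y z)" "continuous_on UNIV (\<lambda>(x, y, z). F33 x y z)"
    "continuous_on UNIV (\<lambda>(x, y, z). H1 x y z)" "continuous_on UNIV (\<lambda>(x, y, z). H11 x y z)"
    "continuous_on UNIV (\<lambda>(x, y, z). H22 x y z)" "continuous_on UNIV (\<lambda>(x, y, z). H33 x y z)"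
    using PF PH unfolding has_toroidal_partials_def by blast+
  note conts = cont[OF cF(1)] cont[OF cF(2)] cP[THEN cont]
  define W where "W x y z = cos x * sin x * (F1 x y z * H x y z - F x y z * H1 x y z)" for x y z
  define A where "A x y z = ((cos x)\<^sup>2 - (sin x)\<^sup>2) * (F1 x y z * H x y z - F x y z * H1 x y z)
      + cos x * sin x * (F11 x y z * H x y z - F x y z * H11 x y z)" for x y z
  define B where "B x y z = F22 x y z * H x y z - F x y z * H22 x y z" for x y z
  define C where "C x y z = F33 x y z * H x y z - F x y z * H33 x y z" for x y z
  define D where "D x y z = (S3_laplacian f (?T x y z) * h (?T x y z) - f (?T x y z) * S3_laplacian h (?T x y z)) * (cos x * sin x)" for x y z
  have dW: "((\<lambda>t. W t y z) has_real_derivative A x y z) (at x)" for x y z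
    unfolding W_def A_def
    by (rule derivative_eq_intros F1 F11 H1 H11 refl)+ (simp add: power2_eq_square algebra_simps)
  have B0: "integral angle_box (\<lambda>(y, z). B x y z) = 0" for x
  proof (rule integral_angle_dy)
    show "continuous_on angle_box (\<lambda>(y, z). B x y z)"
      unfolding B_def case_prod_unfold by (intro continuous_intros conts)
    show "((\<lambda>y. F2 x y z * H x y z - F x y z * H2 x y z) has_real_derivative B x y z) (at y)" for y z
      unfolding B_def by (rule derivative_eq_intros F2 F22 H2 H22 refl)+ (simp add: algebra_simps)
    have p: "F x (t + 2 * pi) z = F x t z" "H x (t + 2 * pi) z = H x t z" for t z
      by (simp_all add: F_def H_def toroidal_periodic)
    \<comment> \<open>A derivative of a periodic function is periodic, so the boundary terms at 0
      and 2 pi cancel.\<close>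
    have "F2 x (t + 2 * pi) z = F2 x t z" "H2 x (t + 2 * pi) z = H2 x t z" for t z
      using periodic_derivative[of "\<lambda>t. F x t z", OF p(1) F2 F2] periodic_derivative[of "\<lambda>t. H x t z", OF p(2) H2 H2] by auto
    from this[of 0] show "F2 x (2 * pi) z * H x (2 * pi) z - F x (2 * pi) z * H2 x (2 * pi) z = F2 x 0 z * H x 0 z - F x 0 z * H2 x 0 z" for z
      using p(1)[of 0 z] p(2)[of 0 z] by simp
  qed
  have C0: "integral angle_box (\<lambda>(y, z). C x y z) = 0" for x
  proof (rule integral_angle_dz)
    show "continuous_on angle_box (\<lambda>(y, z). C x y z)"
      unfolding C_def case_prod_unfold by (intro continuous_intros conts)
    show "((\<lambda>z. F3 x y z * H x y z - F x y z * H3 x y z) has_real_derivative C x y z) (at z)" for y z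
      unfolding C_def by (rule derivative_eq_intros F3 F33 H3 H33 refl)+ (simp add: algebra_simps)
    have p: "F x y (t + 2 * pi) = F x y t" "H x y (t + 2 * pi) = H x y t" for t y
      by (simp_all add: F_def H_def toroidal_periodic)
    have "F3 x y (t + 2 * pi) = F3 x y t" "H3 x y (t + 2 * pi) = H3 x y t" for t y
      using periodic_derivative[of "\<lambda>t. F x y t", OF p(1) F3 F3] periodic_derivative[of "\<lambda>t. H x y t", OF p(2) H3 H3] by auto
    from this[of y 0 for y] show "F3 x y (2 * pi) * H x y (2 * pi) - F x y (2 * pi) * H3 x y (2 * pi) = F3 x y 0 * H x y 0 - F x y 0 * H3 x y 0" for y
      using p(1)[of y 0] p(2)[of y 0] by simp
  qed
  have cA: "continuous_on S (\<lambda>p. A (fst p) (fst (snd p)) (snd (snd p)))" for S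
    unfolding A_def by (intro continuous_intros conts)
  have inner: "integral angle_box (\<lambda>(y, z). D x y z) = integral angle_box (\<lambda>(y, z). A x y z)"
    if x: "x \<in> {0<..<pi/2}" for x
  proof -
    have nz: "cos x \<noteq> 0" "sin x \<noteq> 0" using x cos_gt_zero_pi[of x] sin_gt_zero[of x] by auto
    have "D x y z = A x y z + (sin x / cos x * B x y z + cos x / sin x * C x y z)" for y z
    proof -
      have "(a1 + (c\<^sup>2 - s\<^sup>2) / (c * s) * a2 + a3 / c\<^sup>2 + a4 / s\<^sup>2) * (c * s)
        = a1 * (c * s) + (c\<^sup>2 - s\<^sup>2) * a2 + a3 * (s / c) + a4 * (c / s)" if "c \<noteq> 0" "s \<noteq> 0" for a1 a2 a3 a4 c s :: real
        using that by (simp add: field_simps power2_eq_square)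
      note e = this[OF nz]
      have "D x y z = S3_laplacian f (?T x y z) * (cos x * sin x) * H x y z - F x y z * (S3_laplacian h (?T x y z) * (cos x * sin x))"
        by (simp add: D_def F_def H_def left_diff_distrib)
      also have "\<dots> = A x y z + (sin x / cos x * B x y z + cos x / sin x * C x y z)"
        unfolding lapf[OF nz] laph[OF nz] e A_def B_def C_def by (simp add: algebra_simps)
      finally show ?thesis .
    qed
    then have D: "(\<lambda>(y, z). D x y z) = (\<lambda>p. A x (fst p) (snd p) + (sin x / cos x * B x (fst p) (snd p) + cos x / sin x * C x (fst p) (snd p)))"
      by (simp add: case_prod_unfold)
    have "continuous_on angle_box (\<lambda>p. A x (fst p) (snd p))" "continuous_on angle_box (\<lambda>p. B x (fst p) (snd p))"
      "continuous_on angle_box (\<lambda>p. C x (fst p) (snd p))"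
      unfolding A_def B_def C_def by (intro continuous_intros conts)+
    note int = this[THEN integrable_continuous, THEN integrable_integral]
    have "((\<lambda>(y, z). D x y z) has_integral integral angle_box (\<lambda>p. A x (fst p) (snd p)) + (sin x / cos x * 0 + cos x / sin x * 0)) angle_box"
      unfolding D using B0[of x] C0[of x] int(2,3)
      by (intro has_integral_add has_integral_mult_right int(1)) (simp_all add: case_prod_unfold)
    then show ?thesis by (simp add: integral_unique case_prod_unfold)
  qed
  have cD: "continuous_on S3 (\<lambda>x. S3_laplacian f x * h x - f x * S3_laplacian h x)"
    by (intro continuous_intros cf ch lf lh)
  have "S3_integral (\<lambda>x. S3_laplacian f x * h x - f x * S3_laplacian h x)
      = integral (cbox 0 (pi / 2)) (\<lambda>x. integral angle_box (\<lambda>(y, z). D x y z))"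
    unfolding S3_integral_iterated[OF cD] D_def ..
  \<comment> \<open>The inner identity is available for interior chi; the two end points form a null
    set.\<close>
  also have "\<dots> = integral (cbox 0 (pi / 2)) (\<lambda>x. integral angle_box (\<lambda>(y, z). A x y z))"
    by (rule integral_spike[where S = "{0, pi / 2}"]) (use inner in auto)
  also have "\<dots> = integral angle_box (\<lambda>p. integral (cbox 0 (pi / 2)) (\<lambda>x. case p of (y, z) \<Rightarrow> A x y z))"
    by (rule integral_swap_continuous[where f = "\<lambda>x (y, z). A x y z"]) (use cA in \<open>simp add: case_prod_unfold\<close>)
  also have "(\<lambda>p. integral (cbox 0 (pi / 2)) (\<lambda>x. case p of (y, z) \<Rightarrow> A x y z)) = (\<lambda>p. 0)"
  proof
    fix p :: "real \<times> real"
    obtain y z where p: "p = (y, z)" by (metis prod.collapse)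
    have "((\<lambda>x. A x y z) has_integral W (pi / 2) y z - W 0 y z) {0..pi / 2}"
      by (rule fundamental_theorem_of_calculus)
         (use dW in \<open>auto simp: has_real_derivative_iff_has_vector_derivative[symmetric] intro: has_field_derivative_at_within\<close>)
    moreover have "W (pi / 2) y z = 0" "W 0 y z = 0" by (simp_all add: W_def)
    ultimately show "integral (cbox 0 (pi / 2)) (\<lambda>x. case p of (y, z) \<Rightarrow> A x y z) = 0"
      by (simp add: p integral_unique)
  qed
  finally have "S3_integral (\<lambda>x. S3_laplacian f x * h x + (- 1) * (f x * S3_laplacian h x)) = 0" by simp
  then show ?thesis
    by (subst (asm) S3_integral_add; (subst (asm) S3_integral_cmult)?) (auto intro!: continuous_intros cf ch lf lh)
qed

section \<open>Orthonormality\<close>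

lemma integral_angle_cos:
  fixes l m :: int and \<delta> :: real
  shows "((\<lambda>(y, z). cos (of_int l * y + of_int m * z + \<delta>)) has_integral
    (if l = 0 \<and> m = 0 then 4 * pi\<^sup>2 * cos \<delta> else 0)) angle_box"
proof -
  let ?G = "\<lambda>y z. cos (of_int l * y + of_int m * z + \<delta>)"
  have c: "continuous_on angle_box (\<lambda>(y, z). ?G y z)"
    unfolding case_prod_unfold by (intro continuous_intros)
  have per: "sin (of_int n * (2 * pi) + t) = sin t" for n :: int and t
    using sin.plus_of_int[of t n] by (simp add: add.commute mult_ac)
  have "integral angle_box (\<lambda>(y, z). ?G y z) = (if l = 0 \<and> m = 0 then 4 * pi\<^sup>2 * cos \<delta> else 0)"
  proof (cases "m = 0")
    case False
    have "integral angle_box (\<lambda>(y, z). ?G y z) = 0"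
    proof (rule integral_angle_dz[OF c, where P = "\<lambda>y z. sin (of_int l * y + of_int m * z + \<delta>) / of_int m"])
      show "((\<lambda>z. sin (of_int l * y + of_int m * z + \<delta>) / of_int m) has_real_derivative ?G y z) (at z)" for y z
        using False by (auto intro!: derivative_eq_intros)
      show "sin (of_int l * y + of_int m * (2 * pi) + \<delta>) / of_int m = sin (of_int l * y + of_int m * 0 + \<delta>) / of_int m" for y
        using per[of m "of_int l * y + \<delta>"] by (simp add: algebra_simps)
    qed
    then show ?thesis using False by simp
  next
    case m: True
    show ?thesis
    proof (cases "l = 0")
      case False
      have "integral angle_box (\<lambda>(y, z). ?G y z) = 0"
      proof (rule integral_angle_dy[OF c, where P = "\<lambda>y z. sin (of_int l * y + of_int m * z + \<delta>) / of_int l"])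
        show "((\<lambda>y. sin (of_int l * y + of_int m * z + \<delta>) / of_int l) has_real_derivative ?G y z) (at y)" for y z
          using False by (auto intro!: derivative_eq_intros)
        show "sin (of_int l * (2 * pi) + of_int m * z + \<delta>) / of_int l = sin (of_int l * 0 + of_int m * z + \<delta>) / of_int l" for z
          using per[of l "of_int m * z + \<delta>"] by (simp add: algebra_simps)
      qed
      then show ?thesis using False by simp
    next
      case True
      then show ?thesis
        using m integral_prod_continuous[OF c] by (simp add: power2_eq_square)
    qed
  qed
  then show ?thesis using integrable_integral[OF integrable_continuous[OF c]] by simp
qed

lemma continuous_on_torus_mode: "continuous_on S (torus_mode l m \<delta> Q)"
  using real_polynomial_function_torus_mode
  by (intro continuous_at_imp_continuous_on) (auto intro: continuous_real_polymonial_function)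

text \<open>The product formula for cosines gives the frequencies (l + l', m + m') and (l - l', m -
  m'), and an angular integral can be nonzero only at frequency zero. The radial integral stays a
  parameter \<open>N\<close>, to be evaluated only where the angular factor does not vanish.\<close>

lemma S3_integral_torus_mode_mult:
  assumes "((\<lambda>x. cos x ^ (nat \<bar>l\<bar> + nat \<bar>l'\<bar> + 1) * sin x ^ (nat \<bar>m\<bar> + nat \<bar>m'\<bar> + 1) * (poly Q ((cos x)\<^sup>2) * poly Q' ((cos x)\<^sup>2)))
    has_integral N) {0..pi/2}"
  shows "S3_integral (\<lambda>x. torus_mode l m \<delta> Q x * torus_mode l' m' \<delta>' Q' x) =
    N * 2 * pi\<^sup>2 * ((if l + l' = 0 \<and> m + m' = 0 then cos (\<delta> + \<delta>') else 0) + (if l = l' \<and> m = m' then cos (\<delta> - \<delta>') else 0))"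
proof -
  let ?R = "\<lambda>x. cos x ^ (nat \<bar>l\<bar> + nat \<bar>l'\<bar> + 1) * sin x ^ (nat \<bar>m\<bar> + nat \<bar>m'\<bar> + 1) * (poly Q ((cos x)\<^sup>2) * poly Q' ((cos x)\<^sup>2))"
  let ?A = "((if l + l' = 0 \<and> m + m' = 0 then cos (\<delta> + \<delta>') else 0) + (if l = l' \<and> m = m' then cos (\<delta> - \<delta>') else 0))"
  have "integral angle_box (\<lambda>(y, z). torus_mode l m \<delta> Q (toroidal x y z) * torus_mode l' m' \<delta>' Q' (toroidal x y z) * (cos x * sin x))
     = ?R x * (2 * pi\<^sup>2 * ?A)" for x
  proof -
    have e: "torus_mode l m \<delta> Q (toroidal x y z) * torus_mode l' m' \<delta>' Q' (toroidal x y z) * (cos x * sin x)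
      = ?R x / 2 * (cos (of_int (l + l') * y + of_int (m + m') * z + (\<delta> + \<delta>')) + cos (of_int (l - l') * y + of_int (m - m') * z + (\<delta> - \<delta>')))" for y z
    proof -
      define u where "u = of_int l * y + of_int m * z + \<delta>"
      define v where "v = of_int l' * y + of_int m' * z + \<delta>'"
      have uv: "of_int (l + l') * y + of_int (m + m') * z + (\<delta> + \<delta>') = u + v"
        "of_int (l - l') * y + of_int (m - m') * z + (\<delta> - \<delta>') = u - v"
        by (simp_all add: u_def v_def algebra_simps)
      show ?thesis
        unfolding torus_mode_toroidal u_def[symmetric] v_def[symmetric] uv
        by (simp add: cos_add cos_diff power_add)
    qed
    have "((\<lambda>(y, z). ?R x / 2 * (cos (of_int (l + l') * y + of_int (m + m') * z + (\<delta> + \<delta>')) + cos (of_int (l - l') * y + of_int (m - m') * z + (\<delta> - \<delta>'))))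
      has_integral ?R x / 2 * ((if l + l' = 0 \<and> m + m' = 0 then 4 * pi\<^sup>2 * cos (\<delta> + \<delta>') else 0) + (if l - l' = 0 \<and> m - m' = 0 then 4 * pi\<^sup>2 * cos (\<delta> - \<delta>') else 0))) angle_box"
      using has_integral_mult_right[OF has_integral_add[OF integral_angle_cos[of "l + l'" "m + m'" "\<delta> + \<delta>'"] integral_angle_cos[of "l - l'" "m - m'" "\<delta> - \<delta>'"]], of "?R x / 2"]
      by (simp only: case_prod_unfold)
    then show ?thesis unfolding e by (subst integral_unique, assumption) (auto simp: algebra_simps)
  qed
  moreover have "continuous_on S3 (\<lambda>x. torus_mode l m \<delta> Q x * torus_mode l' m' \<delta>' Q' x)"
    by (intro continuous_intros continuous_on_torus_mode)
  ultimately have "S3_integral (\<lambda>x. torus_mode l m \<delta> Q x * torus_mode l' m' \<delta>' Q' x)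
     = integral (cbox 0 (pi / 2)) (\<lambda>x. ?R x * (2 * pi\<^sup>2 * ?A))"
    by (simp only: S3_integral_iterated)
  also have "\<dots> = N * (2 * pi\<^sup>2 * ?A)"
    using has_integral_mult_left[OF assms, of "2 * pi\<^sup>2 * ?A"] by (simp only: cbox_interval integral_unique)
  finally show ?thesis by (simp only: mult.assoc)
qed

definition harmonic :: "nat \<Rightarrow> int \<Rightarrow> int \<Rightarrow> real \<Rightarrow> real^4 \<Rightarrow> real" where
  "harmonic k l m \<delta> = torus_mode l m \<delta> (Jpoly (nat \<bar>m\<bar>) (nat \<bar>l\<bar>) (mode_deg k l m))"

text \<open>When both frequencies are nonzero, the mode of the theorem combines two functions
  \<open>Psi\<close> with the factor \<open>sqrt (1/2)\<close>; on the axes a single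
  \<open>Psi\<close> already is one cosine or sine.\<close>

definition mode_scale :: "nat \<Rightarrow> int \<Rightarrow> int \<Rightarrow> real" where
  "mode_scale k l m = (if l = 0 \<or> m = 0 then 1 else sqrt (1 / 2)) / mode_norm k l m"

definition unit_mode :: "nat \<Rightarrow> int \<times> int \<times> real \<Rightarrow> real^4 \<Rightarrow> real" where
  "unit_mode k = (\<lambda>(l, m, \<delta>) x. mode_scale k l m * harmonic k l m \<delta> x)"

text \<open>Half of the plane of angular frequencies suffices: \<open>(l, m, \<delta>)\<close> and \<open>(- l, - m, - \<delta>)\<close> give the same
  function. The phase \<open>- pi / 2\<close> turns the cosine into the sine.\<close>

definition mode_indices :: "int \<Rightarrow> int \<Rightarrow> nat \<Rightarrow> (int \<times> int \<times> real) set" where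
  "mode_indices p q k = {(l, m, \<delta>). (l > 0 \<or> l = 0 \<and> m \<ge> 0) \<and> mode_exists k l m \<and> p dvd l + q * m \<and>
     (\<delta> = 0 \<or> \<delta> = - pi / 2 \<and> (l, m) \<noteq> (0, 0))}"

lemma finite_mode_indices: "finite (mode_indices p q k)"
proof (rule finite_subset)
  show "mode_indices p q k \<subseteq> {- int k..int k} \<times> {- int k..int k} \<times> {0, - pi / 2}"
    by (auto simp: mode_indices_def mode_exists_def)
qed auto

lemma mode_exists_deg:
  assumes "mode_exists k l m"
  shows "k = nat \<bar>m\<bar> + nat \<bar>l\<bar> + 2 * mode_deg k l m"
proof -
  have le: "nat \<bar>l\<bar> + nat \<bar>m\<bar> \<le> k" and cong: "(l + m) mod 2 = int k mod 2"
    using assms by (auto simp: mode_exists_def cong_def)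
  have "even (int k - (\<bar>l\<bar> + \<bar>m\<bar>))"
    using cong by (simp add: mod2_eq_if split: if_splits)
  moreover have "int (k - (nat \<bar>l\<bar> + nat \<bar>m\<bar>)) = int k - (\<bar>l\<bar> + \<bar>m\<bar>)"
    using le by simp
  ultimately have "even (k - (nat \<bar>l\<bar> + nat \<bar>m\<bar>))" by (metis even_of_nat)
  then have "2 * mode_deg k l m = k - (nat \<bar>l\<bar> + nat \<bar>m\<bar>)" by (simp add: mode_deg_def)
  then show ?thesis using le by simp
qed

lemma mode_exists_of_deg:
  "mode_exists (nat \<bar>m\<bar> + nat \<bar>l\<bar> + 2 * d) l m" "mode_deg (nat \<bar>m\<bar> + nat \<bar>l\<bar> + 2 * d) l m = d"
proof -
  have "even (l + m - int (nat \<bar>m\<bar> + nat \<bar>l\<bar> + 2 * d))" by (auto simp: abs_if)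
  then show "mode_exists (nat \<bar>m\<bar> + nat \<bar>l\<bar> + 2 * d) l m"
    by (simp add: mode_exists_def cong_iff_dvd_diff)
qed (simp add: mode_deg_def)

section \<open>Eigenvalues and inner products of the modes\<close>

lemma harmonic_polynomial: "real_polynomial_function (harmonic k l m \<delta>)"
  by (simp add: harmonic_def real_polynomial_function_torus_mode)

lemma unit_mode_polynomial: "real_polynomial_function (unit_mode k i)"
  by (cases i) (auto simp: unit_mode_def intro!: real_polynomial_function.intros(2,4) harmonic_polynomial)

lemma continuous_on_real_polynomial: "real_polynomial_function p \<Longrightarrow> continuous_on S p"
  by (intro continuous_at_imp_continuous_on ballI continuous_real_polymonial_function)

definition laplace_eigenfunction :: "nat \<Rightarrow> (real^4 \<Rightarrow> real) \<Rightarrow> bool" where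
  "laplace_eigenfunction k f \<longleftrightarrow> smooth_on_S3 f \<and>
     (\<forall>x\<in>S3. S3_laplacian f x = - (real k * (real k + 2)) * f x)"

lemma harmonic_eigenfunction:
  assumes "mode_exists k l m"
  shows "laplace_eigenfunction k (harmonic k l m \<delta>)"
  using torus_mode_eigenfunction[of _ l m \<delta> "mode_deg k l m"]
  unfolding mode_exists_deg[OF assms, symmetric] laplace_eigenfunction_def harmonic_def
  by (simp add: smooth_on_S3_polynomial real_polynomial_function_torus_mode)

lemma laplace_eigenfunction_sum:
  assumes "finite I" "\<And>i. i \<in> I \<Longrightarrow> real_polynomial_function (h i)" "\<And>i. i \<in> I \<Longrightarrow> laplace_eigenfunction k (h i)"
  shows "laplace_eigenfunction k (\<lambda>x. \<Sum>i\<in>I. c i * h i x)"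
proof -
  have "smooth_on_S3 (\<lambda>x. \<Sum>i\<in>I. c i * h i x)"
    using assms by (auto intro!: smooth_on_S3_polynomial real_polynomial_function_sum real_polynomial_function.intros(2,4))
  then show ?thesis
    using assms(3) S3_laplacian_sum[OF assms(1,2), where c = c]
    unfolding laplace_eigenfunction_def
    by (simp add: sum_distrib_left mult_ac cong: sum.cong) (simp add: sum_negf)
qed

lemma unit_mode_eigenfunction:
  assumes "i \<in> mode_indices p q k"
  shows "laplace_eigenfunction k (unit_mode k i)"
proof -
  obtain l m \<delta> where i: "i = (l, m, \<delta>)" by (cases i)
  then have "laplace_eigenfunction k (harmonic k l m \<delta>)"
    using assms harmonic_eigenfunction by (auto simp: mode_indices_def)
  from laplace_eigenfunction_sum[OF _ _ this, of "{0::nat}" "\<lambda>_. mode_scale k l m"]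
  show ?thesis by (simp add: i unit_mode_def harmonic_polynomial)
qed

text \<open>Symmetry of the Laplacian and distinct eigenvalues: k (k + 2) - j (j + 2) is the product
  of k - j and the positive number j + k + 2.\<close>

lemma laplace_eigenfunctions_orthogonal:
  assumes f: "laplace_eigenfunction j f" and h: "laplace_eigenfunction k h" and "j \<noteq> k"
  shows "S3_integral (\<lambda>x. f x * h x) = 0"
proof -
  have c: "continuous_on S3 (\<lambda>x. f x * h x)"
    using f h unfolding laplace_eigenfunction_def by (intro continuous_on_mult smooth_on_S3_continuous) auto
  have e1: "S3_integral (\<lambda>x. S3_laplacian f x * h x) = S3_integral (\<lambda>x. - (real j * (real j + 2)) * (f x * h x))"
    using f by (intro S3_integral_cong) (simp add: laplace_eigenfunction_def)
  have e2: "S3_integral (\<lambda>x. f x * S3_laplacian h x) = S3_integral (\<lambda>x. - (real k * (real k + 2)) * (f x * h x))"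
    using h by (intro S3_integral_cong) (simp add: laplace_eigenfunction_def)
  have "S3_integral (\<lambda>x. S3_laplacian f x * h x) = S3_integral (\<lambda>x. f x * S3_laplacian h x)"
    using f h unfolding laplace_eigenfunction_def by (intro S3_laplacian_symmetric) auto
  then have "- (real j * (real j + 2)) * S3_integral (\<lambda>x. f x * h x) = - (real k * (real k + 2)) * S3_integral (\<lambda>x. f x * h x)"
    unfolding e1 e2 S3_integral_cmult[OF c] .
  moreover have "real j * (real j + 2) \<noteq> real k * (real k + 2)"
  proof
    assume "real j * (real j + 2) = real k * (real k + 2)"
    then have "(real j - real k) * (real j + real k + 2) = 0" by (simp add: algebra_simps)
    then show False using \<open>j \<noteq> k\<close> by auto
  qed
  ultimately show ?thesis by simp
qed

text \<open>\<open>N\<close> is the radial integral, and 2 pi^2 is half of the area 4 pi^2 of the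
  angular square, as for a squared cosine; at l = m = 0 the cosine is constant and the full area
  counts. The powers of 2 in \<open>mode_norm\<close> and the factor 1 / 2 from
  \<open>mode_scale\<close> compensate this in every case.\<close>

lemma mode_scale_square:
  fixes k l m
  defines "d \<equiv> mode_deg k l m"
  defines "N \<equiv> fact (nat \<bar>m\<bar> + d) * fact (nat \<bar>l\<bar> + d) / (2 * (real k + 1) * fact d * fact (nat \<bar>m\<bar> + nat \<bar>l\<bar> + d))"
  shows "mode_scale k l m * mode_scale k l m * (N * 2 * pi\<^sup>2 * (if l = 0 \<and> m = 0 then 2 else 1)) = 1" and "mode_scale k l m \<noteq> 0"
proof -
  have N: "N > 0" unfolding N_def by (intro divide_pos_pos mult_pos_pos) auto
  have norm: "mode_norm k l m = sqrt (2 ^ ((if l = 0 then 1 else 0) + (if m = 0 then 1 else 0))) * pi * sqrt N"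
    unfolding mode_norm_def Let_def d_def[symmetric] N_def by (simp only: mult_ac add_ac)
  have sq: "mode_scale k l m * mode_scale k l m
     = (if l = 0 \<or> m = 0 then 1 else 1 / 2) / (2 ^ ((if l = 0 then 1 else 0) + (if m = 0 then 1 else 0)) * pi\<^sup>2 * N)"
  proof -
    have "mode_norm k l m * mode_norm k l m = 2 ^ ((if l = 0 then 1 else 0) + (if m = 0 then 1 else 0)) * pi\<^sup>2 * N"
    proof -
      have "(sqrt P * pi * sqrt N) * (sqrt P * pi * sqrt N) = P * pi\<^sup>2 * N" if "P \<ge> 0" for P
      proof -
        have "(sqrt P * pi * sqrt N) * (sqrt P * pi * sqrt N) = (sqrt P * sqrt P) * pi\<^sup>2 * (sqrt N * sqrt N)"
          by (simp only: power2_eq_square mult_ac)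
        then show ?thesis using that N by simp
      qed
      then show ?thesis unfolding norm by simp
    qed
    then show ?thesis unfolding mode_scale_def by (simp add: times_divide_times_eq)
  qed
  show 1: "mode_scale k l m * mode_scale k l m * (N * 2 * pi\<^sup>2 * (if l = 0 \<and> m = 0 then 2 else 1)) = 1"
    unfolding sq using N by (auto simp: field_simps)
  then show "mode_scale k l m \<noteq> 0" by auto
qed

text \<open>For fixed \<open>k\<close> the frequencies determine the radial factor, so different
  modes are separated by their angles: opposite nonzero frequencies are excluded by the half plane,
  and modes with equal frequencies differ in phase by pi / 2.\<close>

theorem unit_mode_orthonormal:
  assumes i: "i \<in> mode_indices p q k" and j: "j \<in> mode_indices p q k"
  shows "S3_integral (\<lambda>x. unit_mode k i x * unit_mode k j x) = (if i = j then 1 else 0)"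
proof -
  obtain l m \<delta> where ij: "i = (l, m, \<delta>)" by (cases i)
  obtain l' m' \<delta>' where jj: "j = (l', m', \<delta>')" by (cases j)
  let ?Q = "Jpoly (nat \<bar>m\<bar>) (nat \<bar>l\<bar>) (mode_deg k l m)" and ?Q' = "Jpoly (nat \<bar>m'\<bar>) (nat \<bar>l'\<bar>) (mode_deg k l' m')"
  let ?R = "\<lambda>x. cos x ^ (nat \<bar>l\<bar> + nat \<bar>l'\<bar> + 1) * sin x ^ (nat \<bar>m\<bar> + nat \<bar>m'\<bar> + 1) * (poly ?Q ((cos x)\<^sup>2) * poly ?Q' ((cos x)\<^sup>2))"
  have half: "l > 0 \<or> l = 0 \<and> m \<ge> 0" "l' > 0 \<or> l' = 0 \<and> m' \<ge> 0"
    and ex: "mode_exists k l m" and ph: "\<delta> = 0 \<or> \<delta> = - pi / 2 \<and> (l, m) \<noteq> (0, 0)" "\<delta>' = 0 \<or> \<delta>' = - pi / 2 \<and> (l', m') \<noteq> (0, 0)"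
    using i j by (auto simp: ij jj mode_indices_def)
  \<comment> \<open>\<open>N\<close> is identified by \<open>has_integral_Jpoly_square\<close> in
    the case of equal indices; in all other cases the angular factor is 0.\<close>
  have "?R integrable_on {0..pi/2}"
    by (intro integrable_continuous_interval continuous_intros)
  then obtain N where N: "(?R has_integral N) {0..pi/2}" by (auto simp: integrable_on_def)
  have "S3_integral (\<lambda>x. unit_mode k i x * unit_mode k j x)
     = S3_integral (\<lambda>x. (mode_scale k l m * mode_scale k l' m') * (harmonic k l m \<delta> x * harmonic k l' m' \<delta>' x))"
    by (intro S3_integral_cong) (simp add: unit_mode_def ij jj)
  also have "\<dots> = mode_scale k l m * mode_scale k l' m' * S3_integral (\<lambda>x. harmonic k l m \<delta> x * harmonic k l' m' \<delta>' x)"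
    by (intro S3_integral_cmult continuous_intros continuous_on_real_polynomial harmonic_polynomial)
  also have "S3_integral (\<lambda>x. harmonic k l m \<delta> x * harmonic k l' m' \<delta>' x)
    = N * 2 * pi\<^sup>2 * ((if l + l' = 0 \<and> m + m' = 0 then cos (\<delta> + \<delta>') else 0) + (if l = l' \<and> m = m' then cos (\<delta> - \<delta>') else 0))"
    unfolding harmonic_def by (rule S3_integral_torus_mode_mult[OF N])
  finally have eq: "S3_integral (\<lambda>x. unit_mode k i x * unit_mode k j x) = mode_scale k l m * mode_scale k l' m' * \<dots>" .
  show ?thesis
  proof (cases "l = l' \<and> m = m'")
    case True
    then have [simp]: "l' = l" "m' = m" by auto
    show ?thesis
    proof (cases "\<delta> = \<delta>'")
      case d: True
      have "l + l' = 0 \<and> m + m' = 0 \<longleftrightarrow> l = 0 \<and> m = 0" by auto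
      moreover have "(if l = 0 \<and> m = 0 then cos (\<delta> + \<delta>') else 0) = (if l = 0 \<and> m = 0 then 1 else 0)"
        using ph d by auto
      moreover have "?R = (\<lambda>x. cos x ^ (2 * nat \<bar>l\<bar> + 1) * sin x ^ (2 * nat \<bar>m\<bar> + 1) * (poly ?Q ((cos x)\<^sup>2))\<^sup>2)"
        by (simp add: power2_eq_square mult_2)
      then have "N = fact (nat \<bar>m\<bar> + mode_deg k l m) * fact (nat \<bar>l\<bar> + mode_deg k l m) / (2 * (real k + 1) * fact (mode_deg k l m) * fact (nat \<bar>m\<bar> + nat \<bar>l\<bar> + mode_deg k l m))"
        using N has_integral_Jpoly_square[of "nat \<bar>l\<bar>" "nat \<bar>m\<bar>" "mode_deg k l m"] mode_exists_deg[OF ex]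
        by (metis (no_types, lifting) has_integral_unique)
      ultimately show ?thesis
        unfolding eq using mode_scale_square(1)[of k l m] d by (simp add: ij jj cong: if_cong) (auto split: if_splits)
    next
      case d: False
      then have nz: "\<not> (l = 0 \<and> m = 0)" and "\<delta> - \<delta>' = pi / 2 \<or> \<delta> - \<delta>' = - (pi / 2)" using ph by auto
      then have "cos (\<delta> - \<delta>') = 0" by (metis cos_minus cos_pi_half)
      then show ?thesis unfolding eq using nz d by (auto simp: ij jj)
    qed
  next
    case False
    then have "\<not> (l + l' = 0 \<and> m + m' = 0)" using half by auto
    then show ?thesis unfolding eq using False by (auto simp: ij jj)
  qed
qed

section \<open>Completeness\<close>

text \<open>The phases 0 and - pi / 2 give real and imaginary part, so the two phases in
  \<open>mode_indices\<close> span all of them.\<close>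

lemma torus_mode_phase:
  "torus_mode l m \<delta> Q x = cos \<delta> * torus_mode l m 0 Q x + - sin \<delta> * torus_mode l m (- pi / 2) Q x"
proof -
  have "cis (- pi / 2) = - \<i>" by (simp add: complex_eq_iff)
  then show ?thesis unfolding torus_mode_def by (simp add: algebra_simps)
qed

lemma torus_mode_minus:
  assumes "x \<in> S3"
  shows "torus_mode (- l) (- m) (- \<delta>) Q x = torus_mode l m \<delta> Q x"
proof -
  obtain a b c where x: "x = toroidal a b c" using toroidal_surj[OF assms] by metis
  have "of_int (- l) * b + of_int (- m) * c + - \<delta> = - (of_int l * b + of_int m * c + \<delta>)" by simp
  then have "cos (of_int (- l) * b + of_int (- m) * c + - \<delta>) = cos (of_int l * b + of_int m * c + \<delta>)"
    by (simp only: cos_minus)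
  then show ?thesis unfolding x torus_mode_toroidal by (simp only: abs_minus_cancel)
qed

lemma torus_mode_poly_add: "torus_mode l m \<delta> (smult c P + Q) x = c * torus_mode l m \<delta> P x + torus_mode l m \<delta> Q x"
  by (simp add: torus_mode_def algebra_simps)

section \<open>Polynomials in complex coordinates\<close>

definition monomial4 :: "nat \<Rightarrow> nat \<Rightarrow> nat \<Rightarrow> nat \<Rightarrow> real \<Rightarrow> real^4 \<Rightarrow> real" where
  "monomial4 a b c e \<delta> x = Re (cis \<delta> * Complex (x$1) (x$2) ^ a * cnj (Complex (x$1) (x$2)) ^ b *
     Complex (x$3) (x$4) ^ c * cnj (Complex (x$3) (x$4)) ^ e)"

text \<open>Re z and Im z are combinations of z and its conjugate, so multiplication by a coordinate
  only raises exponents; the factors i and -i from the imaginary part are phase shifts by pi / 2.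
  This is why the monomials carry an arbitrary phase.\<close>

lemma monomial4_mult_coordinate:
  "x $ 1 * monomial4 a b c e \<delta> x = (1/2) * monomial4 (Suc a) b c e \<delta> x + (1/2) * monomial4 a (Suc b) c e \<delta> x"
  "x $ 2 * monomial4 a b c e \<delta> x = (1/2) * monomial4 (Suc a) b c e (\<delta> - pi / 2) x + (1/2) * monomial4 a (Suc b) c e (\<delta> + pi / 2) x"
  "x $ 3 * monomial4 a b c e \<delta> x = (1/2) * monomial4 a b (Suc c) e \<delta> x + (1/2) * monomial4 a b c (Suc e) \<delta> x"
  "x $ 4 * monomial4 a b c e \<delta> x = (1/2) * monomial4 a b (Suc c) e (\<delta> - pi / 2) x + (1/2) * monomial4 a b c (Suc e) (\<delta> + pi / 2) x"
proof -
  have re: "r * Re w = (1/2) * Re (w * z) + (1/2) * Re (w * cnj z)" if "r = Re z" for r w z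
    using that by (simp add: algebra_simps)
  have im: "r * Re w = (1/2) * Re (cis (- pi / 2) * (w * z)) + (1/2) * Re (cis (pi / 2) * (w * cnj z))" if "r = Im z" for r w z
  proof -
    have "cis (- pi / 2) = - \<i>" "cis (pi / 2) = \<i>" by (simp_all add: complex_eq_iff)
    then show ?thesis using that by (simp add: algebra_simps)
  qed
  have cis: "cis (\<delta> - pi / 2) = cis (- pi / 2) * cis \<delta>" "cis (\<delta> + pi / 2) = cis (pi / 2) * cis \<delta>"
    by (simp_all only: cis_mult diff_conv_add_uminus minus_divide_left add.commute)
  define u where "u = Complex (x$1) (x$2)"
  define v where "v = Complex (x$3) (x$4)"
  note uv = u_def[symmetric] v_def[symmetric]
  show "x $ 1 * monomial4 a b c e \<delta> x = (1/2) * monomial4 (Suc a) b c e \<delta> x + (1/2) * monomial4 a (Suc b) c e \<delta> x"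
    unfolding monomial4_def uv
    by (subst re[of _ u]) (simp add: u_def, simp only: power_Suc mult_ac)
  show "x $ 3 * monomial4 a b c e \<delta> x = (1/2) * monomial4 a b (Suc c) e \<delta> x + (1/2) * monomial4 a b c (Suc e) \<delta> x"
    unfolding monomial4_def uv
    by (subst re[of _ v]) (simp add: v_def, simp only: power_Suc mult_ac)
  show "x $ 2 * monomial4 a b c e \<delta> x = (1/2) * monomial4 (Suc a) b c e (\<delta> - pi / 2) x + (1/2) * monomial4 a (Suc b) c e (\<delta> + pi / 2) x"
    unfolding monomial4_def uv cis
    by (subst im[of _ u]) (simp add: u_def, simp only: power_Suc mult_ac)
  show "x $ 4 * monomial4 a b c e \<delta> x = (1/2) * monomial4 a b (Suc c) e (\<delta> - pi / 2) x + (1/2) * monomial4 a b c (Suc e) (\<delta> + pi / 2) x"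
    unfolding monomial4_def uv cis
    by (subst im[of _ v]) (simp add: v_def, simp only: power_Suc mult_ac)
qed

text \<open>Pairing each complex coordinate with its conjugate splits off |z|^(2 min a b) and |w|^(2
  min c e) and leaves pure powers. On the sphere |z|^2 = t and |w|^2 = 1 - t, which gives the
  polynomial factor in t.\<close>

lemma monomial4_eq_torus_mode:
  assumes "X \<in> S3"
  shows "monomial4 a b c e \<delta> X =
    torus_mode (int a - int b) (int c - int e) \<delta> ([:0, 1:] ^ min a b * [:1, -1:] ^ min c e) X"
proof -
  obtain x y z where X: "X = toroidal x y z" using toroidal_surj[OF assms] by metis
  have p: "cis t ^ a * cis (- t) ^ b = cis (of_int (int a - int b) * t)" for t a b
    by (simp add: Complex.DeMoivre cis_mult algebra_simps)
  let ?r = "cos x" and ?s = "sin x"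
  have "cis \<delta> * (of_real ?r * cis y) ^ a * cnj (of_real ?r * cis y) ^ b * (of_real ?s * cis z) ^ c * cnj (of_real ?s * cis z) ^ e
    = of_real (?r ^ (a + b) * ?s ^ (c + e)) * (cis \<delta> * (cis y ^ a * cis (- y) ^ b) * (cis z ^ c * cis (- z) ^ e))"
    by (simp only: power_mult_distrib complex_cnj_mult complex_cnj_complex_of_real cis_cnj power_add of_real_mult of_real_power mult_ac)
  also have "cis \<delta> * (cis y ^ a * cis (- y) ^ b) * (cis z ^ c * cis (- z) ^ e)
    = cis (of_int (int a - int b) * y + of_int (int c - int e) * z + \<delta>)"
    unfolding p by (simp add: cis_mult add_ac)
  finally have m: "monomial4 a b c e \<delta> X = cos x ^ (a + b) * sin x ^ (c + e) * cos (of_int (int a - int b) * y + of_int (int c - int e) * z + \<delta>)"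
    unfolding X monomial4_def toroidal_complex by (simp del: of_int_diff)
  have ab: "a + b = nat \<bar>int a - int b\<bar> + 2 * min a b" "c + e = nat \<bar>int c - int e\<bar> + 2 * min c e"
    by (auto simp: min_def)
  have "poly ([:0, 1:] ^ min a b * [:1, -1:] ^ min c e) ((cos x)\<^sup>2) = cos x ^ (2 * min a b) * sin x ^ (2 * min c e)"
    by (simp add: power_mult sin_squared_eq)
  then show ?thesis
    unfolding m unfolding X torus_mode_toroidal ab power_add by (simp only: mult_ac)
qed

inductive monomial_span :: "(real^4 \<Rightarrow> real) \<Rightarrow> bool" where
  monomial: "monomial_span (monomial4 a b c e \<delta>)"
| lin: "monomial_span f \<Longrightarrow> monomial_span g \<Longrightarrow> monomial_span (\<lambda>x. r * f x + g x)"

lemma monomial_span_zero: "monomial_span (\<lambda>x. 0)"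
  using monomial_span.lin[OF monomial_span.monomial monomial_span.monomial, of "-1" 0 0 0 0 0 0 0 0 0 0] by simp

lemma monomial_span_scale: "monomial_span f \<Longrightarrow> monomial_span (\<lambda>x. r * f x)"
  using monomial_span.lin[OF _ monomial_span_zero, of f r] by simp

lemma monomial_span_add: "monomial_span f \<Longrightarrow> monomial_span g \<Longrightarrow> monomial_span (\<lambda>x. f x + g x)"
  using monomial_span.lin[of f g 1] by simp

lemma monomial_span_coordinate:
  assumes "monomial_span f"
  shows "monomial_span (\<lambda>x. x $ i * f x)"
  using assms
proof induction
  case (monomial a b c e \<delta>)
  have "i = 1 \<or> i = 2 \<or> i = 3 \<or> i = 4" by (rule exhaust_4)
  then show ?case
    by (elim disjE) (simp_all only: monomial4_mult_coordinate, (intro monomial_span_add monomial_span_scale monomial_span.monomial)+)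
next
  case (lin f g r)
  have "(\<lambda>x. x $ i * (r * f x + g x)) = (\<lambda>x. r * (x $ i * f x) + x $ i * g x)"
    by (simp add: algebra_simps)
  then show ?case using lin by (simp add: monomial_span.lin)
qed

lemma monomial_span_polynomial:
  assumes "real_polynomial_function p"
  shows "monomial_span p"
proof -
  \<comment> \<open>Multiplying an arbitrary element of the span makes the product case a matter of
    associativity. In the end \<open>f\<close> is the constant 1, the monomial with zero exponents
    and phase.\<close>
  have "monomial_span (\<lambda>x. p x * f x)" if "monomial_span f" for f
    using assms that
  proof (induction p arbitrary: f)
    case (linear p)
    have lin: "linear p" using linear.hyps by (rule bounded_linear.linear)
    have px: "p x = p (axis 1 1) * x $ 1 + p (axis 2 1) * x $ 2 + p (axis 3 1) * x $ 3 + p (axis 4 1) * x $ 4" for x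
    proof -
      have "x = x $ 1 *\<^sub>R axis 1 1 + x $ 2 *\<^sub>R axis 2 1 + x $ 3 *\<^sub>R axis 3 1 + x $ 4 *\<^sub>R axis 4 1"
        by (rule vec4_eqI) (simp_all add: axis_def)
      then have "p x = p (x $ 1 *\<^sub>R axis 1 1 + x $ 2 *\<^sub>R axis 2 1 + x $ 3 *\<^sub>R axis 3 1 + x $ 4 *\<^sub>R axis 4 1)"
        by (rule arg_cong)
      also have "\<dots> = p (axis 1 1) * x $ 1 + p (axis 2 1) * x $ 2 + p (axis 3 1) * x $ 3 + p (axis 4 1) * x $ 4"
        by (simp add: linear_add[OF lin] linear_cmul[OF lin])
      finally show ?thesis .
    qed
    have "(\<lambda>x. p x * f x) = (\<lambda>x. p (axis 1 1) * (x $ 1 * f x) + (p (axis 2 1) * (x $ 2 * f x) +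
        (p (axis 3 1) * (x $ 3 * f x) + p (axis 4 1) * (x $ 4 * f x))))"
      by (rule ext, subst px) (simp only: distrib_right mult.assoc add.assoc)
    then show ?case
      by (simp only:) (intro monomial_span_add monomial_span_scale monomial_span_coordinate linear.prems)
  next
    case (const c)
    then show ?case by (rule monomial_span_scale)
  next
    case (add g h)
    then show ?case by (simp add: distrib_right monomial_span_add)
  next
    case (mult g h)
    then show ?case by (simp add: mult.assoc)
  qed
  from this[OF monomial_span.monomial[of 0 0 0 0 0]] show ?thesis
    by (simp add: monomial4_def)
qed

text \<open>The Jacobi polynomials for fixed \<open>l\<close>, \<open>m\<close> have every degree, hence span all polynomials in
  \<open>(cos chi)\<^sup>2\<close>; so the modes span all polynomials on the sphere.\<close>

lemma orthogonal_to_modes_eq_0: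
  assumes g: "continuous_on S3 g"
    and orth: "\<And>k i. i \<in> mode_indices 1 0 k \<Longrightarrow> S3_integral (\<lambda>x. g x * unit_mode k i x) = 0"
    and X: "X \<in> S3"
  shows "g X = 0"
proof -
  have integral_lin: "S3_integral (\<lambda>x. g x * (r * f x + h x)) = r * S3_integral (\<lambda>x. g x * f x) + S3_integral (\<lambda>x. g x * h x)"
    if "continuous_on S3 f" "continuous_on S3 h" for r f h
  proof -
    have c: "continuous_on S3 (\<lambda>x. g x * f x)" "continuous_on S3 (\<lambda>x. g x * h x)"
      using g that by (auto intro: continuous_on_mult)
    have "(\<lambda>x. g x * (r * f x + h x)) = (\<lambda>x. r * (g x * f x) + g x * h x)" by (simp add: algebra_simps)
    then show ?thesis
      using S3_integral_add[OF continuous_on_mult_left[OF c(1), of r] c(2)] S3_integral_cmult[OF c(1), of r] by simp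
  qed
  let ?J = "\<lambda>l m d. Jpoly (nat \<bar>m\<bar>) (nat \<bar>l\<bar>) d"
  note ct = continuous_on_torus_mode
  \<comment> \<open>\<open>mode_indices 1 0\<close> belongs to the trivial group: the divisibility
    condition always holds, so every frequency in the half plane occurs for a suitable
    \<open>k\<close>.\<close>
  have basic: "S3_integral (\<lambda>x. g x * torus_mode l m \<delta> (?J l m d) x) = 0"
    if half: "l > 0 \<or> l = 0 \<and> m \<ge> 0" and ph: "\<delta> = 0 \<or> \<delta> = - pi / 2" for l m d \<delta>
  proof (cases "\<delta> = - pi / 2 \<and> l = 0 \<and> m = 0")
    \<comment> \<open>The sine of frequency zero is absent from the index set, but it is the zero
      function.\<close>
    case True
    have "torus_mode l m \<delta> Q x = 0" if xS: "x \<in> S3" for Q x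
    proof -
      obtain a b c where x: "x = toroidal a b c" using toroidal_surj[OF xS] by metis
      show ?thesis unfolding x torus_mode_toroidal using True by simp
    qed
    then have "S3_integral (\<lambda>x. g x * torus_mode l m \<delta> (?J l m d) x) = S3_integral (\<lambda>x. 0 * 0)"
      by (intro S3_integral_cong) simp
    then show ?thesis using S3_integral_cmult[of "\<lambda>x. 0" 0] by simp
  next
    case False
    define k where "k = nat \<bar>m\<bar> + nat \<bar>l\<bar> + 2 * d"
    have k: "mode_exists k l m" "mode_deg k l m = d" unfolding k_def by (rule mode_exists_of_deg)+
    have "(l, m, \<delta>) \<in> mode_indices 1 0 k"
      using half ph False k by (auto simp: mode_indices_def)
    from orth[OF this]
    have "S3_integral (\<lambda>x. mode_scale k l m * (g x * torus_mode l m \<delta> (?J l m d) x)) = 0"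
      by (simp add: unit_mode_def harmonic_def k mult_ac)
    then show ?thesis
      using mode_scale_square(2)[of k l m]
      by (subst (asm) S3_integral_cmult) (auto intro!: continuous_intros g ct)
  qed
  have half: "S3_integral (\<lambda>x. g x * torus_mode l m \<delta> (?J l m d) x) = 0"
    if "l > 0 \<or> l = 0 \<and> m \<ge> 0" for l m d \<delta>
  proof -
    have "S3_integral (\<lambda>x. g x * torus_mode l m \<delta> (?J l m d) x)
      = S3_integral (\<lambda>x. g x * (cos \<delta> * torus_mode l m 0 (?J l m d) x + - sin \<delta> * torus_mode l m (- pi / 2) (?J l m d) x))"
      by (subst torus_mode_phase) simp
    also have "\<dots> = 0"
    proof -
      have "S3_integral (\<lambda>x. g x * (- sin \<delta> * torus_mode l m (- pi / 2) (?J l m d) x))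
          = S3_integral (\<lambda>x. - sin \<delta> * (g x * torus_mode l m (- pi / 2) (?J l m d) x))"
        by (intro S3_integral_cong) simp
      also have "\<dots> = 0"
        by (subst S3_integral_cmult[OF continuous_on_mult[OF g ct]]) (simp only: basic[OF that] mult_zero_right simp_thms)
      finally show ?thesis
        by (subst integral_lin[OF ct continuous_on_mult_left[OF ct]]) (simp only: basic[OF that] mult_zero_right simp_thms add_0)
    qed
    finally show ?thesis .
  qed
  have J: "S3_integral (\<lambda>x. g x * torus_mode l m \<delta> (?J l m d) x) = 0" for l m d \<delta>
  proof (cases "l > 0 \<or> l = 0 \<and> m \<ge> 0")
    case True
    then show ?thesis by (rule half)
  next
    case False
    have "S3_integral (\<lambda>x. g x * torus_mode l m \<delta> (?J l m d) x) = S3_integral (\<lambda>x. g x * torus_mode (- l) (- m) (- \<delta>) (?J l m d) x)"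
      by (intro S3_integral_cong) (simp only: torus_mode_minus)
    also have "\<dots> = 0"
    proof -
      have "- l > 0 \<or> - l = 0 \<and> - m \<ge> 0" using False by linarith
      from half[OF this, of "- \<delta>" d] show ?thesis by (simp only: abs_minus_cancel)
    qed
    finally show ?thesis .
  qed
  \<comment> \<open>Induction on a strict degree bound: a multiple of the Jacobi polynomial of
    degree \<open>n\<close> removes the coefficient at \<open>n\<close>.\<close>
  have all: "S3_integral (\<lambda>x. g x * torus_mode l m \<delta> Q x) = 0" if "\<forall>i\<ge>n. coeff Q i = 0" for l m \<delta> n Q
    using that
  proof (induction n arbitrary: Q)
    case 0
    then have "Q = 0" by (simp add: poly_eq_iff)
    then show ?case using S3_integral_cmult[of "\<lambda>x. 0" 0] by (simp add: torus_mode_def)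
  next
    case (Suc n)
    let ?P = "?J l m n"
    have nz: "coeff ?P n \<noteq> 0" unfolding coeff_Jpoly by (simp add: binomial_eq_0_iff)
    define r where "r = coeff Q n / coeff ?P n"
    define Q' where "Q' = Q - smult r ?P"
    have "coeff Q' i = 0" if "i \<ge> n" for i
    proof (cases "i = n")
      case True
      then show ?thesis using nz by (simp add: Q'_def r_def)
    next
      case False
      then have "coeff ?P i = 0" using that by (intro coeff_eq_0) (simp add: degree_Jpoly)
      then show ?thesis using Suc.prems False that by (simp add: Q'_def)
    qed
    then have "S3_integral (\<lambda>x. g x * torus_mode l m \<delta> Q' x) = 0" by (intro Suc.IH) auto
    moreover have "Q = smult r ?P + Q'" by (simp add: Q'_def)
    ultimately show ?case
      using integral_lin[OF ct ct, of r l m \<delta> ?P l m \<delta> Q'] J[of l m \<delta> n] by (simp add: torus_mode_poly_add)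
  qed
  have mono: "S3_integral (\<lambda>x. g x * monomial4 a b c e \<delta> x) = 0" for a b c e \<delta>
  proof -
    let ?Q = "[:0, 1:] ^ min a b * [:1, -1:] ^ min c e :: real poly"
    have "S3_integral (\<lambda>x. g x * monomial4 a b c e \<delta> x) = S3_integral (\<lambda>x. g x * torus_mode (int a - int b) (int c - int e) \<delta> ?Q x)"
      by (intro S3_integral_cong) (simp only: monomial4_eq_torus_mode)
    also have "\<dots> = 0" by (rule all[of "Suc (degree ?Q)"]) (auto intro: coeff_eq_0)
    finally show ?thesis .
  qed
  have cmono: "continuous_on S3 (monomial4 a b c e \<delta>)" for a b c e \<delta>
    by (rule continuous_on_eq[OF ct monomial4_eq_torus_mode[symmetric]])
  have span: "continuous_on S3 h \<and> S3_integral (\<lambda>x. g x * h x) = 0" if "monomial_span h" for h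
    using that
  proof induction
    case (lin f h r)
    then show ?case using integral_lin[of f h r] by (auto intro!: continuous_intros)
  qed (use mono cmono in auto)
  have poly: "S3_integral (\<lambda>x. g x * p x) = 0" if "real_polynomial_function p" for p
    using span monomial_span_polynomial[OF that] by blast
  obtain M where M: "\<And>x. x \<in> S3 \<Longrightarrow> \<bar>g x\<bar> \<le> M" "M > 0"
  proof -
    have "bounded (g ` S3)" using g compact_sphere by (intro compact_imp_bounded compact_continuous_image)
    then obtain M where "M > 0" "\<forall>y\<in>g ` S3. norm y \<le> M" by (meson bounded_pos)
    then show ?thesis using that[of M] by auto
  qed
  define V where "V = measure lborel toroidal_box"
  have gg: "continuous_on S3 (\<lambda>x. g x * g x)" by (intro continuous_intros g)
  have small: "\<bar>S3_integral (\<lambda>x. g x * g x)\<bar> \<le> (M * e) * V" if e: "e > 0" for e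
  proof -
    obtain p where p: "real_polynomial_function p" "\<And>x. x \<in> S3 \<Longrightarrow> \<bar>g x - p x\<bar> < e"
      using Stone_Weierstrass_real_polynomial_function[OF compact_sphere g e] by blast
    have cp: "continuous_on S3 p" by (rule continuous_on_real_polynomial[OF p(1)])
    \<comment> \<open>As \<open>g\<close> is orthogonal to \<open>p\<close>, the integral of g^2
      equals that of g (g - p), which is small.\<close>
    have "S3_integral (\<lambda>x. g x * g x) = S3_integral (\<lambda>x. g x * (- 1 * p x + g x))"
      using integral_lin[OF cp g, of "-1"] poly[OF p(1)] by simp
    moreover have "\<bar>S3_integral (\<lambda>x. g x * (- 1 * p x + g x))\<bar> \<le> (M * e) * V"
      unfolding V_def
    proof (rule S3_integral_bound)
      show "continuous_on S3 (\<lambda>x. g x * (- 1 * p x + g x))" by (intro continuous_intros g cp)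
      fix x :: "real^4" assume x: "x \<in> S3"
      show "\<bar>g x * (- 1 * p x + g x)\<bar> \<le> M * e"
        using M(1)[OF x] p(2)[OF x] M(2) by (simp add: abs_mult) (intro mult_mono; linarith)
    qed
    ultimately show ?thesis by simp
  qed
  have "S3_integral (\<lambda>x. g x * g x) = 0"
  proof (rule ccontr)
    let ?I = "\<bar>S3_integral (\<lambda>x. g x * g x)\<bar>"
    assume "S3_integral (\<lambda>x. g x * g x) \<noteq> 0"
    then have I: "?I > 0" by simp
    have V: "V \<ge> 0" by (simp add: V_def)
    \<comment> \<open>Chosen to bound the integral by half of itself; \<open>V + 1\<close> avoids a
      division by 0.\<close>
    define e where "e = ?I / (2 * M * (V + 1))"
    have "e > 0" unfolding e_def using I M(2) V by (intro divide_pos_pos mult_pos_pos) auto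
    from small[OF this] have "?I \<le> M * e * V" .
    also have "M * e * V = ?I / 2 * (V / (V + 1))" using M(2) by (simp add: e_def)
    also have "\<dots> \<le> ?I / 2 * 1" using I V by (intro mult_left_mono) auto
    finally show False using I by simp
  qed
  then show ?thesis using S3_integral_square_eq_0[OF g _ X] by blast
qed

text \<open>The remainder \<open>g\<close> is orthogonal to the modes of wave number
  \<open>k\<close> by the choice of the coefficients, and to those of another wave number because
  \<open>f\<close> and its projection both belong to a different eigenvalue.\<close>

theorem eigenfunction_expansion:
  assumes f: "laplace_eigenfunction k f" and X: "X \<in> S3"
  shows "f X = (\<Sum>i\<in>mode_indices 1 0 k. S3_integral (\<lambda>x. f x * unit_mode k i x) * unit_mode k i X)"
proof -
  let ?I = "mode_indices 1 0 k"
  define a where "a i = S3_integral (\<lambda>x. f x * unit_mode k i x)" for i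
  define g where "g x = f x - (\<Sum>i\<in>?I. a i * unit_mode k i x)" for x
  have cf: "continuous_on S3 f" using f by (auto simp: laplace_eigenfunction_def intro: smooth_on_S3_continuous)
  have cu: "continuous_on S3 (unit_mode k i)" for k i by (intro continuous_on_real_polynomial unit_mode_polynomial)
  have g: "continuous_on S3 g" unfolding g_def by (intro continuous_intros cf cu)
  have "S3_integral (\<lambda>x. g x * unit_mode k' j x) = 0" if j: "j \<in> mode_indices 1 0 k'" for k' j
  proof -
    let ?u = "unit_mode k' j"
    have "(\<lambda>x. g x * ?u x) = (\<lambda>x. f x * ?u x + (\<Sum>i\<in>?I. - a i * (unit_mode k i x * ?u x)))"
      by (simp add: g_def fun_eq_iff left_diff_distrib sum_distrib_right sum_negf mult.assoc)
    then have "S3_integral (\<lambda>x. g x * ?u x) = S3_integral (\<lambda>x. f x * ?u x) + S3_integral (\<lambda>x. \<Sum>i\<in>?I. - a i * (unit_mode k i x * ?u x))"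
      by (simp only:) (intro S3_integral_add continuous_intros cf cu)
    also have "S3_integral (\<lambda>x. \<Sum>i\<in>?I. - a i * (unit_mode k i x * ?u x)) = (\<Sum>i\<in>?I. - a i * S3_integral (\<lambda>x. unit_mode k i x * ?u x))"
      by (intro S3_integral_sum finite_mode_indices continuous_intros cu)
    finally have eq: "S3_integral (\<lambda>x. g x * ?u x) = S3_integral (\<lambda>x. f x * ?u x) + \<dots>" .
    show ?thesis
    proof (cases "k' = k")
      case True
      have "(\<Sum>i\<in>?I. - a i * S3_integral (\<lambda>x. unit_mode k i x * ?u x)) = (\<Sum>i\<in>?I. if i = j then - a i else 0)"
        using j True by (intro sum.cong) (auto simp: unit_mode_orthonormal)
      also have "\<dots> = - a j" using j True by (simp add: finite_mode_indices)
      finally show ?thesis unfolding eq using True by (simp add: a_def)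
    next
      case False
      then show ?thesis
        unfolding eq using laplace_eigenfunctions_orthogonal[OF f unit_mode_eigenfunction[OF j]]
          laplace_eigenfunctions_orthogonal[OF unit_mode_eigenfunction unit_mode_eigenfunction[OF j], of _ 1 0 k] by simp
    qed
  qed
  from orthogonal_to_modes_eq_0[OF g this X] show ?thesis by (simp add: g_def a_def)
qed

section \<open>Lens spaces\<close>

definition on_S3 :: "(real^4 \<Rightarrow> real) \<Rightarrow> real^4 \<Rightarrow> real" where
  "on_S3 f x = (if x \<in> S3 then f x else 0)"

text \<open>\<open>from_toroidal\<close> picks its value by \<open>THE\<close>, which is meaningful
  only if all coordinates of a point agree on it. A function \<open>g\<close> of the point behind
  the coordinate expression guarantees this.\<close>

lemma from_toroidal_eq:
  assumes "\<And>x y z. h x y z = g (toroidal x y z)"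
  shows "from_toroidal h = on_S3 g"
proof
  fix X
  show "from_toroidal h X = on_S3 g X"
  proof (cases "X \<in> S3")
    case True
    obtain x y z where X: "x \<in> {0..pi/2}" "y \<in> {0..2*pi}" "z \<in> {0..2*pi}" "X = toroidal x y z"
      using toroidal_surj[OF True] .
    have "(THE v. \<exists>chi\<in>{0..pi/2}. \<exists>\<theta>\<in>{0..2*pi}. \<exists>\<phi>\<in>{0..2*pi}. X = toroidal chi \<theta> \<phi> \<and> v = h chi \<theta> \<phi>) = g X"
    proof (rule the_equality)
      show "\<exists>chi\<in>{0..pi/2}. \<exists>\<theta>\<in>{0..2*pi}. \<exists>\<phi>\<in>{0..2*pi}. X = toroidal chi \<theta> \<phi> \<and> g X = h chi \<theta> \<phi>"
        by (intro bexI[of _ x] bexI[of _ y] bexI[of _ z]) (use X assms in auto)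
    qed (use assms in auto)
    then show ?thesis using True by (simp add: from_toroidal_def on_S3_def)
  qed (simp add: from_toroidal_def on_S3_def)
qed

section \<open>The listed combinations as single torus modes\<close>

lemma mode_X_eq:
  "mode_X k l m x = cos x ^ nat \<bar>l\<bar> * sin x ^ nat \<bar>m\<bar> * poly (Jpoly (nat \<bar>m\<bar>) (nat \<bar>l\<bar>) (mode_deg k l m)) ((cos x)\<^sup>2)"
  unfolding mode_X_def by (simp add: cos_double_cos jacobi_eq_Jpoly)

text \<open>The product formula turns the two angular factors into a sum of torus modes with
  frequencies (|l|, |m|) and (|l|, - |m|). These live on the ambient space, so the coordinate
  expression is well defined also where an angle is not.\<close>

lemma Psi_toroidal: "Psi k l m (toroidal x y z) = mode_tilde k l m x y z / mode_norm k l m"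
  and Psi_outside: "X \<notin> S3 \<Longrightarrow> Psi k l m X = 0"
proof -
  \<comment> \<open>For negative frequency the angular factor is a sine, that is, a cosine shifted
    by pi / 2.\<close>
  define ph :: "int \<Rightarrow> real" where "ph n = (if n \<ge> 0 then 0 else - pi / 2)" for n
  let ?J = "Jpoly (nat \<bar>m\<bar>) (nat \<bar>l\<bar>) (mode_deg k l m)"
  define G where "G X = (1 / 2 * (torus_mode \<bar>l\<bar> \<bar>m\<bar> (ph l + ph m) ?J X + torus_mode \<bar>l\<bar> (- \<bar>m\<bar>) (ph l - ph m) ?J X)) / mode_norm k l m" for X
  have ang: "mode_angular n t = cos (of_int \<bar>n\<bar> * t + ph n)" for n t
    by (simp add: mode_angular_def ph_def cos_diff)
  have prod: "cos u * cos v = 1 / 2 * (cos (u + v) + cos (u - v))" for u v :: real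
    by (simp add: cos_add cos_diff)
  have "mode_tilde k l m x y z / mode_norm k l m = G (toroidal x y z)" for x y z
  proof -
    have e: "of_int \<bar>l\<bar> * y + ph l + (of_int \<bar>m\<bar> * z + ph m) = of_int \<bar>l\<bar> * y + of_int \<bar>m\<bar> * z + (ph l + ph m)"
      "of_int \<bar>l\<bar> * y + ph l - (of_int \<bar>m\<bar> * z + ph m) = of_int \<bar>l\<bar> * y + of_int (- \<bar>m\<bar>) * z + (ph l - ph m)"
      by simp_all
    have "mode_tilde k l m x y z = mode_X k l m x * (1 / 2 * (cos (of_int \<bar>l\<bar> * y + of_int \<bar>m\<bar> * z + (ph l + ph m))
        + cos (of_int \<bar>l\<bar> * y + of_int (- \<bar>m\<bar>) * z + (ph l - ph m))))"
      unfolding mode_tilde_def ang mult.assoc prod e ..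
    also have "\<dots> = G (toroidal x y z) * mode_norm k l m"
    proof -
      have "mode_norm k l m \<noteq> 0" using mode_scale_square(2)[of k l m] by (auto simp: mode_scale_def)
      then show ?thesis unfolding G_def mode_X_eq torus_mode_toroidal by (simp add: distrib_left)
    qed
    finally show ?thesis
      using mode_scale_square(2)[of k l m] by (auto simp: mode_scale_def)
  qed
  from from_toroidal_eq[of "\<lambda>x y z. mode_tilde k l m x y z / mode_norm k l m" G, OF this] this
  show "Psi k l m (toroidal x y z) = mode_tilde k l m x y z / mode_norm k l m" "X \<notin> S3 \<Longrightarrow> Psi k l m X = 0"
    by (simp_all add: Psi_def on_S3_def)
qed

definition sphere_mode :: "nat \<Rightarrow> int \<times> int \<times> real \<Rightarrow> real^4 \<Rightarrow> real" where
  "sphere_mode k i = on_S3 (unit_mode k i)"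

lemma S3_fun_eqI:
  assumes "\<And>x y z. f (toroidal x y z) = g (toroidal x y z)" "\<And>X. X \<notin> S3 \<Longrightarrow> f X = g X"
  shows "f = g"
proof
  fix X show "f X = g X"
  proof (cases "X \<in> S3")
    case True
    then show ?thesis using assms(1) by (metis toroidal_surj)
  qed (rule assms(2))
qed

lemma sphere_mode_toroidal:
  "sphere_mode k (l, m, \<delta>) (toroidal x y z) = mode_scale k l m * mode_X k l m x * cos (of_int l * y + of_int m * z + \<delta>)"
  by (simp add: sphere_mode_def on_S3_def unit_mode_def harmonic_def torus_mode_toroidal mode_X_eq mult.assoc)

lemma sphere_mode_outside: "X \<notin> S3 \<Longrightarrow> sphere_mode k i X = 0"
  by (simp add: sphere_mode_def on_S3_def)

lemma mode_sign [simp]: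
  "mode_norm k (- l) m = mode_norm k l m" "mode_norm k l (- m) = mode_norm k l m"
  "mode_X k (- l) m = mode_X k l m" "mode_X k l (- m) = mode_X k l m"
  by (simp_all add: mode_norm_def mode_X_def mode_deg_def fun_eq_iff)

text \<open>Addition theorems. cos cos + sin sin is the cosine of a difference, hence has frequency
  (l, - m); the opposite sign leads to (l, m). This decides which congruence goes with which
  sign.\<close>

lemma Psi_sphere_mode:
  "Psi k 0 0 = sphere_mode k (0, 0, 0)"
  "l > 0 \<Longrightarrow> Psi k l 0 = sphere_mode k (l, 0, 0)"
  "l > 0 \<Longrightarrow> Psi k (- l) 0 = sphere_mode k (l, 0, - pi / 2)"
  "m > 0 \<Longrightarrow> Psi k 0 m = sphere_mode k (0, m, 0)"
  "m > 0 \<Longrightarrow> Psi k 0 (- m) = sphere_mode k (0, m, - pi / 2)"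
  "l > 0 \<Longrightarrow> m > 0 \<Longrightarrow> (\<lambda>x. sqrt (1/2) * (Psi k l m x + Psi k (- l) (- m) x)) = sphere_mode k (l, - m, 0)"
  "l > 0 \<Longrightarrow> m > 0 \<Longrightarrow> (\<lambda>x. sqrt (1/2) * (Psi k (- l) m x - Psi k l (- m) x)) = sphere_mode k (l, - m, - pi / 2)"
  "l > 0 \<Longrightarrow> m > 0 \<Longrightarrow> (\<lambda>x. sqrt (1/2) * (Psi k l m x - Psi k (- l) (- m) x)) = sphere_mode k (l, m, 0)"
  "l > 0 \<Longrightarrow> m > 0 \<Longrightarrow> (\<lambda>x. sqrt (1/2) * (Psi k (- l) m x + Psi k l (- m) x)) = sphere_mode k (l, m, - pi / 2)"
  by (rule S3_fun_eqI; simp add: sphere_mode_toroidal Psi_toroidal Psi_outside sphere_mode_outside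
      mode_tilde_def mode_scale_def mode_angular_def cos_add sin_add cos_diff sin_diff
      add_divide_distrib diff_divide_distrib algebra_simps)+

text \<open>The five families are the parts of the half plane of frequencies: the origin, the
  positive axes of \<open>l\<close> and of \<open>m\<close>, and the open quadrants with m < 0 and m
  > 0. In terms of the frequency itself every congruence reads
  \<open>p dvd l + q * m\<close>.\<close>

lemma listed_modes:
  "{f. mode_exists k 0 0 \<and> f = Psi k 0 0} \<union>
      {f. \<exists>l>0. mode_exists k l 0 \<and> [l = 0] (mod p) \<and>
        (f = Psi k l 0 \<or> f = Psi k (- l) 0)} \<union>
      {f. \<exists>m>0. mode_exists k 0 m \<and> [q * m = 0] (mod p) \<and>
        (f = Psi k 0 m \<or> f = Psi k 0 (- m))} \<union>
      {f. \<exists>l>0. \<exists>m>0. mode_exists k l m \<and> [l = q * m] (mod p) \<and>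
        (f = (\<lambda>x. sqrt (1/2) * (Psi k l m x + Psi k (- l) (- m) x)) \<or>
         f = (\<lambda>x. sqrt (1/2) * (Psi k (- l) m x - Psi k l (- m) x)))} \<union>
      {f. \<exists>l>0. \<exists>m>0. mode_exists k l m \<and> [l = - (q * m)] (mod p) \<and>
        (f = (\<lambda>x. sqrt (1/2) * (Psi k l m x - Psi k (- l) (- m) x)) \<or>
         f = (\<lambda>x. sqrt (1/2) * (Psi k (- l) m x + Psi k l (- m) x)))}
   = sphere_mode k ` mode_indices p q k" (is "?L = ?R")
proof
  have c: "[l = 0] (mod p) \<longleftrightarrow> p dvd l + q * 0" "[q * m = 0] (mod p) \<longleftrightarrow> p dvd 0 + q * m"
    "[l = q * m] (mod p) \<longleftrightarrow> p dvd l + q * (- m)" "[l = - (q * m)] (mod p) \<longleftrightarrow> p dvd l + q * m" for l m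
    by (simp_all add: cong_iff_dvd_diff)
  have in_R: "sphere_mode k (l, m, \<delta>) \<in> ?R"
    if "l > 0 \<or> l = 0 \<and> m \<ge> 0" "mode_exists k l m" "p dvd l + q * m" "\<delta> = 0 \<or> \<delta> = - pi / 2 \<and> (l, m) \<noteq> (0, 0)" for l m \<delta>
    using that by (auto simp: mode_indices_def)
  show "?L \<subseteq> ?R"
  proof (intro Un_least subsetI)
    fix f assume "f \<in> {f. mode_exists k 0 0 \<and> f = Psi k 0 0}"
    then show "f \<in> ?R" using in_R[of 0 0 0] by (simp add: Psi_sphere_mode)
  next
    fix f assume "f \<in> {f. \<exists>l>0. mode_exists k l 0 \<and> [l = 0] (mod p) \<and> (f = Psi k l 0 \<or> f = Psi k (- l) 0)}"
    then obtain l where "l > 0" "mode_exists k l 0" "p dvd l + q * 0" "f = sphere_mode k (l, 0, 0) \<or> f = sphere_mode k (l, 0, - pi / 2)"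
      unfolding c by (auto simp: Psi_sphere_mode)
    then show "f \<in> ?R" using in_R[of l 0 0] in_R[of l 0 "- pi / 2"] by auto
  next
    fix f assume "f \<in> {f. \<exists>m>0. mode_exists k 0 m \<and> [q * m = 0] (mod p) \<and> (f = Psi k 0 m \<or> f = Psi k 0 (- m))}"
    then obtain m where "m > 0" "mode_exists k 0 m" "p dvd 0 + q * m" "f = sphere_mode k (0, m, 0) \<or> f = sphere_mode k (0, m, - pi / 2)"
      unfolding c by (auto simp: Psi_sphere_mode)
    then show "f \<in> ?R" using in_R[of 0 m 0] in_R[of 0 m "- pi / 2"] by auto
  next
    fix f assume "f \<in> {f. \<exists>l>0. \<exists>m>0. mode_exists k l m \<and> [l = q * m] (mod p) \<and>
        (f = (\<lambda>x. sqrt (1/2) * (Psi k l m x + Psi k (- l) (- m) x)) \<or>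
         f = (\<lambda>x. sqrt (1/2) * (Psi k (- l) m x - Psi k l (- m) x)))}"
    then obtain l m where lm: "l > 0" "m > 0" "mode_exists k l (- m)" "p dvd l + q * (- m)"
      and f: "f = sphere_mode k (l, - m, 0) \<or> f = sphere_mode k (l, - m, - pi / 2)"
      unfolding c using Psi_sphere_mode(6,7) by auto
    show "f \<in> ?R" using f in_R[of l "- m" 0] in_R[of l "- m" "- pi / 2"] lm by auto
  next
    fix f assume "f \<in> {f. \<exists>l>0. \<exists>m>0. mode_exists k l m \<and> [l = - (q * m)] (mod p) \<and>
        (f = (\<lambda>x. sqrt (1/2) * (Psi k l m x - Psi k (- l) (- m) x)) \<or>
         f = (\<lambda>x. sqrt (1/2) * (Psi k (- l) m x + Psi k l (- m) x)))}"
    then obtain l m where lm: "l > 0" "m > 0" "mode_exists k l m" "p dvd l + q * m"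
      and f: "f = sphere_mode k (l, m, 0) \<or> f = sphere_mode k (l, m, - pi / 2)"
      unfolding c using Psi_sphere_mode(8,9) by auto
    show "f \<in> ?R" using f in_R[of l m 0] in_R[of l m "- pi / 2"] lm by auto
  qed
  show "?R \<subseteq> ?L"
  proof
    fix f assume "f \<in> ?R"
    then obtain l m \<delta> where f: "f = sphere_mode k (l, m, \<delta>)" and half: "l > 0 \<or> l = 0 \<and> m \<ge> 0"
      and ex: "mode_exists k l m" and d: "p dvd l + q * m" and ph: "\<delta> = 0 \<or> \<delta> = - pi / 2 \<and> (l, m) \<noteq> (0, 0)"
      by (auto simp: mode_indices_def)
    consider "l = 0" "m = 0" | "l > 0" "m = 0" | "l = 0" "m > 0" | "l > 0" "m < 0" | "l > 0" "m > 0"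
      using half by linarith
    then show "f \<in> ?L"
    proof cases
      case 1
      then show ?thesis using f ex ph by (simp add: Psi_sphere_mode)
    next
      case 2
      then have "\<exists>l>0. mode_exists k l 0 \<and> [l = 0] (mod p) \<and> (f = Psi k l 0 \<or> f = Psi k (- l) 0)"
        unfolding c using f ex ph d by (intro exI[of _ l]) (auto simp: Psi_sphere_mode)
      then show ?thesis by blast
    next
      case 3
      then have "\<exists>m>0. mode_exists k 0 m \<and> [q * m = 0] (mod p) \<and> (f = Psi k 0 m \<or> f = Psi k 0 (- m))"
        unfolding c using f ex ph d by (intro exI[of _ m]) (auto simp: Psi_sphere_mode)
      then show ?thesis by blast
    next
      case 4
      then obtain n where n: "m = - n" "n > 0" by (metis minus_minus neg_less_0_iff_less)
      have "\<exists>l>0. \<exists>m>0. mode_exists k l m \<and> [l = q * m] (mod p) \<and>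
        (f = (\<lambda>x. sqrt (1/2) * (Psi k l m x + Psi k (- l) (- m) x)) \<or>
         f = (\<lambda>x. sqrt (1/2) * (Psi k (- l) m x - Psi k l (- m) x)))"
        unfolding c using f ex ph d 4 n Psi_sphere_mode(6,7)[of l n k]
        by (intro exI[of _ l] conjI exI[of _ n]) auto
      then show ?thesis by blast
    next
      case 5
      then have "\<exists>l>0. \<exists>m>0. mode_exists k l m \<and> [l = - (q * m)] (mod p) \<and>
        (f = (\<lambda>x. sqrt (1/2) * (Psi k l m x - Psi k (- l) (- m) x)) \<or>
         f = (\<lambda>x. sqrt (1/2) * (Psi k (- l) m x + Psi k l (- m) x)))"
        unfolding c using f ex ph d Psi_sphere_mode(8,9)[of l m k]
        by (intro exI[of _ l] exI[of _ m]) auto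
      then show ?thesis by blast
    qed
  qed
qed

section \<open>The action of the cyclic group on the modes\<close>

lemma periodic_int:
  fixes t :: real and n :: int
  shows "cos (t + of_int n * (2 * pi)) = cos t" "sin (t + of_int n * (2 * pi)) = sin t"
  using cos.plus_of_int[of t n] sin.plus_of_int[of t n] by simp_all

lemma lens_rot_power:
  "(lens_rot p q ^^ n) (toroidal x y z) = toroidal x (y + real n * (2 * pi / p)) (z + real n * (2 * pi * q / p))"
proof (induction n)
  case (Suc n)
  have "a + real n * b + b = a + real (Suc n) * b" for a b by (simp add: algebra_simps)
  then show ?case by (simp only: funpow.simps o_apply Suc.IH lens_rot_toroidal)
qed simp

text \<open>Real part of a geometric sum whose ratio is a p-th root of unity, equal to 1 exactly if
  \<open>p\<close> divides \<open>j\<close>.\<close>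

lemma sum_cos_arithmetic:
  fixes p j :: int
  assumes "p \<ge> 1"
  shows "(\<Sum>n<nat p. cos (u + real n * (2 * pi * j / p))) = (if p dvd j then p * cos u else 0)"
proof (cases "p dvd j")
  case True
  then obtain i where j: "j = p * i" by blast
  have "cos (u + real n * (2 * pi * j / p)) = cos u" for n
  proof -
    have "u + real n * (2 * pi * j / p) = u + of_int (int n * i) * (2 * pi)" using assms by (simp add: j)
    then show ?thesis using cos.plus_of_int[of u "int n * i"] by simp
  qed
  then show ?thesis using True assms by simp
next
  case False
  define w where "w = cis (2 * pi * j / p)"
  have w: "w ^ nat p = 1"
    using assms by (simp add: w_def Complex.DeMoivre)
  have "w \<noteq> 1"
  proof
    assume "w = 1"
    then have "cos (2 * pi * j / p) = 1" by (simp add: w_def complex_eq_iff)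
    then obtain i :: int where "2 * pi * j / p = of_int i * 2 * pi" using cos_one_2pi_int by blast
    then have "real_of_int j = of_int (i * p)" using assms by (simp add: field_simps)
    then have "j = i * p" by (simp only: of_int_eq_iff)
    then show False using False by simp
  qed
  then have "(\<Sum>n<nat p. w ^ n) = 0" using geometric_sum[of w "nat p"] w by simp
  then have "Re (\<Sum>n<nat p. cis u * w ^ n) = 0" by (simp flip: sum_distrib_left)
  moreover have "cis u * w ^ n = cis (u + real n * (2 * pi * j / p))" for n
    by (simp add: w_def Complex.DeMoivre cis_mult)
  ultimately show ?thesis using False by simp
qed

text \<open>The n-th power of the generator leaves chi alone and adds n times 2 pi (l + q m) / p to
  the phase, so the radial factor comes out and a sum of cosines in arithmetic progression
  remains.\<close>

lemma sphere_mode_average: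
  assumes p: "p \<ge> 1" and X: "X \<in> S3"
  shows "(\<Sum>n<nat p. sphere_mode k (l, m, \<delta>) ((lens_rot p q ^^ n) X)) =
    (if p dvd l + q * m then p * sphere_mode k (l, m, \<delta>) X else 0)"
proof -
  obtain x y z where X: "X = toroidal x y z" using toroidal_surj[OF X] by metis
  have "of_int l * (y + real n * (2 * pi / p)) + of_int m * (z + real n * (2 * pi * q / p)) + \<delta>
    = (of_int l * y + of_int m * z + \<delta>) + real n * (2 * pi * (l + q * m) / p)" for n
    using p by (simp add: field_simps)
  then have "(\<Sum>n<nat p. sphere_mode k (l, m, \<delta>) ((lens_rot p q ^^ n) X))
     = mode_scale k l m * mode_X k l m x * (\<Sum>n<nat p. cos ((of_int l * y + of_int m * z + \<delta>) + real n * (2 * pi * (l + q * m) / p)))"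
    unfolding X lens_rot_power sphere_mode_toroidal by (simp only: sum_distrib_left)
  then show ?thesis
    unfolding sum_cos_arithmetic[OF p] by (simp add: X sphere_mode_toroidal)
qed

section \<open>Orbits and descent to the quotient\<close>

lemma lens_rot_power_S3:
  assumes "X \<in> S3"
  shows "(lens_rot p q ^^ n) X \<in> S3"
proof -
  obtain x y z where X: "X = toroidal x y z" using toroidal_surj[OF assms] by metis
  show ?thesis unfolding X lens_rot_power by (rule toroidal_in_S3)
qed

lemma lens_rot_order:
  assumes "p \<ge> 1" "X \<in> S3"
  shows "(lens_rot p q ^^ nat p) X = X"
proof -
  obtain x y z where X: "X = toroidal x y z" using toroidal_surj[OF assms(2)] by metis
  have "real (nat p) * (2 * pi / p) = 2 * pi" "real (nat p) * (2 * pi * q / p) = of_int q * (2 * pi)"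
    using assms(1) by simp_all
  then show ?thesis
    unfolding X lens_rot_power by (simp only: toroidal_def periodic_int sin_periodic cos_periodic)
qed

text \<open>Orbits consist of natural powers, so finite order is what puts \<open>X\<close> itself
  into the orbit of its image: it is reached after \<open>nat p - 1\<close> further
  rotations.\<close>

lemma lens_orbit_rot:
  assumes p: "p \<ge> 1" and X: "X \<in> S3"
  shows "lens_orbit p q (lens_rot p q X) = lens_orbit p q X"
proof -
  have e: "(lens_rot p q ^^ n) (lens_rot p q X) = (lens_rot p q ^^ Suc n) X" for n
    by (simp add: funpow_swap1)
  have "\<exists>n'. (lens_rot p q ^^ n) X = (lens_rot p q ^^ Suc n') X" for n
  proof (cases n)
    case 0
    then have "(lens_rot p q ^^ n) X = (lens_rot p q ^^ Suc (nat p - 1)) X"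
      using lens_rot_order[OF p X] p by (simp del: funpow.simps(2) add: Suc_diff_1)
    then show ?thesis by blast
  qed blast
  then show ?thesis unfolding lens_orbit_def e by blast
qed

lemma lens_orbit_subset: "X \<in> S3 \<Longrightarrow> lens_orbit p q X \<subseteq> S3"
  unfolding lens_orbit_def using lens_rot_power_S3 by blast

lemma lens_orbit_self: "X \<in> lens_orbit p q X"
  unfolding lens_orbit_def by (auto intro: exI[of _ 0])

lemma lens_orbit_in_lens_space: "lens_orbit p q X \<in> lens_space p q \<longleftrightarrow> X \<in> S3"
  unfolding lens_space_def using lens_orbit_subset lens_orbit_self by blast

text \<open>For an invariant \<open>f\<close> the choice of the representative does not affect the
  value; outside the lens space the value is 0, as \<open>lens_functions\<close> demands.\<close>

definition lens_descend :: "int \<Rightarrow> int \<Rightarrow> (real^4 \<Rightarrow> real) \<Rightarrow> (real^4) set \<Rightarrow> real" where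
  "lens_descend p q f c = (if c \<in> lens_space p q then f (SOME x. x \<in> S3 \<and> lens_orbit p q x = c) else 0)"

lemma lens_descend_in_lens_functions: "lens_descend p q f \<in> lens_functions p q"
  by (simp add: lens_functions_def lens_descend_def)

lemma lens_lift_descend:
  assumes inv: "\<And>X. X \<in> S3 \<Longrightarrow> f (lens_rot p q X) = f X" and out: "\<And>X. X \<notin> S3 \<Longrightarrow> f X = 0"
  shows "lens_lift p q (lens_descend p q f) = f"
proof
  fix X
  show "lens_lift p q (lens_descend p q f) X = f X"
  proof (cases "X \<in> S3")
    case True
    have pow: "f ((lens_rot p q ^^ n) Y) = f Y" if "Y \<in> S3" for n Y
      using inv lens_rot_power_S3[OF that] by (induction n) auto
    define Y where "Y = (SOME x. x \<in> S3 \<and> lens_orbit p q x = lens_orbit p q X)"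
    have Y: "Y \<in> S3 \<and> lens_orbit p q Y = lens_orbit p q X"
      unfolding Y_def by (rule someI[of _ X]) (use True in auto)
    then have "X \<in> lens_orbit p q Y" using lens_orbit_self by blast
    then obtain n where "X = (lens_rot p q ^^ n) Y" by (auto simp: lens_orbit_def)
    then have "f X = f Y" using pow Y by simp
    then show ?thesis
      using True by (simp add: lens_lift_def lens_descend_def lens_orbit_in_lens_space Y_def)
  qed (simp add: lens_lift_def lens_descend_def lens_orbit_in_lens_space out)
qed

lemma lens_lift_inject:
  assumes "F \<in> lens_functions p q" "G \<in> lens_functions p q" "\<And>X. X \<in> S3 \<Longrightarrow> lens_lift p q F X = lens_lift p q G X"
  shows "F = G"
proof
  fix c show "F c = G c"
  proof (cases "c \<in> lens_space p q")
    case True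
    then obtain X where "X \<in> S3" "c = lens_orbit p q X" by (auto simp: lens_space_def)
    then show ?thesis using assms(3)[of X] by (simp add: lens_lift_def)
  qed (use assms in \<open>simp add: lens_functions_def\<close>)
qed

lemma sphere_mode_invariant:
  assumes "i \<in> mode_indices p q k" "p \<ge> 1" and X: "X \<in> S3"
  shows "sphere_mode k i (lens_rot p q X) = sphere_mode k i X"
proof -
  obtain l m \<delta> where i: "i = (l, m, \<delta>)" by (cases i)
  obtain x y z where X: "X = toroidal x y z" using toroidal_surj[OF X] by metis
  obtain j where "l + q * m = p * j" using assms(1) by (auto simp: i mode_indices_def)
  then have "real_of_int l + q * m = p * j" by (metis of_int_add of_int_mult)
  then have "(of_int l + of_int q * of_int m) / of_int p = real_of_int j" using assms(2) by (simp add: field_simps)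
  moreover have "of_int l * (y + 2 * pi / p) + of_int m * (z + 2 * pi * q / p) + \<delta>
     = of_int l * y + of_int m * z + \<delta> + (of_int l + of_int q * of_int m) / of_int p * (2 * pi)"
    using assms(2) by (simp add: field_simps)
  ultimately show ?thesis
    unfolding X i lens_rot_toroidal sphere_mode_toroidal by (simp only: periodic_int)
qed

text \<open>\<open>fun_span\<close> indexes coefficients by the functions themselves, so the
  coefficients of indices with the same \<open>h i\<close> are merged.\<close>

lemma fun_span_sum:
  assumes "finite I" "\<And>i. i \<in> I \<Longrightarrow> h i \<in> B"
  shows "(\<lambda>x. \<Sum>i\<in>I. a i * h i x) \<in> fun_span B"
proof -
  have "(\<Sum>i\<in>I. a i * h i x) = (\<Sum>b\<in>h ` I. (\<Sum>i\<in>{i \<in> I. h i = b}. a i) * b x)" for x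
    unfolding sum.image_gen[OF assms(1), of "\<lambda>i. a i * h i x" h] sum_distrib_right
    by (intro sum.cong) auto
  then show ?thesis
    unfolding fun_span_def using assms
    by (intro CollectI exI[of _ "h ` I"] exI[of _ "\<lambda>b. \<Sum>i\<in>{i \<in> I. h i = b}. a i"]) auto
qed

theorem theorem2:
  fixes p q :: int and k :: nat
  assumes "p \<ge> 1" and "coprime p q"
  shows "\<exists>B. orthonormal_basis (lens_inner p q) (lens_eigenspace p q k) B \<and>
    lens_lift p q ` B =
      {f. mode_exists k 0 0 \<and> f = Psi k 0 0} \<union>
      {f. \<exists>l>0. mode_exists k l 0 \<and> [l = 0] (mod p) \<and>
        (f = Psi k l 0 \<or> f = Psi k (- l) 0)} \<union>
      {f. \<exists>m>0. mode_exists k 0 m \<and> [q * m = 0] (mod p) \<and>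
        (f = Psi k 0 m \<or> f = Psi k 0 (- m))} \<union>
      {f. \<exists>l>0. \<exists>m>0. mode_exists k l m \<and> [l = q * m] (mod p) \<and>
        (f = (\<lambda>x. sqrt (1/2) * (Psi k l m x + Psi k (- l) (- m) x)) \<or>
         f = (\<lambda>x. sqrt (1/2) * (Psi k (- l) m x - Psi k l (- m) x)))} \<union>
      {f. \<exists>l>0. \<exists>m>0. mode_exists k l m \<and> [l = - (q * m)] (mod p) \<and>
        (f = (\<lambda>x. sqrt (1/2) * (Psi k l m x - Psi k (- l) (- m) x)) \<or>
         f = (\<lambda>x. sqrt (1/2) * (Psi k (- l) m x + Psi k l (- m) x)))}"
proof -
  let ?I = "mode_indices p q k"
  note p = \<open>p \<ge> 1\<close>
  define b where "b i = lens_descend p q (sphere_mode k i)" for i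
  have lift: "lens_lift p q (b i) = sphere_mode k i" if "i \<in> ?I" for i
    unfolding b_def by (rule lens_lift_descend) (use that p sphere_mode_invariant sphere_mode_outside in auto)
  have bfun: "b i \<in> lens_functions p q" for i
    unfolding b_def by (rule lens_descend_in_lens_functions)
  have inner: "lens_inner p q (b i) (b j) = (if i = j then 1 else 0)" if "i \<in> ?I" "j \<in> ?I" for i j
  proof -
    have "lens_inner p q (b i) (b j) = S3_integral (\<lambda>x. unit_mode k i x * unit_mode k j x)"
      unfolding lens_inner_def lift[OF that(1)] lift[OF that(2)]
      by (rule S3_integral_cong) (simp add: sphere_mode_def on_S3_def)
    then show ?thesis using unit_mode_orthonormal[OF that] by simp
  qed
  \<comment> \<open>If two indices gave the same function, its inner product with itself would be
    both 0 and 1.\<close>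
  have inj: "b i = b j \<longleftrightarrow> i = j" if "i \<in> ?I" "j \<in> ?I" for i j
    using inner[OF that] inner[OF that(1) that(1)] by (metis one_neq_zero)
  have span: "fun_span (b ` ?I) = lens_eigenspace p q k"
  proof (intro equalityI subsetI)
    fix F assume "F \<in> fun_span (b ` ?I)"
    then obtain A c where A: "finite A" "A \<subseteq> b ` ?I" and F: "F = (\<lambda>x. \<Sum>h\<in>A. c h * h x)"
      by (auto simp: fun_span_def)
    \<comment> \<open>A set of basis functions is replaced by a set of indices, so that the
      coefficients can be attached to modes.\<close>
    obtain J where J: "J \<subseteq> ?I" "A = b ` J" using A(2) by (auto simp: subset_image_iff)
    have fin: "finite J" using J(1) finite_mode_indices finite_subset by blast
    have "inj_on b J" by (rule inj_onI) (use inj J(1) in blast)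
    then have F': "F = (\<lambda>x. \<Sum>i\<in>J. c (b i) * b i x)" unfolding F J(2) by (simp add: sum.reindex)
    let ?u = "\<lambda>x. \<Sum>i\<in>J. c (b i) * unit_mode k i x"
    have "lens_lift p q F = (\<lambda>x. \<Sum>i\<in>J. c (b i) * lens_lift p q (b i) x)"
      by (simp add: F' lens_lift_def fun_eq_iff)
    also have "\<dots> = (\<lambda>x. \<Sum>i\<in>J. c (b i) * sphere_mode k i x)"
      using lift J(1) by (intro ext sum.cong) auto
    finally have eq: "?u x = lens_lift p q F x" if "x \<in> S3" for x
      using that by (simp add: sphere_mode_def on_S3_def)
    have u: "laplace_eigenfunction k ?u"
      using J(1) by (intro laplace_eigenfunction_sum fin unit_mode_polynomial unit_mode_eigenfunction) auto
    have "F \<in> lens_functions p q"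
      using bfun by (simp add: F' lens_functions_def)
    moreover have "smooth_on_S3 (lens_lift p q F)"
      using u smooth_on_S3_cong[of ?u "lens_lift p q F"] eq by (simp add: laplace_eigenfunction_def)
    moreover have "S3_laplacian (lens_lift p q F) x = - (real k * (real k + 2)) * lens_lift p q F x" if "x \<in> S3" for x
      using u S3_laplacian_cong[of ?u "lens_lift p q F" x] eq that by (simp add: laplace_eigenfunction_def)
    ultimately show "F \<in> lens_eigenspace p q k" by (simp add: lens_eigenspace_def)
  next
    fix F assume F: "F \<in> lens_eigenspace p q k"
    define f where "f = lens_lift p q F"
    have eig: "laplace_eigenfunction k f" and Ffun: "F \<in> lens_functions p q"
      using F by (auto simp: lens_eigenspace_def laplace_eigenfunction_def f_def)
    define a where "a i = S3_integral (\<lambda>x. f x * unit_mode k i x)" for i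
    have exp: "f X = (\<Sum>i\<in>mode_indices 1 0 k. a i * sphere_mode k i X)" if "X \<in> S3" for X
      using eigenfunction_expansion[OF eig that] that by (simp add: a_def sphere_mode_def on_S3_def)
    have finv: "f ((lens_rot p q ^^ n) X) = f X" if "X \<in> S3" for n X
    proof (induction n)
      case (Suc n)
      then show ?case
        using lens_orbit_rot[OF p lens_rot_power_S3[OF that]] by (simp add: f_def lens_lift_def)
    qed simp
    have sub: "?I \<subseteq> mode_indices 1 0 k"
      by (auto simp: mode_indices_def)
    have "f X = (\<Sum>i\<in>?I. a i * sphere_mode k i X)" if X: "X \<in> S3" for X
    proof -
      \<comment> \<open>Summation over the group multiplies the invariant \<open>f\<close> by
        \<open>p\<close>, and on the right it does the same to the modes in \<open>?I\<close> and
        removes the others, so the expansion restricts to \<open>?I\<close> with unchanged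
        coefficients.\<close>
      have "of_int p * f X = (\<Sum>n<nat p. f ((lens_rot p q ^^ n) X))"
        using p by (simp add: finv[OF X])
      also have "\<dots> = (\<Sum>i\<in>mode_indices 1 0 k. a i * (\<Sum>n<nat p. sphere_mode k i ((lens_rot p q ^^ n) X)))"
        by (simp only: exp[OF lens_rot_power_S3[OF X]] sum_distrib_left sum.swap[of _ "mode_indices 1 0 k"])
      also have "\<dots> = (\<Sum>i\<in>mode_indices 1 0 k. if i \<in> ?I then of_int p * (a i * sphere_mode k i X) else 0)"
      proof (intro sum.cong refl)
        fix i assume i: "i \<in> mode_indices 1 0 k"
        obtain l m \<delta> where "i = (l, m, \<delta>)" by (cases i)
        moreover from this have "i \<in> ?I \<longleftrightarrow> p dvd l + q * m" using i by (auto simp: mode_indices_def)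
        ultimately show "a i * (\<Sum>n<nat p. sphere_mode k i ((lens_rot p q ^^ n) X)) = (if i \<in> ?I then of_int p * (a i * sphere_mode k i X) else 0)"
          by (simp add: sphere_mode_average[OF p X])
      qed
      also have "\<dots> = (\<Sum>i\<in>?I. of_int p * (a i * sphere_mode k i X))"
        by (subst sum.inter_restrict[symmetric, OF finite_mode_indices]) (simp only: Int_absorb1[OF sub])
      also have "\<dots> = of_int p * (\<Sum>i\<in>?I. a i * sphere_mode k i X)" by (simp add: sum_distrib_left)
      finally show ?thesis using p by simp
    qed
    then have "lens_lift p q F X = lens_lift p q (\<lambda>c. \<Sum>i\<in>?I. a i * b i c) X" if "X \<in> S3" for X
      using that lift by (simp add: f_def lens_lift_def fun_eq_iff)
    then have "F = (\<lambda>c. \<Sum>i\<in>?I. a i * b i c)"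
      by (intro lens_lift_inject[OF Ffun]) (use bfun in \<open>auto simp: lens_functions_def\<close>)
    then show "F \<in> fun_span (b ` ?I)"
      using fun_span_sum[OF finite_mode_indices, of p q k b "b ` ?I" a] by simp
  qed
  have "orthonormal_basis (lens_inner p q) (lens_eigenspace p q k) (b ` ?I)"
    unfolding orthonormal_basis_def span using inner inj by auto
  moreover have "lens_lift p q ` b ` ?I = sphere_mode k ` ?I"
    using lift by (force simp: image_image)
  ultimately show ?thesis unfolding listed_modes by blast
qed

end
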